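(* Let $c\ge 1$ and let $n_1\ge n_2\ge\cdots\ge n_c\ge 1$ be integers. (1) Let $S=S(n_1-1,\ldots,n_c-1)$. The universal Gröbner basis of $S$ does not equal its Graver basis, i.e. $\mathrm{UGB}(A_S)\neq\mathcal G(A_S)$, if and only if $S$ dominates $S(6)$, $S(5,4)$, or $S(4,3,2)$. (2) Let $H=H(n_1,\ldots,n_c)$. The universal Gröbner basis of $H$ does not equal its Graver basis, i.e. $\mathrm{UGB}(A_H)\neq\mathcal G(A_H)$, if and only if $H$ dominates $H(7)$, $H(6,2)$, or $H(4,3)$.
   Context: Toric ideals. Let $k$ be a field and $A\in\mathbb Z^{d\times n}$. Write $\mathbf u\in\mathbb Z^n$ as $\mathbf u=\mathbf u^+-\mathbf u^-$ with $\mathbf u^+,\mathbf u^-$ nonnegative of disjoint support. The toric ideal of $A$ is $I_A=\langle \mathbf x^{\mathbf u^+}-\mathbf x^{\mathbf u^-} : \mathbf u\in\mathbb Z^n,\ A\mathbf u=0\rangle\subseteq k[x_1,\ldots,x_n]$. Binomials $\mathbf x^{\mathbf u^+}-\mathbf x^{\mathbf u^-}$ are identified with vectors $\mathbf u\in\ker_{\mathbb Z}A$, considered up to sign. Universal Gröbner basis: $\mathrm{UGB}(A)$ is the union of all the (finitely many) reduced Gröbner bases of $I_A$. Graver basis: $\mathcal G(A)$ is the set of all nonzero binomials $\mathbf x^{\mathbf u^+}-\mathbf x^{\mathbf u^-}\in I_A$ for which there is no other nonzero binomial $\mathbf x^{\mathbf v^+}-\mathbf x^{\mathbf v^-}\in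 I_A$ such that $\mathbf x^{\mathbf v^+}$ divides $\mathbf x^{\mathbf u^+}$ and $\mathbf x^{\mathbf v^-}$ divides $\mathbf x^{\mathbf u^-}$ (primitive binomials). One always has $\mathrm{UGB}(A)\subseteq\mathcal G(A)$. The two families. Let $e_1,\ldots,e_c$ be the standard basis of $\mathbb Z^c$ and let $n_1\ge\cdots\ge n_c\ge1$. The matrix $A_{S(n_1-1,\ldots,n_c-1)}$ has $c+1$ rows and $n_1+\cdots+n_c$ columns, namely the vectors $(i,e_j)\in\mathbb Z\times\mathbb Z^c$ for $1\le j\le c$, $1\le i\le n_j$ (it defines a rational normal scroll; note that the argument $n_j-1$ corresponds to a block of $n_j$ columns). The matrix $A_{H(n_1,\ldots,n_c)}$ has $c+1$ rows and $n_1+\cdots+n_c$ columns, namely the vectors $(1,i\,e_j)\in\mathbb Z\times\mathbb Z^c$ for $1\le j\le c$, $1\le i\le n_j$. The universal Gröbner basis (Graver basis) of $S(\cdot)$ or $H(\cdot)$ means that of the corresponding matrix. Dominance. For weakly decreasing sequences, $(a_1,\ldots,a_c)\preceq(b_1,\ldots,b_d)$ if $c\le d$ and $a_j\le b_j$ for $j=1,\ldots,c$. We say $S(b_1,\ldots,b_d)$ dominates $S(a_1,\ldots,a_c)$, and $H(b_1,\ldots,b_d)$ dominates $H(a_1,\ldots,a_c)$, if $(a_1,\ldots,a_c)\preceq(b_1,\ldots,b_d)$ (comparing the listed arguments). *)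

theory Defs
  imports
    "HOL-Library.Poly_Mapping"
    "HOL-Algebra.Ideal"
    "Jordan_Normal_Form.Matrix"
begin

section \<open>Polynomial rings\<close>

text \<open>A monomial is its exponent vector, so products of monomials are sums of exponent vectors.
  The variables of \<open>k[x\<^sub>1,\<dots>,x\<^sub>n]\<close> are indexed by \<open>{..<n}\<close>.\<close>

type_synonym monom = "nat \<Rightarrow>\<^sub>0 nat"
type_synonym 'k mpoly = "monom \<Rightarrow>\<^sub>0 'k"

definition monoms :: "nat \<Rightarrow> monom set" where
  "monoms n = {t. Poly_Mapping.keys t \<subseteq> {..<n}}"

definition poly_ring :: "nat \<Rightarrow> ('k::field) mpoly ring" where
  "poly_ring n = \<lparr>carrier = {f. Poly_Mapping.keys f \<subseteq> monoms n},
     monoid.mult = (*), one = 1, ring.zero = 0, add = (+)\<rparr>"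

definition mono_dvd :: "monom \<Rightarrow> monom \<Rightarrow> bool" where
  "mono_dvd s t \<longleftrightarrow> (\<exists>r. t = s + r)"

lemma poly_ring_simps [simp]:
  "carrier (poly_ring n) = {f. Poly_Mapping.keys f \<subseteq> monoms n}"
  "x \<otimes>\<^bsub>poly_ring n\<^esub> y = x * y" "\<one>\<^bsub>poly_ring n\<^esub> = 1"
  "x \<oplus>\<^bsub>poly_ring n\<^esub> y = x + y" "\<zero>\<^bsub>poly_ring n\<^esub> = 0"
  by (simp_all add: poly_ring_def)

lemma monoms_add: "s \<in> monoms n \<Longrightarrow> t \<in> monoms n \<Longrightarrow> s + t \<in> monoms n"
  using Poly_Mapping.keys_add[of s t] by (auto simp: monoms_def)

lemma cring_poly_ring: "cring (poly_ring n :: ('k::field) mpoly ring)"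
proof (rule cringI)
  show "abelian_group (poly_ring n :: 'k mpoly ring)"
  proof (rule abelian_groupI)
    fix x y :: "'k mpoly"
    assume "x \<in> carrier (poly_ring n)" "y \<in> carrier (poly_ring n)"
    then show "x \<oplus>\<^bsub>poly_ring n\<^esub> y \<in> carrier (poly_ring n)"
      using Poly_Mapping.keys_add[of x y] by auto
  next
    fix x :: "'k mpoly"
    assume "x \<in> carrier (poly_ring n)"
    then show "\<exists>y\<in>carrier (poly_ring n). y \<oplus>\<^bsub>poly_ring n\<^esub> x = \<zero>\<^bsub>poly_ring n\<^esub>"
      by (intro bexI[of _ "- x"]) auto
  qed (auto simp: ac_simps)
  show "comm_monoid (poly_ring n :: 'k mpoly ring)"
  proof (rule comm_monoidI)
    fix x y :: "'k mpoly"
    assume "x \<in> carrier (poly_ring n)" "y \<in> carrier (poly_ring n)"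
    then show "x \<otimes>\<^bsub>poly_ring n\<^esub> y \<in> carrier (poly_ring n)"
      using Poly_Mapping.keys_mult[of x y] monoms_add[of _ n] by fastforce
  qed (auto simp: ac_simps monoms_def)
qed (auto simp: algebra_simps)


section \<open>Universal Groebner bases\<close>

definition term_order :: "nat \<Rightarrow> monom rel \<Rightarrow> bool" where
  "term_order n r \<longleftrightarrow> linear_order_on (monoms n) r \<and>
     (\<forall>t\<in>monoms n. (0, t) \<in> r) \<and>
     (\<forall>s\<in>monoms n. \<forall>t\<in>monoms n. \<forall>u\<in>monoms n. (s, t) \<in> r \<longrightarrow> (s + u, t + u) \<in> r)"

text \<open>The leading monomial is meaningful only for nonzero polynomials.\<close>

definition lead_mon :: "monom rel \<Rightarrow> ('k::field) mpoly \<Rightarrow> monom" where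
  "lead_mon r f = (THE t. t \<in> Poly_Mapping.keys f \<and> (\<forall>s\<in>Poly_Mapping.keys f. (s, t) \<in> r))"

definition initial_ideal :: "nat \<Rightarrow> monom rel \<Rightarrow> ('k::field) mpoly set \<Rightarrow> 'k mpoly set" where
  "initial_ideal n r F =
     Idl\<^bsub>poly_ring n\<^esub> ((\<lambda>f. Poly_Mapping.single (lead_mon r f) 1) ` (F - {0}))"

definition groebner_basis ::
    "nat \<Rightarrow> monom rel \<Rightarrow> ('k::field) mpoly set \<Rightarrow> 'k mpoly set \<Rightarrow> bool" where
  "groebner_basis n r I G \<longleftrightarrow>
     finite G \<and> G \<subseteq> I \<and> initial_ideal n r G = initial_ideal n r I"

text \<open>The condition on leading coefficients also excludes \<open>0 \<in> G\<close>.\<close>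

definition reduced_groebner_basis ::
    "nat \<Rightarrow> monom rel \<Rightarrow> ('k::field) mpoly set \<Rightarrow> 'k mpoly set \<Rightarrow> bool" where
  "reduced_groebner_basis n r I G \<longleftrightarrow> groebner_basis n r I G \<and>
     (\<forall>g\<in>G. Poly_Mapping.lookup g (lead_mon r g) = 1) \<and>
     (\<forall>g\<in>G. \<forall>h\<in>G. h \<noteq> g \<longrightarrow> (\<forall>t\<in>Poly_Mapping.keys h. \<not> mono_dvd (lead_mon r g) t))"


section \<open>Toric ideals\<close>

definition pos_part :: "int vec \<Rightarrow> monom" where
  "pos_part u = Abs_poly_mapping (\<lambda>i. if i < dim_vec u then nat (u $ i) else 0)"

definition neg_part :: "int vec \<Rightarrow> monom" where
  "neg_part u = Abs_poly_mapping (\<lambda>i. if i < dim_vec u then nat (- (u $ i)) else 0)"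

lemma lookup_pos_part:
  "Poly_Mapping.lookup (pos_part u) i = (if i < dim_vec u then nat (u $ i) else 0)"
  unfolding pos_part_def by (subst lookup_Abs_poly_mapping) auto

lemma lookup_neg_part:
  "Poly_Mapping.lookup (neg_part u) i = (if i < dim_vec u then nat (- (u $ i)) else 0)"
  unfolding neg_part_def by (subst lookup_Abs_poly_mapping) auto

definition binom :: "int vec \<Rightarrow> ('k::field) mpoly" where
  "binom u = Poly_Mapping.single (pos_part u) 1 - Poly_Mapping.single (neg_part u) 1"

definition toric_ideal :: "int mat \<Rightarrow> ('k::field) mpoly set" where
  "toric_ideal A = Idl\<^bsub>poly_ring (dim_col A)\<^esub>
     {binom u | u. u \<in> carrier_vec (dim_col A) \<and> A *\<^sub>v u = 0\<^sub>v (dim_row A)}"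

definition ugb :: "int mat \<Rightarrow> ('k::field) mpoly set" where
  "ugb A = \<Union> {G. \<exists>r. term_order (dim_col A) r \<and>
     reduced_groebner_basis (dim_col A) r (toric_ideal A) G}"

definition graver :: "int mat \<Rightarrow> ('k::field) mpoly set" where
  "graver A = {binom u | u.
     u \<in> carrier_vec (dim_col A) \<and> (binom u :: 'k mpoly) \<in> toric_ideal A \<and>
     (binom u :: 'k mpoly) \<noteq> 0 \<and>
     \<not> (\<exists>v \<in> carrier_vec (dim_col A). (binom v :: 'k mpoly) \<in> toric_ideal A \<and>
          (binom v :: 'k mpoly) \<noteq> 0 \<and> (binom v :: 'k mpoly) \<noteq> binom u \<and>
          mono_dvd (pos_part v) (pos_part u) \<and> mono_dvd (neg_part v) (neg_part u))}"

text \<open>A reduced Groebner basis contains only one of \<open>f\<close> and \<open>- f\<close>, with the sign chosen by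
  the term order, whereas the Graver basis contains both; bases are compared up to sign.\<close>

definition up_to_sign :: "('k::field) mpoly set \<Rightarrow> 'k mpoly set set" where
  "up_to_sign F = (\<lambda>f. {f, - f}) ` F"


section \<open>The two families of matrices\<close>

text \<open>Coordinates \<open>j\<close> are counted from 0, so \<open>e\<^sub>j\<close> is \<open>unit_vec c (j - 1)\<close>.
  The matrix of \<open>S(a\<^sub>1,\<dots>,a\<^sub>c)\<close> has blocks of \<open>a\<^sub>1 + 1, \<dots>, a\<^sub>c + 1\<close> columns,
  that of \<open>H(a\<^sub>1,\<dots>,a\<^sub>c)\<close> has blocks of \<open>a\<^sub>1, \<dots>, a\<^sub>c\<close> columns.\<close>

definition S_mat :: "nat list \<Rightarrow> int mat" where
  "S_mat as = (let c = length as in mat_of_cols (c + 1)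
     [vCons (int i) (unit_vec c j). j \<leftarrow> [0..<c], i \<leftarrow> [1..<as ! j + 2]])"

definition H_mat :: "nat list \<Rightarrow> int mat" where
  "H_mat as = (let c = length as in mat_of_cols (c + 1)
     [vCons 1 (int i \<cdot>\<^sub>v unit_vec c j). j \<leftarrow> [0..<c], i \<leftarrow> [1..<as ! j + 1]])"

definition dominates :: "nat list \<Rightarrow> nat list \<Rightarrow> bool" where
  "dominates bs as \<longleftrightarrow> length as \<le> length bs \<and> (\<forall>j<length as. as ! j \<le> bs ! j)"

end

(*
  For a primitive u in ker A the binomial of u is, up to sign, in the universal Groebner basis if some linear
  functional vanishes on u and is positive on w - u^- for all other points w of the fiber of u^- with support in
  that of u: such a functional refines to a term order in which u^- is the least monomial of its fiber and u^+ is a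
  minimal generator of the initial ideal. Conversely, a relation k u^+ + (K - k) u^- = w_1 + ... + w_K with
  points w_i of the fiber other than u^+ and u^- shows that u is in no reduced Groebner basis. For the six minimal
  matrices such a relation is given explicitly, and it extends by zero to all dominating ones.

  In the remaining cases every u has to be separated by a functional. A block in which u has at most two nonzero
  entries has a one-dimensional kernel on the support of u, so there the points of the fiber are conformal to u. All
  blocks except two can be treated in this way, and they enter only through the values of their minimal balanced
  vectors. So they can be replaced by a single block with the columns (0, 1), ..., (0, m), which leaves finitely many
  finite problems: enumerate the primitive vectors on two small blocks and the auxiliary one, and compute a
  functional for each.
*)

theory Submission
  imports Defs "HOL-Library.Multiset"
begin

section \<open>Monomial ideals\<close>

text \<open>Geometrically, a functional as above makes the segment from \<open>u^-\<close> to
  \<open>u^+\<close> an edge of the convex hull of its fiber, and a relation puts a point of this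
  segment into the hull of other fiber points. The obstacle is that the number of blocks is
  unbounded and that many of them might have three or more nonzero entries. The computation itself
  settles this: if two such blocks exist, two of them are made explicit, and in every primitive
  vector found with both of them large the auxiliary part is at most one unit, of absolute value
  other than 1. In the widths at issue such a unit has at most two nonzero entries, so there is no
  third large block. Replacing the remaining blocks by counts of values loses nothing: in a
  primitive vector the values of the units outside the two blocks are nonzero and never opposite, so
  signed counts determine them, and in small blocks the splitting into units is unique. The bound
  \<open>m\<close> is one less than the largest width among the remaining blocks, because a unit of
  the first family has a difference of two positions as its value; in the second family three
  columns also give values up to 2.\<close>

abbreviation (input) lk where "lk \<equiv> Poly_Mapping.lookup"
abbreviation (input) ks where "ks \<equiv> Poly_Mapping.keys"
abbreviation (input) sg where "sg \<equiv> Poly_Mapping.single"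

lemma mapping_sum_singles: "f = (\<Sum>t\<in>ks f. sg t (lk f t))"
proof (rule poly_mapping_eqI)
  fix s
  show "lk f s = lk (\<Sum>t\<in>ks f. sg t (lk f t)) s"
    by (simp add: lookup_sum lookup_single when_def sum.delta in_keys_iff)
qed

lemma ring_poly_ring: "ring (poly_ring n :: ('k::field) mpoly ring)"
  using cring_poly_ring cring.axioms(1) by blast

text \<open>A polynomial is a sum of terms, so closure under multiplication by single terms gives
  closure under all multiples; negatives are the case \<open>sg 0 (-1)\<close>.\<close>

lemma ideal_poly_ringI:
  fixes J :: "('k::field) mpoly set"
  assumes J: "J \<subseteq> carrier (poly_ring n)" "0 \<in> J"
    and add: "\<And>a b. a \<in> J \<Longrightarrow> b \<in> J \<Longrightarrow> a + b \<in> J"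
    and mono: "\<And>a t c. a \<in> J \<Longrightarrow> t \<in> monoms n \<Longrightarrow> sg t c * a \<in> J"
  shows "ideal J (poly_ring n)"
proof (rule idealI)
  show "ring (poly_ring n :: 'k mpoly ring)" by (rule ring_poly_ring)
  interpret R: ring "poly_ring n :: 'k mpoly ring" by (rule ring_poly_ring)
  have mult: "f * a \<in> J" if "a \<in> J" "f \<in> carrier (poly_ring n)" for a f
  proof -
    have "(\<Sum>t\<in>S. sg t (lk f t) * a) \<in> J" if "finite S" "S \<subseteq> ks f" for S
      using that
    proof induction
      case (insert t S)
      then show ?case using add mono[OF \<open>a \<in> J\<close>] \<open>f \<in> carrier _\<close> by auto
    qed (simp add: J)
    from this[of "ks f"] have "(\<Sum>t\<in>ks f. sg t (lk f t)) * a \<in> J"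
      by (simp add: sum_distrib_right)
    then show "f * a \<in> J" by (simp only: mapping_sum_singles[symmetric])
  qed
  show "x \<otimes>\<^bsub>poly_ring n\<^esub> a \<in> J" if "a \<in> J" "x \<in> carrier (poly_ring n)" for a x
    using mult[OF that] by simp
  then show "a \<otimes>\<^bsub>poly_ring n\<^esub> x \<in> J" if "a \<in> J" "x \<in> carrier (poly_ring n)" for a x
    using mult[OF that] by (simp add: mult.commute)
  show "subgroup J (add_monoid (poly_ring n))"
  proof (rule group.subgroupI[OF R.a_group])
    show "J \<subseteq> carrier (add_monoid (poly_ring n))" using J by simp
    show "J \<noteq> {}" using J by auto
    fix a b assume ab: "a \<in> J" "b \<in> J"
    show "a \<otimes>\<^bsub>add_monoid (poly_ring n)\<^esub> b \<in> J" using add[OF ab] by simp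
    have "sg 0 (-1) * a \<in> J" by (rule mono) (auto simp: ab monoms_def)
    then have m: "- a \<in> J" by (simp add: single_uminus)
    have "\<ominus>\<^bsub>poly_ring n\<^esub> a = - a"
      by (rule R.minus_equality) (use J ab m in auto)
    with m show "inv\<^bsub>add_monoid (poly_ring n)\<^esub> a \<in> J" by (simp add: a_inv_def)
  qed
qed

section \<open>Coefficient sums over the fibers of a grading\<close>

definition fsum :: "(monom \<Rightarrow> 'd) \<Rightarrow> ('k::field) mpoly \<Rightarrow> 'd \<Rightarrow> 'k" where
  "fsum \<delta> f d = (\<Sum>t\<in>ks f. if \<delta> t = d then lk f t else 0)"

lemma fsum_superset:
  assumes "finite S" "ks f \<subseteq> S"
  shows "fsum \<delta> f d = (\<Sum>t\<in>S. if \<delta> t = d then lk f t else 0)"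
  unfolding fsum_def by (rule sum.mono_neutral_left) (use assms in \<open>auto simp: in_keys_iff\<close>)

lemma fsum_add: "fsum \<delta> (f + g) d = fsum \<delta> f d + fsum \<delta> g d"
proof -
  have *: "finite (ks f \<union> ks g)" by simp
  show ?thesis
    unfolding fsum_superset[OF *, of f, simplified] fsum_superset[OF *, of g, simplified]
      fsum_superset[OF * keys_add]
    by (auto simp: lookup_add sum.distrib[symmetric] intro!: sum.cong)
qed

lemma fsum_single: "fsum \<delta> (sg t c) d = (if \<delta> t = d then c else 0)"
  by (simp add: fsum_superset[of "{t}"])

lemma fsum_zero: "fsum \<delta> 0 d = 0"
  by (simp add: fsum_def)

lemma fsum_sum: "fsum \<delta> (\<Sum>i\<in>I. f i) d = (\<Sum>i\<in>I. fsum \<delta> (f i) d)"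
  by (induction I rule: infinite_finite_induct) (auto simp: fsum_add fsum_zero)

text \<open>Only cancellation is assumed of \<open>\<delta>\<close>: multiplication by a monomial
  carries each fiber into one fiber and distinct fibers into distinct ones. So a coefficient sum of
  the product is either empty or \<open>c\<close> times one of \<open>f\<close>.\<close>

lemma fsum_single_mult:
  assumes hom: "\<And>s s' u. \<delta> (u + s) = \<delta> (u + s') \<longleftrightarrow> \<delta> s = \<delta> s'" and z: "\<And>d. fsum \<delta> f d = 0"
  shows "fsum \<delta> (sg t c * f) d = 0"
proof -
  have "sg t c * f = (\<Sum>s\<in>ks f. sg (t + s) (c * lk f s))"
    by (simp only: mapping_sum_singles[symmetric] mult_single[symmetric] sum_distrib_left[symmetric])
  then have *: "fsum \<delta> (sg t c * f) d = (\<Sum>s\<in>ks f. if \<delta> (t + s) = d then c * lk f s else 0)"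
    by (simp add: fsum_sum fsum_single)
  show ?thesis
  proof (cases "\<exists>s0. \<delta> (t + s0) = d")
    case True
    then obtain s0 where "\<delta> (t + s0) = d" by blast
    then have "fsum \<delta> (sg t c * f) d = (\<Sum>s\<in>ks f. c * (if \<delta> s = \<delta> s0 then lk f s else 0))"
      unfolding * by (intro sum.cong) (use hom in auto)
    also have "\<dots> = c * fsum \<delta> f (\<delta> s0)" by (simp add: fsum_def sum_distrib_left)
    finally show ?thesis using z by simp
  qed (simp add: *)
qed

lemma mono_dvd_trans: "mono_dvd a b \<Longrightarrow> mono_dvd b c \<Longrightarrow> mono_dvd a c"
  unfolding mono_dvd_def by (metis add.assoc)

lemma monom_eqI: "(\<And>k. lk s k = lk t k) \<Longrightarrow> s = t"
  by (rule poly_mapping_eqI)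

lemma mono_dvd_iff: "mono_dvd s t \<longleftrightarrow> (\<forall>k. lk s k \<le> lk t k)"
proof
  assume "\<forall>k. lk s k \<le> lk t k"
  then have "t = s + (t - s)" by (intro monom_eqI) (simp add: lookup_add lookup_minus)
  then show "mono_dvd s t" unfolding mono_dvd_def by blast
next
  assume "mono_dvd s t"
  then obtain u where "t = s + u" unfolding mono_dvd_def by blast
  then show "\<forall>k. lk s k \<le> lk t k" by (simp add: lookup_add)
qed

lemma mono_dvd_antisym:
  assumes "mono_dvd s t" "mono_dvd t s"
  shows "s = t"
proof (rule monom_eqI)
  fix k
  have "lk s k \<le> lk t k" "lk t k \<le> lk s k" using assms by (simp_all add: mono_dvd_iff)
  then show "lk s k = lk t k" by simp
qed

lemma monoms_iff: "t \<in> monoms n \<longleftrightarrow> (\<forall>k\<ge>n. lk t k = 0)"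
proof
  assume t: "t \<in> monoms n"
  show "\<forall>k\<ge>n. lk t k = 0"
  proof (intro allI impI)
    fix k assume "n \<le> k"
    then have "k \<notin> ks t" using t by (auto simp: monoms_def)
    then show "lk t k = 0" by (simp add: in_keys_iff)
  qed
next
  assume t: "\<forall>k\<ge>n. lk t k = 0"
  have "k < n" if "k \<in> ks t" for k
  proof (rule ccontr)
    assume "\<not> k < n"
    then show False using t that by (simp add: in_keys_iff)
  qed
  then show "t \<in> monoms n" by (auto simp: monoms_def)
qed

lemma monoms_dvd:
  assumes "t \<in> monoms n" "mono_dvd s t"
  shows "s \<in> monoms n"
  unfolding monoms_iff
proof (intro allI impI)
  fix k assume "n \<le> k"
  then have "lk t k = 0" using assms(1) by (simp add: monoms_iff)
  moreover have "lk s k \<le> lk t k" using assms(2) unfolding mono_dvd_iff by blast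
  ultimately show "lk s k = 0" by simp
qed

lemma mono_dvd_refl: "mono_dvd t t"
  by (simp add: mono_dvd_iff)

lemma mono_dvd_add: "mono_dvd m s \<Longrightarrow> mono_dvd m (t + s)"
  unfolding mono_dvd_iff lookup_add by (blast intro: trans_le_add2)

text \<open>The polynomials all of whose monomials are multiples of members of \<open>M\<close> form
  an ideal containing the generators, so no other monomial can lie in the generated ideal.\<close>

lemma single_in_monomial_ideal_iff:
  fixes M :: "monom set"
  assumes M: "M \<subseteq> monoms n" and t: "t \<in> monoms n"
  shows "sg t (1::'k::field) \<in> Idl\<^bsub>poly_ring n\<^esub> ((\<lambda>m. sg m 1) ` M) \<longleftrightarrow> (\<exists>m\<in>M. mono_dvd m t)"
proof
  interpret R: ring "poly_ring n :: 'k mpoly ring" by (rule ring_poly_ring)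
  let ?S = "(\<lambda>m. sg m (1::'k)) ` M"
  let ?J = "{f :: 'k mpoly. ks f \<subseteq> {t\<in>monoms n. \<exists>m\<in>M. mono_dvd m t}}"
  have "ideal ?J (poly_ring n)"
  proof (rule ideal_poly_ringI)
    fix a b :: "'k mpoly" assume "a \<in> ?J" "b \<in> ?J"
    then show "a + b \<in> ?J" using keys_add[of a b] by blast
  next
    fix a :: "'k mpoly" and t c assume a: "a \<in> ?J" and t: "t \<in> monoms n"
    have "ks (sg t c * a) \<subseteq> {t + s | s. s \<in> ks a}"
      using keys_mult[of "sg t c" a] by (auto split: if_splits)
    then show "sg t c * a \<in> ?J"
      using a t by (auto dest!: subsetD simp: monoms_add) (blast intro: mono_dvd_add)
  qed auto
  moreover have "?S \<subseteq> ?J" using M mono_dvd_refl by fastforce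
  ultimately have IJ: "Idl\<^bsub>poly_ring n\<^esub> ?S \<subseteq> ?J" by (rule R.genideal_minimal)
  show "\<exists>m\<in>M. mono_dvd m t" if "sg t (1::'k) \<in> Idl\<^bsub>poly_ring n\<^esub> ?S"
    using subsetD[OF IJ that] by simp
  have S: "?S \<subseteq> carrier (poly_ring n)" using M by auto
  interpret I: ideal "Idl\<^bsub>poly_ring n\<^esub> ?S" "poly_ring n" using S by (rule R.genideal_ideal)
  assume "\<exists>m\<in>M. mono_dvd m t"
  then obtain m u where m: "m \<in> M" "t = m + u" unfolding mono_dvd_def by blast
  have "mono_dvd u t" unfolding m(2) by (intro mono_dvd_add mono_dvd_refl)
  then have u: "u \<in> monoms n" by (rule monoms_dvd[OF t])
  have "sg m (1::'k) \<in> Idl\<^bsub>poly_ring n\<^esub> ?S" using m(1) R.genideal_self[OF S] by blast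
  then have "sg u 1 \<otimes>\<^bsub>poly_ring n\<^esub> sg m (1::'k) \<in> Idl\<^bsub>poly_ring n\<^esub> ?S"
    by (rule I.I_l_closed) (use u in simp)
  then show "sg t (1::'k) \<in> Idl\<^bsub>poly_ring n\<^esub> ?S"
    unfolding m(2) by (simp add: mult_single add.commute)
qed

section \<open>Toric ideals and primitive binomials\<close>

text \<open>The common factor \<open>s - pos_part u\<close> is the greatest common divisor of
  \<open>s\<close> and \<open>t\<close>. Hence a difference of two monomials is a monomial multiple
  of some \<open>binom u\<close>.\<close>

lemma monom_split:
  fixes s t :: monom
  assumes "s \<in> monoms n" "t \<in> monoms n"
  defines "u \<equiv> vec n (\<lambda>k. int (lk s k) - int (lk t k))"
  shows "s = (s - pos_part u) + pos_part u" "t = (s - pos_part u) + neg_part u"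
proof -
  have *: "lk s k = 0" "lk t k = 0" if "\<not> k < n" for k
    using assms(1,2) that by (auto simp: monoms_iff)
  show "s = (s - pos_part u) + pos_part u"
    by (rule monom_eqI) (auto simp: u_def lookup_add lookup_minus lookup_pos_part *)
  show "t = (s - pos_part u) + neg_part u"
    by (rule monom_eqI) (auto simp: u_def lookup_add lookup_minus lookup_pos_part lookup_neg_part *)
qed

lemma pos_part_monoms: "u \<in> carrier_vec n \<Longrightarrow> pos_part u \<in> monoms n"
  by (auto simp: monoms_iff lookup_pos_part)

lemma neg_part_monoms: "u \<in> carrier_vec n \<Longrightarrow> neg_part u \<in> monoms n"
  by (auto simp: monoms_iff lookup_neg_part)

lemma pos_part_uminus [simp]: "pos_part (- u) = neg_part u"
  by (rule monom_eqI) (auto simp: lookup_pos_part lookup_neg_part)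

lemma neg_part_uminus [simp]: "neg_part (- u) = pos_part u"
  by (rule monom_eqI) (auto simp: lookup_pos_part lookup_neg_part)

lemma binom_uminus: "binom (- u) = - (binom u)"
  by (simp add: binom_def)

lemma vec_of_parts:
  assumes "u \<in> carrier_vec n"
  shows "vec n (\<lambda>k. int (lk (pos_part u) k) - int (lk (neg_part u) k)) = u"
  using assms by (intro eq_vecI) (auto simp: lookup_pos_part lookup_neg_part)

lemma pos_neg_eq_iff:
  assumes "u \<in> carrier_vec n"
  shows "pos_part u = neg_part u \<longleftrightarrow> u = 0\<^sub>v n"
proof
  assume "pos_part u = neg_part u"
  then show "u = 0\<^sub>v n" using vec_of_parts[OF assms] by (metis (no_types, lifting) diff_self eq_vecI index_vec index_zero_vec dim_vec)
next
  assume "u = 0\<^sub>v n"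
  then show "pos_part u = neg_part u" by (intro monom_eqI) (simp add: lookup_pos_part lookup_neg_part)
qed

lemma binom_eq_0_iff:
  assumes "u \<in> carrier_vec n"
  shows "(binom u :: ('k::field) mpoly) = 0 \<longleftrightarrow> u = 0\<^sub>v n"
proof -
  have "(binom u :: 'k mpoly) = 0 \<longleftrightarrow> pos_part u = neg_part u"
  proof
    assume "(binom u :: 'k mpoly) = 0"
    then have "sg (pos_part u) (1::'k) = sg (neg_part u) 1" by (simp add: binom_def)
    then show "pos_part u = neg_part u"
      by (metis keys_single singleton_inject zero_neq_one)
  qed (simp add: binom_def)
  then show ?thesis using pos_neg_eq_iff[OF assms] by simp
qed

text \<open>All columns of the matrix lie on a common affine hyperplane, so fibers are finite.\<close>

locale toric =
  fixes A :: "int mat"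
  assumes homogeneous: "\<And>u. u \<in> carrier_vec (dim_col A) \<Longrightarrow> A *\<^sub>v u = 0\<^sub>v (dim_row A) \<Longrightarrow>
    (\<Sum>k<dim_col A. u $ k) = 0"
begin

abbreviation n where "n \<equiv> dim_col A"

definition ker where "ker = {u \<in> carrier_vec n. A *\<^sub>v u = 0\<^sub>v (dim_row A)}"

text \<open>The degree given by the columns of \<open>A\<close>. It is 0 beyond the last row so that
  equality of functions is equality of degrees.\<close>

definition dg :: "monom \<Rightarrow> nat \<Rightarrow> int" where
  "dg t = (\<lambda>i. if i < dim_row A then \<Sum>k<n. A $$ (i, k) * int (lk t k) else 0)"

definition mdeg :: "monom \<Rightarrow> nat" where "mdeg t = (\<Sum>k<n. lk t k)"

lemma mult_vec_index: "u \<in> carrier_vec n \<Longrightarrow> i < dim_row A \<Longrightarrow> (A *\<^sub>v u) $ i = (\<Sum>k<n. A $$ (i, k) * u $ k)"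
  by (auto simp: scalar_prod_def lessThan_atLeast0 intro!: sum.cong)

lemma kerI: "u \<in> carrier_vec n \<Longrightarrow> (\<And>i. i < dim_row A \<Longrightarrow> (\<Sum>k<n. A $$ (i, k) * u $ k) = 0) \<Longrightarrow> u \<in> ker"
  unfolding ker_def using mult_vec_index[of u] by (auto intro!: eq_vecI simp del: index_mult_mat_vec)

lemma kerD: "u \<in> ker \<Longrightarrow> i < dim_row A \<Longrightarrow> (\<Sum>k<n. A $$ (i, k) * u $ k) = 0"
  unfolding ker_def using mult_vec_index[of u i] by (auto simp del: index_mult_mat_vec)

lemma dg_eq_iff: "dg s = dg t \<longleftrightarrow> vec n (\<lambda>k. int (lk s k) - int (lk t k)) \<in> ker"
proof -
  let ?u = "vec n (\<lambda>k. int (lk s k) - int (lk t k))"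
  have "(\<Sum>k<n. A $$ (i, k) * ?u $ k) = dg s i - dg t i" if "i < dim_row A" for i
    using that by (simp add: dg_def right_diff_distrib sum_subtractf)
  then show ?thesis using kerI[of ?u] kerD[of ?u] by (auto simp: dg_def fun_eq_iff)
qed

lemma dg_parts: "u \<in> ker \<Longrightarrow> dg (pos_part u) = dg (neg_part u)"
  unfolding dg_eq_iff by (subst vec_of_parts) (auto simp: ker_def)

lemma dg_add: "dg (s + t) = (\<lambda>i. dg s i + dg t i)"
  by (auto simp: dg_def lookup_add distrib_left sum.distrib)

lemma dg_cancel: "dg (u + s) = dg (u + t) \<longleftrightarrow> dg s = dg t"
  by (auto simp: dg_add fun_eq_iff)

lemma mdeg_add: "mdeg (s + t) = mdeg s + mdeg t"
  by (simp add: mdeg_def lookup_add sum.distrib)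

lemma dg_mdeg: "dg s = dg t \<Longrightarrow> mdeg s = mdeg t"
proof -
  assume "dg s = dg t"
  then have "(\<Sum>k<n. vec n (\<lambda>k. int (lk s k) - int (lk t k)) $ k) = 0"
    by (intro homogeneous) (auto simp: dg_eq_iff ker_def)
  then have "int (mdeg s) = int (mdeg t)" by (simp add: mdeg_def sum_subtractf)
  then show ?thesis by simp
qed

lemma mdeg_0: "t \<in> monoms n \<Longrightarrow> mdeg t = 0 \<Longrightarrow> t = 0"
  by (rule monom_eqI) (auto simp: mdeg_def monoms_iff not_less[symmetric])

lemma dvd_same_mdeg: "t \<in> monoms n \<Longrightarrow> mono_dvd s t \<Longrightarrow> mdeg t \<le> mdeg s \<Longrightarrow> s = t"
proof -
  assume t: "t \<in> monoms n" "mono_dvd s t" "mdeg t \<le> mdeg s"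
  then obtain u where u: "t = s + u" unfolding mono_dvd_def by blast
  then have "mono_dvd u t" using mono_dvd_add[OF mono_dvd_refl] by simp
  then have "u \<in> monoms n" using t monoms_dvd by blast
  moreover have "mdeg u = 0" using t(3) u by (simp add: mdeg_add)
  ultimately show "s = t" using u mdeg_0 by simp
qed

text \<open>By homogeneity all monomials of a fiber have the same total degree.\<close>

lemma finite_fiber: "finite {s \<in> monoms n. dg s = d}"
proof -
  have "finite {s \<in> monoms n. mdeg s = D}" for D
  proof (rule inj_on_finite)
    show "inj_on lk {s \<in> monoms n. mdeg s = D}" by (rule inj_onI) (simp add: poly_mapping.lookup_inject)
    show "lk ` {s \<in> monoms n. mdeg s = D} \<subseteq> {f. \<forall>k. (k \<in> {..<n} \<longrightarrow> f k \<in> {..D}) \<and> (k \<notin> {..<n} \<longrightarrow> f k = 0)}"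
      by (auto simp: monoms_iff mdeg_def intro!: member_le_sum)
    show "finite {f. \<forall>k. (k \<in> {..<n} \<longrightarrow> f k \<in> {..D}) \<and> (k \<notin> {..<n} \<longrightarrow> f k = (0::nat))}"
      by (rule finite_set_of_finite_funs) auto
  qed
  note fin = this
  show ?thesis
  proof (cases "{s \<in> monoms n. dg s = d} = {}")
    case False
    then have "\<exists>t. t \<in> {s \<in> monoms n. dg s = d}" unfolding ex_in_conv .
    then obtain t where "t \<in> {s \<in> monoms n. dg s = d}" ..
    then have "dg t = d" by simp
    then have "{s \<in> monoms n. dg s = d} \<subseteq> {s \<in> monoms n. mdeg s = mdeg t}"
    proof (intro Collect_mono impI conjI)
      fix s assume "s \<in> monoms n \<and> dg s = d"
      with \<open>dg t = d\<close> show "mdeg s = mdeg t" by (intro dg_mdeg) simp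
    qed simp
    then show ?thesis using fin by (rule finite_subset)
  qed (simp only: finite.emptyI)
qed

lemma binom_in_carrier: "u \<in> carrier_vec n \<Longrightarrow> (binom u :: ('k::field) mpoly) \<in> carrier (poly_ring n)"
  using pos_part_monoms[of u n] neg_part_monoms[of u n]
  by (auto simp: binom_def dest!: subsetD[OF keys_diff])

lemma toric_gens: "{binom u :: ('k::field) mpoly | u. u \<in> carrier_vec n \<and> A *\<^sub>v u = 0\<^sub>v (dim_row A)}
   \<subseteq> carrier (poly_ring n)"
  using binom_in_carrier by blast

lemma toric_ideal_ideal: "ideal (toric_ideal A :: ('k::field) mpoly set) (poly_ring n)"
  unfolding toric_ideal_def by (rule ring.genideal_ideal[OF ring_poly_ring toric_gens])

lemma diff_in_toric:
  assumes "s \<in> monoms n" "t \<in> monoms n" "dg s = dg t"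
  shows "sg s 1 - sg t 1 \<in> (toric_ideal A :: ('k::field) mpoly set)"
proof -
  let ?u = "vec n (\<lambda>k. int (lk s k) - int (lk t k))"
  let ?m = "s - pos_part ?u"
  interpret I: ideal "toric_ideal A :: 'k mpoly set" "poly_ring n" by (rule toric_ideal_ideal)
  have "binom ?u \<in> (toric_ideal A :: 'k mpoly set)"
    unfolding toric_ideal_def
    by (rule subsetD[OF ring.genideal_self[OF ring_poly_ring toric_gens]])
       (use assms in \<open>auto simp: dg_eq_iff ker_def\<close>)
  moreover have "?m \<in> monoms n"
    using assms(1) by (auto simp: monoms_iff lookup_minus)
  ultimately have "sg ?m 1 \<otimes>\<^bsub>poly_ring n\<^esub> binom ?u \<in> (toric_ideal A :: 'k mpoly set)"
    by (intro I.I_l_closed) auto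
  also have "sg ?m 1 \<otimes>\<^bsub>poly_ring n\<^esub> binom ?u = sg (?m + pos_part ?u) (1::'k) - sg (?m + neg_part ?u) 1"
    by (simp add: binom_def right_diff_distrib mult_single)
  also have "\<dots> = sg s 1 - sg t 1"
    using monom_split[OF assms(1,2)] by simp
  finally show ?thesis .
qed

text \<open>Vanishing of all coefficient sums defines an ideal, and a generator has its two terms,
  with coefficients 1 and -1, in one fiber.\<close>

lemma toric_ideal_fsum:
  assumes "f \<in> (toric_ideal A :: ('k::field) mpoly set)"
  shows "ks f \<subseteq> monoms n" "fsum dg f d = 0"
proof -
  let ?J = "{f :: 'k mpoly. ks f \<subseteq> monoms n \<and> (\<forall>d. fsum dg f d = 0)}"
  have "ideal ?J (poly_ring n)"
  proof (rule ideal_poly_ringI)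
    fix a b :: "'k mpoly" assume "a \<in> ?J" "b \<in> ?J"
    then show "a + b \<in> ?J" using keys_add[of a b] by (auto simp: fsum_add)
  next
    fix a :: "'k mpoly" and t c assume a: "a \<in> ?J" and t: "t \<in> monoms n"
    have "ks (sg t c * a) \<subseteq> {t + s | s. s \<in> ks a}"
      using keys_mult[of "sg t c" a] by (auto split: if_splits)
    then have "ks (sg t c * a) \<subseteq> monoms n" using a t by (auto dest!: subsetD simp: monoms_add)
    moreover have "fsum dg (sg t c * a) d = 0" for d
      by (rule fsum_single_mult) (use a in \<open>auto simp: dg_cancel\<close>)
    ultimately show "sg t c * a \<in> ?J" by simp
  qed (auto simp: fsum_zero)
  moreover have "{binom u :: 'k mpoly | u. u \<in> carrier_vec n \<and> A *\<^sub>v u = 0\<^sub>v (dim_row A)} \<subseteq> ?J"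
  proof safe
    fix u t assume u: "u \<in> carrier_vec n" "A *\<^sub>v u = 0\<^sub>v (dim_row A)"
    show "t \<in> monoms n" if "t \<in> ks (binom u :: 'k mpoly)"
      using binom_in_carrier[OF u(1)] that by auto
    have "dg (pos_part u) = dg (neg_part u)" by (rule dg_parts) (use u in \<open>simp add: ker_def\<close>)
    then have "fsum dg (binom u + sg (neg_part u) 1 :: 'k mpoly) d = fsum dg (sg (neg_part u) 1) d" for d
      by (simp add: binom_def fsum_single)
    then show "fsum dg (binom u :: 'k mpoly) d = 0" for d by (simp add: fsum_add)
  qed
  ultimately have "toric_ideal A \<subseteq> ?J"
    unfolding toric_ideal_def by (rule ring.genideal_minimal[OF ring_poly_ring])
  with assms show "ks f \<subseteq> monoms n" "fsum dg f d = 0" by auto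
qed

text \<open>If the two monomials had different degrees, the coefficient sum over the fiber of
  \<open>pos_part u\<close> would be 1 instead of 0.\<close>

lemma binom_in_toric_iff:
  assumes u: "u \<in> carrier_vec n"
  shows "binom u \<in> (toric_ideal A :: ('k::field) mpoly set) \<longleftrightarrow> u \<in> ker"
proof
  assume b: "binom u \<in> (toric_ideal A :: 'k mpoly set)"
  have "dg (pos_part u) = dg (neg_part u)"
  proof (rule ccontr)
    assume "dg (pos_part u) \<noteq> dg (neg_part u)"
    moreover have "fsum dg (binom u + sg (neg_part u) 1 :: 'k mpoly) (dg (pos_part u))
      = fsum dg (sg (neg_part u) 1 :: 'k mpoly) (dg (pos_part u))"
      using toric_ideal_fsum(2)[OF b] by (simp add: fsum_add)
    ultimately show False by (simp add: binom_def fsum_single)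
  qed
  then show "u \<in> ker" unfolding dg_eq_iff vec_of_parts[OF u] .
next
  assume "u \<in> ker"
  then show "binom u \<in> (toric_ideal A :: 'k mpoly set)"
    unfolding binom_def using u by (intro diff_in_toric dg_parts pos_part_monoms neg_part_monoms)
qed

section \<open>Conformal and primitive vectors\<close>

definition conf :: "int vec \<Rightarrow> int vec \<Rightarrow> bool" where
  "conf v u \<longleftrightarrow> (\<forall>k<n. 0 \<le> v $ k \<and> v $ k \<le> u $ k \<or> u $ k \<le> v $ k \<and> v $ k \<le> 0)"

definition prim :: "int vec \<Rightarrow> bool" where
  "prim u \<longleftrightarrow> u \<in> ker \<and> u \<noteq> 0\<^sub>v n \<and> (\<forall>v\<in>ker. conf v u \<longrightarrow> v = 0\<^sub>v n \<or> v = u)"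

lemma conf_iff_dvd:
  assumes "u \<in> carrier_vec n" "v \<in> carrier_vec n"
  shows "conf v u \<longleftrightarrow> mono_dvd (pos_part v) (pos_part u) \<and> mono_dvd (neg_part v) (neg_part u)"
proof -
  have "(\<forall>k. lk (pos_part v) k \<le> lk (pos_part u) k \<and> lk (neg_part v) k \<le> lk (neg_part u) k) \<longleftrightarrow> conf v u"
    using assms unfolding conf_def lookup_pos_part lookup_neg_part by (auto split: if_splits; smt (verit))
  then show ?thesis unfolding mono_dvd_iff by blast
qed

text \<open>In characteristic 2 the binomials of \<open>u\<close> and \<open>- u\<close> coincide.
  Conformality excludes \<open>v = - u\<close> for nonzero \<open>u\<close>, since the two parts of
  \<open>u\<close> have disjoint supports.\<close>

lemma binom_inj:
  assumes u: "u \<in> carrier_vec n" and v: "v \<in> carrier_vec n" and b: "(binom v :: ('k::field) mpoly) = binom u"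
    and c: "conf v u"
  shows "v = u"
proof (cases "v = 0\<^sub>v n")
  case True
  have "(binom v :: 'k mpoly) = 0" using binom_eq_0_iff[OF v, where ?'k = 'k] True by (rule iffD2)
  then have "(binom u :: 'k mpoly) = 0" unfolding b .
  then have "u = 0\<^sub>v n" using binom_eq_0_iff[OF u, where ?'k = 'k] by (rule iffD1[rotated])
  then show ?thesis unfolding True by (rule sym)
next
  case False
  then have "pos_part v \<noteq> neg_part v" unfolding pos_neg_eq_iff[OF v] .
  have "lk (binom v :: 'k mpoly) (pos_part v) = 1" "lk (binom v :: 'k mpoly) (neg_part v) = - 1"
    using \<open>pos_part v \<noteq> neg_part v\<close> by (auto simp: binom_def lookup_minus lookup_single when_def)
  then have "lk (binom u :: 'k mpoly) (pos_part v) \<noteq> 0" "lk (binom u :: 'k mpoly) (neg_part v) \<noteq> 0"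
    unfolding b by simp_all
  then have *: "pos_part v \<in> {pos_part u, neg_part u}" "neg_part v \<in> {pos_part u, neg_part u}"
    by (auto simp: binom_def lookup_minus lookup_single when_def split: if_splits)
  have dvd: "mono_dvd (pos_part v) (pos_part u)" "mono_dvd (neg_part v) (neg_part u)"
    using c conf_iff_dvd[OF u v] by auto
  have "pos_part v = pos_part u \<and> neg_part v = neg_part u"
  proof (rule ccontr)
    assume "\<not> ?thesis"
    then have e: "pos_part v = neg_part u" "neg_part v = pos_part u"
      using * \<open>pos_part v \<noteq> neg_part v\<close> by auto
    have "pos_part v = neg_part v"
      using dvd[folded e] by (intro mono_dvd_antisym)
    then show False using \<open>pos_part v \<noteq> neg_part v\<close> by (rule notE[rotated])
  qed
  then have e: "pos_part v = pos_part u" "neg_part v = neg_part u" by (rule conjunct1, rule conjunct2)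
  show ?thesis using vec_of_parts[OF v] unfolding e vec_of_parts[OF u] by (rule sym)
qed

text \<open>Divisibility of the positive and of the negative parts together is conformality, so the
  Graver basis is described by integer vectors independently of the field.\<close>

lemma graver_eq: "(graver A :: ('k::field) mpoly set) = {binom u | u. prim u}"
proof -
  have "(\<exists>v \<in> carrier_vec n. (binom v :: 'k mpoly) \<in> toric_ideal A \<and>
          (binom v :: 'k mpoly) \<noteq> 0 \<and> (binom v :: 'k mpoly) \<noteq> binom u \<and>
          mono_dvd (pos_part v) (pos_part u) \<and> mono_dvd (neg_part v) (neg_part u))
      \<longleftrightarrow> (\<exists>v\<in>ker. conf v u \<and> v \<noteq> 0\<^sub>v n \<and> v \<noteq> u)" if u: "u \<in> carrier_vec n" for u
  proof
    assume "\<exists>v \<in> carrier_vec n. (binom v :: 'k mpoly) \<in> toric_ideal A \<and>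
          (binom v :: 'k mpoly) \<noteq> 0 \<and> (binom v :: 'k mpoly) \<noteq> binom u \<and>
          mono_dvd (pos_part v) (pos_part u) \<and> mono_dvd (neg_part v) (neg_part u)"
    then obtain v where v: "v \<in> carrier_vec n" "(binom v :: 'k mpoly) \<in> toric_ideal A"
        "(binom v :: 'k mpoly) \<noteq> 0" "(binom v :: 'k mpoly) \<noteq> binom u" "conf v u"
      using conf_iff_dvd[OF u] by blast
    then show "\<exists>v\<in>ker. conf v u \<and> v \<noteq> 0\<^sub>v n \<and> v \<noteq> u"
      using binom_in_toric_iff[OF v(1), where ?'k='k] binom_eq_0_iff[OF v(1), where ?'k='k] by (metis v(1,4))
  next
    assume "\<exists>v\<in>ker. conf v u \<and> v \<noteq> 0\<^sub>v n \<and> v \<noteq> u"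
    then obtain v where v: "v \<in> ker" "conf v u" "v \<noteq> 0\<^sub>v n" "v \<noteq> u" by blast
    then have vc: "v \<in> carrier_vec n" by (simp add: ker_def)
    show "\<exists>v \<in> carrier_vec n. (binom v :: 'k mpoly) \<in> toric_ideal A \<and>
          (binom v :: 'k mpoly) \<noteq> 0 \<and> (binom v :: 'k mpoly) \<noteq> binom u \<and>
          mono_dvd (pos_part v) (pos_part u) \<and> mono_dvd (neg_part v) (neg_part u)"
      using v vc binom_in_toric_iff[OF vc, where ?'k='k] binom_eq_0_iff[OF vc, where ?'k='k]
        binom_inj[OF u vc, where ?'k='k] conf_iff_dvd[OF u vc] by blast
  qed
  note eq = this
  have "u \<in> carrier_vec n \<and> (binom u :: 'k mpoly) \<in> toric_ideal A \<and> (binom u :: 'k mpoly) \<noteq> 0 \<and>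
     \<not> (\<exists>v \<in> carrier_vec n. (binom v :: 'k mpoly) \<in> toric_ideal A \<and>
          (binom v :: 'k mpoly) \<noteq> 0 \<and> (binom v :: 'k mpoly) \<noteq> binom u \<and>
          mono_dvd (pos_part v) (pos_part u) \<and> mono_dvd (neg_part v) (neg_part u)) \<longleftrightarrow> prim u" for u
  proof (cases "u \<in> carrier_vec n")
    case True
    show ?thesis unfolding eq[OF True] binom_in_toric_iff[OF True] binom_eq_0_iff[OF True]
      using True by (auto simp: prim_def)
  qed (auto simp: prim_def ker_def)
  then show ?thesis unfolding graver_def by simp
qed

end

section \<open>Reduced Groebner bases of toric ideals\<close>

text \<open>The coefficients 1 and -1 may coincide, namely in characteristic 2, so only the
  unordered pair of monomials is recovered.\<close>

lemma binomial_keys: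
  fixes p q s t :: monom
  assumes "sg p (1::'k::field) - sg q 1 = sg t 1 - sg s 1" "p \<noteq> q" "t \<noteq> s"
  shows "p = t \<and> q = s \<or> p = s \<and> q = t"
proof -
  have *: "ks (sg a (1::'k) - sg b 1) = {a, b}" if "a \<noteq> b" for a b :: monom
  proof (rule Set.set_eqI)
    fix x
    show "x \<in> ks (sg a (1::'k) - sg b 1) \<longleftrightarrow> x \<in> {a, b}"
      using that by (auto simp: in_keys_iff lookup_minus lookup_single when_def)
  qed
  have "{p, q} = {t, s}" using *[OF assms(2)] *[OF assms(3)] assms(1) by metis
  then show ?thesis by (simp add: doubleton_eq_iff)
qed

primrec nsum :: "nat \<Rightarrow> monom \<Rightarrow> monom" where
  "nsum 0 t = 0"
| "nsum (Suc k) t = t + nsum k t"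

lemma lookup_nsum: "lk (nsum k t) i = k * lk t i"
  by (induction k) (simp_all add: lookup_add)

lemma lookup_sum_list: "lk (sum_list ws) i = (\<Sum>w\<leftarrow>ws. lk w i)"
  by (induction ws) (simp_all add: lookup_add)

lemma sum_list_choice:
  "sum_list (map (\<lambda>w. if P w then t else s) ws)
   = nsum (length (filter P ws)) t + nsum (length (filter (\<lambda>w. \<not> P w) ws)) s"
  by (induction ws) (simp_all add: ac_simps)

locale toric_order = toric +
  fixes r :: "monom rel"
  assumes ord: "term_order (dim_col A) r"
begin

lemma lin: "linear_order_on (monoms n) r"
  using ord unfolding term_order_def by blast

lemma r_monoms: "(s, t) \<in> r \<Longrightarrow> s \<in> monoms n \<and> t \<in> monoms n"
  using lin unfolding linear_order_on_def partial_order_on_def preorder_on_def by blast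

lemma r_refl: "t \<in> monoms n \<Longrightarrow> (t, t) \<in> r"
  using lin unfolding linear_order_on_def partial_order_on_def preorder_on_def refl_on_def by blast

lemma r_total: "s \<in> monoms n \<Longrightarrow> t \<in> monoms n \<Longrightarrow> (s, t) \<in> r \<or> (t, s) \<in> r"
  using lin r_refl unfolding linear_order_on_def total_on_def by metis

lemma r_antisym: "(s, t) \<in> r \<Longrightarrow> (t, s) \<in> r \<Longrightarrow> s = t"
  using lin unfolding linear_order_on_def partial_order_on_def antisym_def by blast

lemma r_trans: "(s, t) \<in> r \<Longrightarrow> (t, u) \<in> r \<Longrightarrow> (s, u) \<in> r"
  using lin unfolding linear_order_on_def partial_order_on_def preorder_on_def trans_def by blast

lemma r_add: "(s, t) \<in> r \<Longrightarrow> u \<in> monoms n \<Longrightarrow> (s + u, t + u) \<in> r"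
  using ord r_monoms[of s t] unfolding term_order_def by blast

lemma r_add2:
  assumes "(s, t) \<in> r" "(s', t') \<in> r"
  shows "(s + s', t + t') \<in> r"
proof (rule r_trans)
  show "(s + s', t + s') \<in> r" using assms r_monoms by (intro r_add) blast+
  have "(s' + t, t' + t) \<in> r" using assms r_monoms by (intro r_add) blast+
  then show "(t + s', t + t') \<in> r" by (simp add: add.commute)
qed

lemma dvd_monom: "mono_dvd s t \<Longrightarrow> t \<in> monoms n \<Longrightarrow> (s, t) \<in> r"
proof -
  assume "mono_dvd s t" "t \<in> monoms n"
  then obtain u where u: "t = s + u" unfolding mono_dvd_def by blast
  have "s \<in> monoms n" by (rule monoms_dvd) fact+
  have "mono_dvd u t" unfolding u by (intro mono_dvd_add mono_dvd_refl)
  then have "u \<in> monoms n" using \<open>t \<in> monoms n\<close> monoms_dvd by blast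
  then have "(0, u) \<in> r" using ord unfolding term_order_def by blast
  from r_add[OF this \<open>s \<in> monoms n\<close>] show ?thesis by (simp add: u add.commute)
qed

lemma finite_max:
  assumes "finite S" "S \<noteq> {}" "S \<subseteq> monoms n"
  shows "\<exists>m\<in>S. \<forall>s\<in>S. (s, m) \<in> r"
  using assms
proof (induction rule: finite_ne_induct)
  case (singleton x)
  then show ?case using r_refl by blast
next
  case (insert x F)
  then obtain m where m: "m \<in> F" "\<forall>s\<in>F. (s, m) \<in> r" by blast
  have "x \<in> monoms n" "m \<in> monoms n" using insert.prems m(1) by blast+
  from r_total[OF this] show ?case
  proof
    assume "(x, m) \<in> r"
    then show ?thesis using m by blast
  next
    assume "(m, x) \<in> r"
    then have "\<forall>s\<in>F. (s, x) \<in> r" using m r_trans by blast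
    then show ?thesis using r_refl \<open>x \<in> monoms n\<close> by blast
  qed
qed

lemma finite_min:
  assumes "finite S" "S \<noteq> {}" "S \<subseteq> monoms n"
  shows "\<exists>m\<in>S. \<forall>s\<in>S. (m, s) \<in> r"
  using assms
proof (induction rule: finite_ne_induct)
  case (singleton x)
  then show ?case using r_refl by blast
next
  case (insert x F)
  then obtain m where m: "m \<in> F" "\<forall>s\<in>F. (m, s) \<in> r" by blast
  have "x \<in> monoms n" "m \<in> monoms n" using insert.prems m(1) by blast+
  from r_total[OF this] show ?case
  proof
    assume "(m, x) \<in> r"
    then show ?thesis using m by blast
  next
    assume "(x, m) \<in> r"
    then have "\<forall>s\<in>F. (x, s) \<in> r" using m r_trans by blast
    then show ?thesis using r_refl \<open>x \<in> monoms n\<close> by blast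
  qed
qed

lemma lead_eqI:
  assumes "t \<in> ks f" "\<And>s. s \<in> ks f \<Longrightarrow> (s, t) \<in> r"
  shows "lead_mon r f = t"
  unfolding lead_mon_def using assms r_antisym by (intro the_equality) blast+

lemma lead:
  assumes "f \<noteq> 0" "ks f \<subseteq> monoms n"
  shows "lead_mon r f \<in> ks f" "s \<in> ks f \<Longrightarrow> (s, lead_mon r f) \<in> r"
proof -
  have "ks f \<noteq> {}" using assms(1) by simp
  then obtain m where m: "m \<in> ks f" "\<forall>s\<in>ks f. (s, m) \<in> r"
    using finite_max[OF finite_keys _ assms(2)] by blast
  then have "lead_mon r f = m" by (intro lead_eqI) blast+
  with m show "lead_mon r f \<in> ks f" "s \<in> ks f \<Longrightarrow> (s, lead_mon r f) \<in> r" by simp_all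
qed

section \<open>Standard monomials and the shape of reduced Groebner bases\<close>

definition std :: "monom \<Rightarrow> bool" where
  "std t \<longleftrightarrow> (\<forall>t'\<in>monoms n. dg t' = dg t \<longrightarrow> (t, t') \<in> r)"

lemma std_unique: "std s \<Longrightarrow> std t \<Longrightarrow> s \<in> monoms n \<Longrightarrow> t \<in> monoms n \<Longrightarrow> dg s = dg t \<Longrightarrow> s = t"
  unfolding std_def using r_antisym by metis

lemma not_stdE:
  assumes "\<not> std t" "t \<in> monoms n"
  obtains s where "s \<in> monoms n" "dg s = dg t" "(s, t) \<in> r" "s \<noteq> t"
  using assms r_total r_refl unfolding std_def by metis

lemma not_stdI: "(s, t) \<in> r \<Longrightarrow> s \<noteq> t \<Longrightarrow> dg s = dg t \<Longrightarrow> \<not> std t"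
  unfolding std_def using r_antisym r_monoms by metis

text \<open>A smaller monomial in the fiber of a divisor, times the cofactor, is a smaller monomial
  in the fiber of \<open>t\<close>.\<close>

lemma std_dvd:
  assumes "std t" "t \<in> monoms n" "mono_dvd s t"
  shows "std s"
proof (rule ccontr)
  assume "\<not> std s"
  have "s \<in> monoms n" by (rule monoms_dvd) fact+
  then obtain x where x: "x \<in> monoms n" "dg x = dg s" "(x, s) \<in> r" "x \<noteq> s"
    using not_stdE \<open>\<not> std s\<close> by metis
  obtain u where u: "t = s + u" using assms(3) unfolding mono_dvd_def by blast
  have "mono_dvd u t" unfolding u by (intro mono_dvd_add mono_dvd_refl)
  then have "u \<in> monoms n" using assms(2) monoms_dvd by blast
  then have "(x + u, t) \<in> r" unfolding u using x(3) by (intro r_add)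
  moreover have "x + u \<noteq> t" using x(4) by (simp add: u)
  moreover have "dg (x + u) = dg t" unfolding u using x(2) by (simp add: dg_add)
  ultimately show False using not_stdI assms(1) by blast
qed

lemma ex_std:
  assumes "t \<in> monoms n"
  obtains s where "s \<in> monoms n" "dg s = dg t" "std s"
proof -
  have "{s \<in> monoms n. dg s = dg t} \<noteq> {}" using assms by blast
  then obtain m where m: "m \<in> {s \<in> monoms n. dg s = dg t}" "\<forall>s\<in>{s \<in> monoms n. dg s = dg t}. (m, s) \<in> r"
    using finite_min[OF finite_fiber] by blast
  then have "std m" unfolding std_def by simp
  then show ?thesis using m(1) that[of m] by simp
qed

lemma init_iff:
  assumes F: "F \<subseteq> carrier (poly_ring n)" and t: "t \<in> monoms n"
  shows "sg t (1::'k::field) \<in> initial_ideal n r F \<longleftrightarrow> (\<exists>f\<in>F - {0}. mono_dvd (lead_mon r f) t)"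
proof -
  have "lead_mon r ` (F - {0}) \<subseteq> monoms n"
  proof (rule image_subsetI)
    fix f assume "f \<in> F - {0}"
    then have f: "f \<in> F" "f \<noteq> 0" by auto
    have "ks f \<subseteq> monoms n" using F f(1) by auto
    then show "lead_mon r f \<in> monoms n" using lead(1)[OF f(2)] by blast
  qed
  from single_in_monomial_ideal_iff[OF this t, where ?'k = 'k] show ?thesis
    by (simp add: initial_ideal_def image_image)
qed

lemma init_subset:
  assumes F: "F \<subseteq> carrier (poly_ring n)" "F' \<subseteq> carrier (poly_ring n :: ('k::field) mpoly ring)"
    and dvd: "\<And>f. f \<in> F - {0} \<Longrightarrow> \<exists>f'\<in>F' - {0}. mono_dvd (lead_mon r f') (lead_mon r f)"
  shows "initial_ideal n r F \<subseteq> initial_ideal n r F'"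
proof -
  have mon: "lead_mon r f \<in> monoms n" if "f \<in> G - {0}" "G \<subseteq> carrier (poly_ring n)" for f and G :: "'k mpoly set"
  proof -
    have "f \<noteq> 0" "ks f \<subseteq> monoms n" using that by auto
    then show ?thesis using lead(1) by blast
  qed
  have "ideal (initial_ideal n r F') (poly_ring n)"
    unfolding initial_ideal_def
    by (rule ring.genideal_ideal[OF ring_poly_ring]) (use mon[OF _ F(2)] in auto)
  moreover have "(\<lambda>f. sg (lead_mon r f) 1) ` (F - {0}) \<subseteq> initial_ideal n r F'"
    using init_iff[OF F(2) mon[OF _ F(1)]] dvd by blast
  ultimately show ?thesis
    unfolding initial_ideal_def[of n r F] by (rule ring.genideal_minimal[OF ring_poly_ring])
qed

lemma toric_carrier: "(toric_ideal A :: ('k::field) mpoly set) \<subseteq> carrier (poly_ring n)"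
  using toric_ideal_fsum(1) by auto

lemma lead_binomial:
  assumes "s \<noteq> t" "(s, t) \<in> r"
  shows "lead_mon r (sg t (1::'k::field) - sg s 1) = t"
proof (rule lead_eqI)
  show "t \<in> ks (sg t (1::'k) - sg s 1)" using assms by (simp add: in_keys_iff lookup_minus lookup_single when_def)
  fix x assume "x \<in> ks (sg t (1::'k) - sg s 1)"
  then have "x = t \<or> x = s" using keys_diff[of "sg t (1::'k)" "sg s 1"] by auto
  then show "(x, t) \<in> r" using assms r_refl r_monoms by blast
qed

text \<open>The coefficients of \<open>f\<close> sum to 0 over the fiber of the leading monomial, so
  this fiber contains another monomial of \<open>f\<close>, which is smaller.\<close>

lemma toric_lead:
  assumes f: "f \<in> (toric_ideal A :: ('k::field) mpoly set)" "f \<noteq> 0"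
  shows "lead_mon r f \<in> monoms n" "\<not> std (lead_mon r f)"
proof -
  let ?t = "lead_mon r f"
  have fm: "ks f \<subseteq> monoms n" using toric_ideal_fsum(1)[OF f(1)] .
  note ld = lead[OF f(2) fm]
  show tm: "?t \<in> monoms n" using ld(1) fm by blast
  have "\<exists>s\<in>ks f. s \<noteq> ?t \<and> dg s = dg ?t"
  proof (rule ccontr)
    assume "\<not> ?thesis"
    then have "fsum dg f (dg ?t) = (\<Sum>s\<in>ks f. if s = ?t then lk f s else 0)"
      unfolding fsum_def by (intro sum.cong) auto
    also have "\<dots> = lk f ?t" using ld(1) by simp
    finally have "lk f ?t = 0" using toric_ideal_fsum(2)[OF f(1)] by simp
    then show False using ld(1) by (simp add: in_keys_iff)
  qed
  then obtain s where "s \<in> ks f" "s \<noteq> ?t" "dg s = dg ?t" by blast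
  then show "\<not> std ?t" using not_stdI[OF ld(2)] by blast
qed

text \<open>Multiples of nonstandard monomials are nonstandard by \<open>std_dvd\<close>. Conversely
  a nonstandard \<open>t\<close> is the leading monomial of its difference with a smaller monomial
  of its fiber.\<close>

lemma toric_init_iff:
  assumes t: "t \<in> monoms n"
  shows "sg t 1 \<in> initial_ideal n r (toric_ideal A :: ('k::field) mpoly set) \<longleftrightarrow> \<not> std t"
proof -
  note iff = init_iff[OF toric_carrier t, where ?'k = 'k]
  show ?thesis
  proof
    assume "sg t 1 \<in> initial_ideal n r (toric_ideal A :: 'k mpoly set)"
    then obtain f where f: "f \<in> (toric_ideal A :: 'k mpoly set)" "f \<noteq> 0" "mono_dvd (lead_mon r f) t"
      unfolding iff by blast
    show "\<not> std t" using toric_lead(2)[OF f(1,2)] std_dvd[OF _ t f(3)] by blast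
  next
    assume "\<not> std t"
    then obtain s where s: "s \<in> monoms n" "dg s = dg t" "(s, t) \<in> r" "s \<noteq> t" by (rule not_stdE[OF _ t])
    have "sg t (1::'k) - sg s 1 \<in> toric_ideal A" using diff_in_toric[OF t s(1)] s(2) by simp
    moreover have "lead_mon r (sg t (1::'k) - sg s 1) = t" by (rule lead_binomial) fact+
    moreover have "sg t (1::'k) - sg s 1 \<noteq> 0"
    proof
      assume "sg t (1::'k) - sg s 1 = 0"
      then have "lk (sg t (1::'k) - sg s 1) t = 0" by simp
      then show False using s(4) by (simp add: lookup_minus lookup_single when_def)
    qed
    ultimately show "sg t 1 \<in> initial_ideal n r (toric_ideal A :: 'k mpoly set)"
      unfolding iff using mono_dvd_refl[of t] by (metis DiffI singletonD)
  qed
qed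

text \<open>\<open>t\<close> is a minimal generator of the initial ideal and \<open>s\<close> is its
  normal form: the two monomials of an element of the reduced Groebner basis.\<close>

definition red :: "monom \<Rightarrow> monom \<Rightarrow> bool" where
  "red t s \<longleftrightarrow> t \<in> monoms n \<and> s \<in> monoms n \<and> dg s = dg t \<and> std s \<and> \<not> std t \<and>
     (\<forall>t'. mono_dvd t' t \<longrightarrow> t' \<noteq> t \<longrightarrow> std t')"

text \<open>Each fiber has only one standard monomial. Reducedness makes all nonleading monomials of
  \<open>g\<close> standard, so the vanishing coefficient sums leave exactly one of them, in the
  fiber of \<open>t\<close> and with coefficient -1.\<close>

lemma reduced_elem:
  assumes G: "reduced_groebner_basis n r (toric_ideal A :: ('k::field) mpoly set) G" and g: "g \<in> G"
  obtains t s where "red t s" "g = sg t 1 - sg s 1"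
proof -
  have GI: "G \<subseteq> toric_ideal A" and init: "initial_ideal n r G = initial_ideal n r (toric_ideal A)"
    and lc: "\<And>g. g \<in> G \<Longrightarrow> lk g (lead_mon r g) = 1"
    and rd: "\<And>g h t. g \<in> G \<Longrightarrow> h \<in> G \<Longrightarrow> h \<noteq> g \<Longrightarrow> t \<in> ks h \<Longrightarrow> \<not> mono_dvd (lead_mon r g) t"
    using G unfolding reduced_groebner_basis_def groebner_basis_def by blast+
  have gI: "g \<in> toric_ideal A" using g GI by blast
  have g0: "g \<noteq> 0" using lc[OF g] by auto
  define t where "t = lead_mon r g"
  have gm: "ks g \<subseteq> monoms n" using toric_ideal_fsum(1)[OF gI] .
  have t: "t \<in> ks g" "t \<in> monoms n" "\<And>s. s \<in> ks g \<Longrightarrow> (s, t) \<in> r" "\<not> std t"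
    using lead[OF g0 gm] toric_lead[OF gI g0] unfolding t_def by blast+
  have G_carr: "G \<subseteq> carrier (poly_ring n)" using GI toric_carrier by blast
  have key: "\<exists>h\<in>G. mono_dvd (lead_mon r h) s" if "s \<in> monoms n" "\<not> std s" for s
    using toric_init_iff[OF that(1), where ?'k = 'k] that(2) init_iff[OF G_carr that(1)] init by blast
  have std_other: "std s" if "s \<in> ks g" "s \<noteq> t" for s
  proof (rule ccontr)
    \<comment> \<open>A nonstandard \<open>s\<close> is divisible by the leading monomial of some
      basis element. By reducedness that element is \<open>g\<close>, so \<open>t\<close> divides
      \<open>s\<close>, although \<open>s\<close> is below \<open>t\<close>.\<close>
    assume "\<not> std s"
    have sm: "s \<in> monoms n" using that(1) gm by blast
    obtain h where h: "h \<in> G" "mono_dvd (lead_mon r h) s" using key[OF sm \<open>\<not> std s\<close>] by blast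
    have "h = g" using rd[OF h(1) g _ that(1)] h(2) by blast
    then have "mono_dvd t s" using h(2) by (simp add: t_def)
    then have "(t, s) \<in> r" using sm by (rule dvd_monom)
    then show False using t(3)[OF that(1)] r_antisym that(2) by blast
  qed
  have std_div: "std t'" if "mono_dvd t' t" "t' \<noteq> t" for t'
  proof (rule ccontr)
    assume "\<not> std t'"
    have tm: "t' \<in> monoms n" using that(1) t(2) monoms_dvd by blast
    obtain h where h: "h \<in> G" "mono_dvd (lead_mon r h) t'" using key[OF tm \<open>\<not> std t'\<close>] by blast
    have "mono_dvd (lead_mon r h) t" using h(2) that(1) by (rule mono_dvd_trans)
    then have "h = g" using rd[OF h(1) g _ t(1)] by blast
    then have "mono_dvd t t'" using h(2) by (simp add: t_def)
    then show False using mono_dvd_antisym that by blast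
  qed
  have fib: "dg s = dg t \<and> lk g s = - 1" if s: "s \<in> ks g" "s \<noteq> t" for s
  proof -
    have "fsum dg g (dg s) = (\<Sum>x\<in>ks g. (if x = s then lk g s else 0) + (if x = t then (if dg t = dg s then 1 else 0) else 0))"
      unfolding fsum_def
    proof (rule sum.cong)
      fix x assume x: "x \<in> ks g"
      show "(if dg x = dg s then lk g x else 0) =
        (if x = s then lk g s else 0) + (if x = t then (if dg t = dg s then 1 else 0) else 0)"
      proof (cases "x = t")
        case True
        then show ?thesis using s(2) lc[OF g] by (auto simp: t_def)
      next
        case False
        have "x = s" if "dg x = dg s"
          using std_unique[OF std_other[OF x False] std_other[OF s] _ _ that] gm x s(1) by blast
        then show ?thesis using False by auto
      qed
    qed simp
    also have "\<dots> = lk g s + (if dg t = dg s then 1 else 0)"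
      using s(1) t(1) by (simp add: sum.distrib)
    finally have "lk g s + (if dg t = dg s then 1 else 0) = 0" using toric_ideal_fsum(2)[OF gI] by simp
    moreover have "lk g s \<noteq> 0" using s(1) by (simp add: in_keys_iff)
    ultimately show ?thesis by (auto simp: eq_neg_iff_add_eq_0 split: if_splits)
  qed
  have "\<exists>s\<in>ks g. s \<noteq> t"
  proof (rule ccontr)
    assume "\<not> ?thesis"
    then have "ks g = {t}" using t(1) by blast
    then have "fsum dg g (dg t) = lk g t" by (simp add: fsum_def)
    then show False using toric_ideal_fsum(2)[OF gI] lc[OF g] by (simp add: t_def)
  qed
  then obtain s where s: "s \<in> ks g" "s \<noteq> t" by blast
  have keys_g: "ks g = {t, s}"
  proof -
    have "x = s" if x: "x \<in> ks g" "x \<noteq> t" for x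
      using std_unique[OF std_other[OF x] std_other[OF s]] fib[OF x] fib[OF s] gm x(1) s(1) by auto
    then show ?thesis using s(1) t(1) by blast
  qed
  have "g = sg t 1 - sg s 1"
  proof (rule poly_mapping_eqI)
    fix x
    show "lk g x = lk (sg t 1 - sg s 1) x"
    proof (cases "x \<in> ks g")
      case True
      then have "x = t \<or> x = s" using keys_g by blast
      then show ?thesis using fib[OF s] lc[OF g] s(2) by (auto simp: lookup_minus lookup_single when_def t_def)
    next
      case False
      then have "x \<noteq> t" "x \<noteq> s" "lk g x = 0" using t(1) s(1) by (auto simp: in_keys_iff)
      then show ?thesis by (simp add: lookup_minus lookup_single when_def)
    qed
  qed
  moreover have "red t s"
    unfolding red_def using t(2,4) s gm std_other[OF s] fib[OF s] std_div by blast
  ultimately show ?thesis using that by blast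
qed

end

section \<open>Dickson's lemma and existence of reduced Groebner bases\<close>

lemma nat_mono_subseq:
  fixes s :: "nat \<Rightarrow> nat"
  shows "\<exists>\<phi>::nat \<Rightarrow> nat. strict_mono \<phi> \<and> mono (\<lambda>i. s (\<phi> i))"
proof -
  obtain \<phi> where \<phi>: "strict_mono (\<phi>::nat \<Rightarrow> nat)" "monoseq (\<lambda>i. s (\<phi> i))"
    using seq_monosub[of s] by auto
  consider "\<forall>m. \<forall>n\<ge>m. s (\<phi> m) \<le> s (\<phi> n)" | "\<forall>m. \<forall>n\<ge>m. s (\<phi> n) \<le> s (\<phi> m)"
    using \<phi>(2) unfolding monoseq_def by blast
  then show ?thesis
  proof cases
    case 1
    then show ?thesis using \<phi>(1) by (auto simp: mono_def)
  next
    case 2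
    \<comment> \<open>A weakly decreasing sequence of naturals is constant once it has reached its
      minimum.\<close>
    obtain N where N: "\<And>i. s (\<phi> N) \<le> s (\<phi> i)"
      using ex_has_least_nat[of "\<lambda>_. True" undefined "\<lambda>i. s (\<phi> i)"] by blast
    have "s (\<phi> (i + N)) = s (\<phi> N)" for i using 2 N[of "i + N"] by (simp add: antisym)
    moreover have "strict_mono (\<lambda>i. \<phi> (i + N))" using \<phi>(1) by (auto simp: strict_mono_def)
    ultimately show ?thesis by (intro exI[of _ "\<lambda>i. \<phi> (i + N)"]) (simp add: mono_def)
  qed
qed

text \<open>Passing to subsequences, one variable after the other, makes all exponents weakly
  increasing.\<close>

lemma dickson_pair:
  fixes f :: "nat \<Rightarrow> monom"
  assumes f: "\<And>i. f i \<in> monoms n"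
  shows "\<exists>i j. i < j \<and> mono_dvd (f i) (f j)"
proof -
  have "\<exists>\<phi>::nat \<Rightarrow> nat. strict_mono \<phi> \<and> (\<forall>k<m. mono (\<lambda>i. lk (f (\<phi> i)) k))" for m
  proof (induction m)
    case 0
    show ?case by (intro exI[of _ id]) (simp add: strict_mono_def)
  next
    case (Suc m)
    then obtain \<phi> where \<phi>: "strict_mono (\<phi>::nat \<Rightarrow> nat)" "\<forall>k<m. mono (\<lambda>i. lk (f (\<phi> i)) k)" by blast
    obtain \<psi> where \<psi>: "strict_mono (\<psi>::nat \<Rightarrow> nat)" "mono (\<lambda>i. lk (f (\<phi> (\<psi> i))) m)"
      using nat_mono_subseq[of "\<lambda>i. lk (f (\<phi> i)) m"] by blast
    have "mono \<psi>" using \<psi>(1) by (rule strict_mono_mono)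
    have "mono (\<lambda>i. lk (f (\<phi> (\<psi> i))) k)" if "k < Suc m" for k
    proof (cases "k = m")
      case False
      then have "mono (\<lambda>i. lk (f (\<phi> i)) k)" using that \<phi>(2) by simp
      then show ?thesis using \<open>mono \<psi>\<close> by (simp add: mono_def)
    qed (use \<psi>(2) in simp)
    moreover have "strict_mono (\<lambda>i. \<phi> (\<psi> i))" using \<phi>(1) \<psi>(1) by (simp add: strict_mono_def)
    ultimately show ?case by (intro exI[of _ "\<lambda>i. \<phi> (\<psi> i)"]) blast
  qed
  from this[of n] obtain \<phi> where \<phi>: "strict_mono (\<phi>::nat \<Rightarrow> nat)" "\<forall>k<n. mono (\<lambda>i. lk (f (\<phi> i)) k)" by blast
  have "lk (f (\<phi> 0)) k \<le> lk (f (\<phi> 1)) k" for k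
  proof (cases "k < n")
    case True
    then have "mono (\<lambda>i. lk (f (\<phi> i)) k)" using \<phi>(2) by blast
    then show ?thesis by (rule monoD) simp
  next
    case False
    then show ?thesis using f[of "\<phi> 0"] by (simp add: monoms_iff)
  qed
  then have "mono_dvd (f (\<phi> 0)) (f (\<phi> 1))" unfolding mono_dvd_iff by blast
  moreover have "\<phi> 0 < \<phi> 1" using \<phi>(1) by (simp add: strict_mono_def)
  ultimately show ?thesis by blast
qed

lemma finite_antichain:
  assumes M: "M \<subseteq> monoms n" and anti: "\<And>s t. s \<in> M \<Longrightarrow> t \<in> M \<Longrightarrow> mono_dvd s t \<Longrightarrow> s = t"
  shows "finite M"
proof (rule ccontr)
  assume "infinite M"
  then obtain f :: "nat \<Rightarrow> monom" where f: "inj f" "range f \<subseteq> M"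
    using infinite_countable_subset by blast
  obtain i j where "i < j" "mono_dvd (f i) (f j)"
    using dickson_pair[of f n] f(2) M by blast
  then have "f i = f j" using anti f(2) by blast
  then show False using f(1) \<open>i < j\<close> by (simp add: inj_eq)
qed

context toric_order
begin

text \<open>The basis consists of the differences of the minimal nonstandard monomials and their
  normal forms. Minimal monomials form an antichain for divisibility, so Dickson's lemma makes it
  finite.\<close>

lemma red_in_reduced:
  assumes "red t s"
  shows "\<exists>G. reduced_groebner_basis n r (toric_ideal A :: ('k::field) mpoly set) G \<and> sg t 1 - sg s 1 \<in> G"
proof -
  define M where "M = {t \<in> monoms n. \<not> std t \<and> (\<forall>t'. mono_dvd t' t \<longrightarrow> t' \<noteq> t \<longrightarrow> std t')}"
  define nf where "nf t = (SOME s. s \<in> monoms n \<and> dg s = dg t \<and> std s)" for t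
  define b where "b t = sg t (1::'k) - sg (nf t) 1" for t
  have nf: "nf t \<in> monoms n" "dg (nf t) = dg t" "std (nf t)" if "t \<in> M" for t
  proof -
    have "t \<in> monoms n" using that by (simp add: M_def)
    then obtain s where "s \<in> monoms n \<and> dg s = dg t \<and> std s" using ex_std by metis
    from someI[of "\<lambda>s. s \<in> monoms n \<and> dg s = dg t \<and> std s", OF this]
    show "nf t \<in> monoms n" "dg (nf t) = dg t" "std (nf t)" unfolding nf_def by blast+
  qed
  have nf_ne: "nf t \<noteq> t" if "t \<in> M" for t
    using nf(3)[OF that] that by (auto simp: M_def)
  have nf_less: "(nf t, t) \<in> r" if "t \<in> M" for t
    using nf[OF that] that unfolding std_def M_def by simp
  have lead_b: "lead_mon r (b t) = t" if "t \<in> M" for t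
    unfolding b_def using nf_ne[OF that] nf_less[OF that] by (rule lead_binomial)
  have coeff: "lk (b t) t = 1" if "t \<in> M" for t
    using nf_ne[OF that] by (simp add: b_def lookup_minus lookup_single when_def)
  then have b0: "b t \<noteq> 0" if "t \<in> M" for t
    using that by fastforce
  have keys_b: "x = t \<or> x = nf t" if "x \<in> ks (b t)" for x t
    using that keys_diff[of "sg t (1::'k)" "sg (nf t) 1"] by (auto simp: b_def)
  have b_toric: "b t \<in> toric_ideal A" if "t \<in> M" for t
    unfolding b_def using nf[OF that] that by (intro diff_in_toric) (auto simp: M_def)
  have below: "\<exists>m\<in>M. mono_dvd m t" if "t \<in> monoms n" "\<not> std t" for t
    using that
  proof (induction "mdeg t" arbitrary: t rule: less_induct)
    case less
    show ?case
    proof (cases "t \<in> M")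
      case True
      then show ?thesis using mono_dvd_refl by blast
    next
      case False
      then obtain t' where t': "mono_dvd t' t" "t' \<noteq> t" "\<not> std t'" using less.prems by (auto simp: M_def)
      have "mdeg t' < mdeg t"
        using dvd_same_mdeg[OF less.prems(1) t'(1)] t'(2) not_less by blast
      moreover have "t' \<in> monoms n" using less.prems(1) t'(1) by (rule monoms_dvd)
      ultimately obtain m where "m \<in> M" "mono_dvd m t'" using less.hyps t'(3) by blast
      then show ?thesis using t'(1) mono_dvd_trans by blast
    qed
  qed
  have "finite M"
  proof (rule finite_antichain)
    show "M \<subseteq> monoms n" by (auto simp: M_def)
    show "s = t" if "s \<in> M" "t \<in> M" "mono_dvd s t" for s t
      using that unfolding M_def by blast
  qed
  have GI: "b ` M \<subseteq> toric_ideal A" using b_toric by blast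
  have init: "initial_ideal n r (b ` M) = initial_ideal n r (toric_ideal A :: 'k mpoly set)"
  proof (rule equalityI)
    show "initial_ideal n r (b ` M) \<subseteq> initial_ideal n r (toric_ideal A :: 'k mpoly set)"
    proof (rule init_subset)
      fix f assume "f \<in> b ` M - {0}"
      then show "\<exists>f'\<in>toric_ideal A - {0::'k mpoly}. mono_dvd (lead_mon r f') (lead_mon r f)"
        using GI mono_dvd_refl by blast
    qed (use GI toric_carrier in blast)+
    show "initial_ideal n r (toric_ideal A :: 'k mpoly set) \<subseteq> initial_ideal n r (b ` M)"
    proof (rule init_subset)
      fix f :: "'k mpoly" assume "f \<in> toric_ideal A - {0}"
      then obtain m where m: "m \<in> M" "mono_dvd m (lead_mon r f)"
        using below toric_lead by blast
      then show "\<exists>f'\<in>b ` M - {0}. mono_dvd (lead_mon r f') (lead_mon r f)"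
        using b0 lead_b by (intro bexI[of _ "b m"]) auto
    qed (use GI toric_carrier in blast)+
  qed
  have "reduced_groebner_basis n r (toric_ideal A) (b ` M)"
    unfolding reduced_groebner_basis_def groebner_basis_def
  proof (intro conjI ballI impI)
    show "finite (b ` M)" using \<open>finite M\<close> by simp
    fix g assume "g \<in> b ` M"
    then obtain t where t: "t \<in> M" "g = b t" by blast
    then show "lk g (lead_mon r g) = 1" using lead_b coeff by simp
    fix h x assume "h \<in> b ` M" "h \<noteq> g" "x \<in> ks h"
    then obtain t' where t': "t' \<in> M" "h = b t'" "t' \<noteq> t" using t by blast
    show "\<not> mono_dvd (lead_mon r g) x"
    proof
      assume "mono_dvd (lead_mon r g) x"
      then have d: "mono_dvd t x" using t lead_b by simp
      have "\<not> std t" using t(1) by (simp add: M_def)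
      moreover have "x = t' \<or> x = nf t'" using keys_b \<open>x \<in> ks h\<close> t'(2) by blast
      moreover have "std t" if "x = t'" using that d t' unfolding M_def by blast
      moreover have "std t" if "x = nf t'" using std_dvd nf[OF t'(1)] d that by blast
      ultimately show False by blast
    qed
  qed (use GI init in blast)+
  moreover have "t \<in> M" using assms by (simp add: red_def M_def)
  moreover have "nf t = s"
    using std_unique nf[OF \<open>t \<in> M\<close>] assms unfolding red_def by metis
  ultimately show ?thesis unfolding b_def by blast
qed

lemma red_ne: "red t s \<Longrightarrow> t \<noteq> s"
  unfolding red_def by blast

text \<open>If \<open>t\<close> and \<open>s\<close> shared a variable, dividing it out would give
  two standard monomials in one fiber, hence equal ones. The same uniqueness excludes a proper
  conformal \<open>v\<close>: both its parts would be standard, so \<open>v\<close> would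
  vanish.\<close>

lemma red_prim:
  assumes "red t s"
  obtains u where "prim u" "pos_part u = t" "neg_part u = s"
proof -
  define u where "u = vec n (\<lambda>k. int (lk t k) - int (lk s k))"
  have ts: "t \<in> monoms n" "s \<in> monoms n" "dg s = dg t" "std s" "\<not> std t"
    "\<And>t'. mono_dvd t' t \<Longrightarrow> t' \<noteq> t \<Longrightarrow> std t'"
    using assms unfolding red_def by blast+
  have uk: "u \<in> ker" unfolding u_def dg_eq_iff[symmetric] using ts(3) by simp
  have uc: "u \<in> carrier_vec n" by (simp add: u_def)
  have disj: "lk t k = 0 \<or> lk s k = 0" for k
  proof (rule ccontr)
    assume "\<not> ?thesis"
    then have pos: "0 < lk t k" "0 < lk s k" by simp_all
    have split: "x = sg k 1 + (x - sg k 1)" if "0 < lk x k" for x :: monom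
      by (rule monom_eqI) (use that in \<open>auto simp: lookup_add lookup_minus lookup_single when_def\<close>)
    let ?t = "t - sg k 1" and ?s = "s - sg k 1"
    have d: "mono_dvd ?t t" "mono_dvd ?s s"
      by (auto simp: mono_dvd_iff lookup_minus)
    have m: "?t \<in> monoms n" "?s \<in> monoms n"
      using monoms_dvd[OF ts(1) d(1)] monoms_dvd[OF ts(2) d(2)] by blast+
    have "dg ?s = dg ?t"
      using ts(3) dg_cancel[of "sg k 1" ?s ?t] split[OF pos(1)] split[OF pos(2)] by simp
    moreover have "?t \<noteq> t"
    proof
      assume "?t = t"
      then have "lk ?t k = lk t k" by simp
      then show False using pos(1) by (simp add: lookup_minus)
    qed
    then have "std ?t" using ts(6) d(1) by blast
    moreover have "std ?s" using std_dvd ts(2,4) d(2) by blast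
    ultimately have "?s = ?t" using std_unique m by blast
    then have "s = t" using split[OF pos(1)] split[OF pos(2)] by simp
    then show False using ts(4,5) by simp
  qed
  have out: "lk t k = 0 \<and> lk s k = 0" if "\<not> k < n" for k using ts(1,2) that by (simp add: monoms_iff)
  have pos: "pos_part u = t"
  proof (rule monom_eqI)
    fix k show "lk (pos_part u) k = lk t k" using disj[of k] out[of k] by (auto simp: lookup_pos_part u_def)
  qed
  have neg: "neg_part u = s"
  proof (rule monom_eqI)
    fix k show "lk (neg_part u) k = lk s k" using disj[of k] out[of k] by (auto simp: lookup_neg_part u_def)
  qed
  have "u \<noteq> 0\<^sub>v n" using pos_neg_eq_iff[OF uc] pos neg red_ne[OF assms] by simp
  moreover have "v = 0\<^sub>v n \<or> v = u" if v: "v \<in> ker" "conf v u" for v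
  proof -
    have vc: "v \<in> carrier_vec n" using v(1) by (simp add: ker_def)
    have d: "mono_dvd (pos_part v) t" "mono_dvd (neg_part v) s"
      using conf_iff_dvd[OF uc vc] v(2) pos neg by simp_all
    have e: "dg (pos_part v) = dg (neg_part v)" using v(1) by (rule dg_parts)
    show ?thesis
    proof (cases "pos_part v = t")
      case True
      then have "mdeg (neg_part v) = mdeg t" using dg_mdeg[OF e] by simp
      also have "\<dots> = mdeg s" using dg_mdeg[OF ts(3)] by simp
      finally have "neg_part v = s" using dvd_same_mdeg[OF ts(2) d(2)] by simp
      then show ?thesis using True pos neg vec_of_parts[OF uc] vec_of_parts[OF vc] by simp
    next
      case False
      then have "std (pos_part v)" using ts(6) d(1) by blast
      moreover have "std (neg_part v)" using std_dvd ts(2,4) d(2) by blast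
      ultimately have "pos_part v = neg_part v"
        using std_unique e pos_part_monoms[OF vc] neg_part_monoms[OF vc] by blast
      then show ?thesis using pos_neg_eq_iff[OF vc] by simp
    qed
  qed
  ultimately have "prim u" unfolding prim_def using uk by blast
  then show ?thesis using that pos neg by blast
qed

lemma nsum_monoms: "t \<in> monoms n \<Longrightarrow> nsum k t \<in> monoms n"
  by (induction k) (auto simp: monoms_add, simp add: monoms_def)

lemma nsum_le: "(s, t) \<in> r \<Longrightarrow> (nsum k s, nsum k t) \<in> r"
proof (induction k)
  case 0
  have "0 \<in> monoms n" by (simp add: monoms_def)
  then show ?case using r_refl by simp
qed (simp add: r_add2)

lemma nsum_add: "nsum (j + k) t = nsum j t + nsum k t"
  by (induction j) (simp_all add: ac_simps)

lemma sum_list_less: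
  assumes "\<And>w. w \<in> set ws \<Longrightarrow> (f w, w) \<in> r \<and> f w \<noteq> w" "ws \<noteq> []"
  shows "(sum_list (map f ws), sum_list ws) \<in> r \<and> sum_list (map f ws) \<noteq> sum_list ws"
  using assms(2,1)
proof (induction ws rule: list_nonempty_induct)
  case (cons w ws)
  then have IH: "(sum_list (map f ws), sum_list ws) \<in> r" "sum_list (map f ws) \<noteq> sum_list ws"
    and w: "(f w, w) \<in> r" by auto
  have "f w + sum_list (map f ws) \<noteq> w + sum_list ws"
  proof
    assume eq: "f w + sum_list (map f ws) = w + sum_list ws"
    have "(w + sum_list (map f ws), w + sum_list ws) \<in> r"
      using r_add[OF IH(1), of w] r_monoms[OF w] by (simp add: add.commute)
    moreover have "(w + sum_list ws, w + sum_list (map f ws)) \<in> r"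
      unfolding eq[symmetric] using r_add[OF w, of "sum_list (map f ws)"] r_monoms[OF IH(1)] by blast
    ultimately have "w + sum_list (map f ws) = w + sum_list ws" by (rule r_antisym)
    then show False using IH(2) by simp
  qed
  then show ?case using r_add2[OF w IH(1)] by simp
qed simp

text \<open>Every \<open>w\<close> that shares a variable with \<open>t\<close> lies above
  \<open>t\<close>, and every other \<open>w\<close> above \<open>s\<close>. Replacing each
  \<open>w\<close> by this bound lowers the sum strictly. But counting degrees in the variables of
  \<open>t\<close> shows that at least \<open>k\<close> of them are replaced by \<open>t\<close>, so
  the new sum is at least the right side of the relation.\<close>

lemma red_no_relation:
  assumes red: "red t s" and ws: "\<And>w. w \<in> set ws \<Longrightarrow> w \<in> monoms n \<and> dg w = dg t \<and> w \<noteq> t \<and> w \<noteq> s"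
    and ne: "ws \<noteq> []" and k: "k \<le> length ws"
    and rel: "sum_list ws = nsum k t + nsum (length ws - k) s"
  shows False
proof -
  have ts: "t \<in> monoms n" "s \<in> monoms n" "dg s = dg t" "std s"
    "\<And>t'. mono_dvd t' t \<Longrightarrow> t' \<noteq> t \<Longrightarrow> std t'"
    using red unfolding red_def by blast+
  have st: "(s, t) \<in> r" using ts(1,3,4) unfolding std_def by simp
  define P where "P (w :: monom) \<longleftrightarrow> (\<exists>i. 0 < lk w i \<and> 0 < lk t i)" for w
  \<comment> \<open>Cancelling the shared variable turns \<open>t\<close> into a proper divisor,
    which is standard by minimality of \<open>t\<close> and hence below the quotient of
    \<open>w\<close>.\<close>
  have touch: "(t, w) \<in> r" if w: "w \<in> set ws" "P w" for w
  proof -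
    obtain i where i: "0 < lk w i" "0 < lk t i" using w(2) unfolding P_def by blast
    have split: "x = (x - sg i 1) + sg i 1" if "0 < lk x i" for x :: monom
      by (rule monom_eqI) (use that in \<open>auto simp: lookup_add lookup_minus lookup_single when_def\<close>)
    let ?t = "t - sg i 1" and ?w = "w - sg i 1"
    have d: "mono_dvd ?t t" "mono_dvd ?w w" "mono_dvd (sg i 1) t"
      using i by (auto simp: mono_dvd_iff lookup_minus lookup_single when_def)
    have wm: "w \<in> monoms n" using ws[OF w(1)] by blast
    have "?t \<noteq> t"
    proof
      assume "?t = t"
      then have "lk ?t i = lk t i" by simp
      then show False using i(2) by (simp add: lookup_minus)
    qed
    then have "std ?t" using ts(5) d(1) by blast
    moreover have "dg ?w = dg ?t"
      using ws[OF w(1)] dg_cancel[of "sg i 1" ?w ?t] split[OF i(1)] split[OF i(2)]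
      by (simp add: add.commute)
    ultimately have "(?t, ?w) \<in> r" unfolding std_def using monoms_dvd[OF wm d(2)] by blast
    from r_add[OF this monoms_dvd[OF ts(1) d(3)]] show ?thesis
      using split[OF i(1)] split[OF i(2)] by simp
  qed
  have all: "(s, w) \<in> r" if "w \<in> set ws" for w
    using ws[OF that] ts(3,4) unfolding std_def by simp
  define f where "f w = (if P w then t else s)" for w
  define a where "a = length (filter P ws)"
  have fs: "sum_list (map f ws) = nsum a t + nsum (length ws - a) s"
  proof -
    have "length (filter (\<lambda>w. \<not> P w) ws) = length ws - a"
      unfolding a_def using sum_length_filter_compl[of P ws] by simp
    then show ?thesis unfolding f_def a_def using sum_list_choice[of P t s ws] by simp
  qed
  have less: "(sum_list (map f ws), sum_list ws) \<in> r \<and> sum_list (map f ws) \<noteq> sum_list ws"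
  proof (rule sum_list_less)
    fix w assume "w \<in> set ws"
    then show "(f w, w) \<in> r \<and> f w \<noteq> w" using touch all ws unfolding f_def by auto
  qed (rule ne)
  \<comment> \<open>The degree in the variables of \<open>t\<close>. It is 0 on each
    \<open>w\<close> that does not touch \<open>t\<close> and at most the degree of \<open>t\<close>
    on the others, which bounds \<open>k\<close> by the number \<open>a\<close> of those that touch
    \<open>t\<close>.\<close>
  define D where "D (x :: monom) = (\<Sum>i\<in>ks t. lk x i)" for x
  have D_add: "D (x + y) = D x + D y" for x y by (simp add: D_def lookup_add sum.distrib)
  have D0: "D 0 = 0" by (simp add: D_def)
  have ksn: "ks t \<subseteq> {..<n}" using ts(1) by (simp add: monoms_def)
  have D_le: "D x \<le> mdeg x" for x
    unfolding D_def mdeg_def using ksn by (intro sum_mono2) auto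
  have D_t: "D t = mdeg t"
    unfolding D_def mdeg_def using ksn by (intro sum.mono_neutral_left) (auto simp: in_keys_iff)
  have D_n: "D (nsum k x) = k * D x" for k x by (induction k) (simp_all add: D_add D0)
  have "0 < mdeg t"
  proof (rule ccontr)
    assume "\<not> 0 < mdeg t"
    then have "mdeg t = 0" "mdeg s = 0" using dg_mdeg[OF ts(3)] by simp_all
    then show False using mdeg_0 ts(1,2) red_ne[OF red] by metis
  qed
  have D_ws: "D (sum_list xs) \<le> length (filter P xs) * mdeg t" if "set xs \<subseteq> set ws" for xs
    using that
  proof (induction xs)
    case (Cons w xs)
    have "D w \<le> (if P w then mdeg t else 0)"
    proof (cases "P w")
      case True
      have "mdeg w = mdeg t" using ws[of w] Cons.prems by (intro dg_mdeg) simp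
      then show ?thesis using True D_le[of w] by simp
    next
      case False
      then have "lk w i = 0" if "i \<in> ks t" for i using that by (auto simp: P_def in_keys_iff)
      then show ?thesis using False by (simp add: D_def)
    qed
    then show ?case using Cons by (auto simp: D_add)
  qed (simp add: D0)
  have "k * mdeg t \<le> D (sum_list ws)" unfolding rel by (simp add: D_add D_n D_t)
  also have "\<dots> \<le> a * mdeg t" unfolding a_def by (rule D_ws) simp
  finally have "k \<le> a" using \<open>0 < mdeg t\<close> by simp
  have "a \<le> length ws" by (simp add: a_def)
  obtain j where j: "a = k + j" using \<open>k \<le> a\<close> le_Suc_ex by blast
  then have j': "length ws - k = j + (length ws - a)" using \<open>a \<le> length ws\<close> by simp
  have "(nsum j s + nsum (length ws - a) s, nsum j t + nsum (length ws - a) s) \<in> r"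
    by (rule r_add2[OF nsum_le[OF st] r_refl[OF nsum_monoms[OF ts(2)]]])
  then have "(nsum k t + (nsum j s + nsum (length ws - a) s), nsum k t + (nsum j t + nsum (length ws - a) s)) \<in> r"
    by (rule r_add2[OF r_refl[OF nsum_monoms[OF ts(1)]]])
  then have "(sum_list ws, sum_list (map f ws)) \<in> r"
    unfolding rel fs j' j nsum_add by (simp add: add.assoc)
  then show False using less r_antisym by blast
qed

end

context toric
begin

section \<open>The universal Groebner basis inside the Graver basis\<close>

lemma toric_orderI: "term_order n r \<Longrightarrow> toric_order A r"
  by unfold_locales

lemma ugb_iff:
  "f \<in> (ugb A :: ('k::field) mpoly set) \<longleftrightarrow>
    (\<exists>r t s. term_order n r \<and> toric_order.red A r t s \<and> f = sg t 1 - sg s 1)"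
proof
  assume "f \<in> (ugb A :: 'k mpoly set)"
  then obtain r G where G: "term_order n r" "reduced_groebner_basis n r (toric_ideal A) G" "f \<in> G"
    unfolding ugb_def by blast
  interpret toric_order A r using G(1) by (rule toric_orderI)
  show "\<exists>r t s. term_order n r \<and> toric_order.red A r t s \<and> f = sg t 1 - sg s 1"
    using reduced_elem[OF G(2,3)] G(1) by metis
next
  assume "\<exists>r t s. term_order n r \<and> toric_order.red A r t s \<and> f = sg t 1 - sg s 1"
  then obtain r t s where r: "term_order n r" "toric_order.red A r t s" "f = sg t 1 - sg s 1" by blast
  interpret toric_order A r using r(1) by (rule toric_orderI)
  show "f \<in> (ugb A :: 'k mpoly set)"
    using red_in_reduced[OF r(2), where ?'k = 'k] r(1) unfolding ugb_def r(3) by blast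
qed

lemma ugb_subset_graver: "(ugb A :: ('k::field) mpoly set) \<subseteq> graver A"
proof
  fix f assume "f \<in> (ugb A :: 'k mpoly set)"
  then obtain r t s where r: "term_order n r" "toric_order.red A r t s" "f = sg t 1 - sg s 1"
    unfolding ugb_iff by blast
  interpret toric_order A r using r(1) by (rule toric_orderI)
  obtain u where "prim u" "pos_part u = t" "neg_part u = s" using red_prim[OF r(2)] .
  then show "f \<in> graver A" unfolding graver_eq r(3) binom_def by blast
qed

text \<open>\<open>ugb A\<close> is contained in the Graver basis, so the two can only differ by a
  primitive binomial that is missing with both signs.\<close>

theorem ugb_neq_graver_iff:
  "up_to_sign (ugb A :: ('k::field) mpoly set) \<noteq> up_to_sign (graver A) \<longleftrightarrow>
    (\<exists>u. prim u \<and> binom u \<notin> (ugb A :: 'k mpoly set) \<and> binom (- u) \<notin> (ugb A :: 'k mpoly set))"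
proof
  assume ne: "up_to_sign (ugb A :: 'k mpoly set) \<noteq> up_to_sign (graver A)"
  show "\<exists>u. prim u \<and> binom u \<notin> (ugb A :: 'k mpoly set) \<and> binom (- u) \<notin> (ugb A :: 'k mpoly set)"
  proof (rule ccontr)
    assume "\<not> ?thesis"
    then have all: "binom u \<in> (ugb A :: 'k mpoly set) \<or> - binom u \<in> (ugb A :: 'k mpoly set)" if "prim u" for u
      using that by (auto simp: binom_uminus)
    have "{f, - f} \<in> up_to_sign (ugb A)" if f: "f \<in> (graver A :: 'k mpoly set)" for f
    proof -
      obtain u where u: "prim u" "f = binom u" using f unfolding graver_eq by blast
      show ?thesis using all[OF u(1)]
      proof
        assume "- binom u \<in> (ugb A :: 'k mpoly set)"
        then have "{- f, - (- f)} \<in> up_to_sign (ugb A)" unfolding up_to_sign_def u(2) by blast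
        then show ?thesis by (simp add: insert_commute)
      qed (auto simp: up_to_sign_def u(2))
    qed
    then have "up_to_sign (graver A :: 'k mpoly set) \<subseteq> up_to_sign (ugb A)"
      unfolding up_to_sign_def by blast
    moreover have "up_to_sign (ugb A :: 'k mpoly set) \<subseteq> up_to_sign (graver A)"
      unfolding up_to_sign_def using ugb_subset_graver by (rule image_mono)
    ultimately show False using ne by blast
  qed
next
  assume "\<exists>u. prim u \<and> binom u \<notin> (ugb A :: 'k mpoly set) \<and> binom (- u) \<notin> (ugb A :: 'k mpoly set)"
  then obtain u where u: "prim u" "binom u \<notin> (ugb A :: 'k mpoly set)" "- binom u \<notin> (ugb A :: 'k mpoly set)"
    by (auto simp: binom_uminus)
  have "{binom u :: 'k mpoly, - binom u} \<in> up_to_sign (graver A)"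
    unfolding up_to_sign_def graver_eq using u(1) by blast
  moreover have "{binom u :: 'k mpoly, - binom u} \<notin> up_to_sign (ugb A)"
  proof
    assume "{binom u :: 'k mpoly, - binom u} \<in> up_to_sign (ugb A)"
    then obtain f where f: "f \<in> (ugb A :: 'k mpoly set)" "{binom u, - binom u} = {f, - f}"
      unfolding up_to_sign_def by blast
    then have "f \<in> {binom u, - binom u}" by simp
    then show False using u(2,3) f(1) by blast
  qed
  ultimately show "up_to_sign (ugb A :: 'k mpoly set) \<noteq> up_to_sign (graver A)" by metis
qed

end

section \<open>Weight orders\<close>

context toric
begin

definition dotm :: "(nat \<Rightarrow> int) \<Rightarrow> monom \<Rightarrow> int" where
  "dotm \<omega> t = (\<Sum>k<n. \<omega> k * int (lk t k))"

lemma dotm_add: "dotm \<omega> (s + t) = dotm \<omega> s + dotm \<omega> t"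
  by (simp add: dotm_def lookup_add distrib_left sum.distrib)

text \<open>Refining by the total degree first makes \<open>0\<close> the least monomial even though the weights
  \<open>\<omega>\<close> may be negative.\<close>

definition weight_order :: "(nat \<Rightarrow> int) \<Rightarrow> (nat \<Rightarrow> int) \<Rightarrow> monom rel" where
  "weight_order \<eta> \<omega> = {(s, t). s \<in> monoms n \<and> t \<in> monoms n \<and>
     (mdeg s < mdeg t \<or> mdeg s = mdeg t \<and> (dotm \<eta> s < dotm \<eta> t \<or> dotm \<eta> s = dotm \<eta> t \<and>
       (dotm \<omega> s < dotm \<omega> t \<or> dotm \<omega> s = dotm \<omega> t \<and> s \<le> t)))}"

lemma term_order_weight: "term_order n (weight_order \<eta> \<omega>)"
  unfolding term_order_def
proof (intro conjI ballI impI)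
  show "linear_order_on (monoms n) (weight_order \<eta> \<omega>)"
    unfolding linear_order_on_def partial_order_on_def preorder_on_def
  proof (intro conjI)
    show "weight_order \<eta> \<omega> \<subseteq> monoms n \<times> monoms n" by (auto simp: weight_order_def)
    show "refl_on (monoms n) (weight_order \<eta> \<omega>)" by (simp add: refl_on_def weight_order_def)
    show "trans (weight_order \<eta> \<omega>)"
      by (rule transI) (simp add: weight_order_def, elim conjE disjE; simp)
    show "antisym (weight_order \<eta> \<omega>)" by (rule antisymI) (simp add: weight_order_def, elim conjE disjE; simp)
    show "total_on (monoms n) (weight_order \<eta> \<omega>)"
      unfolding total_on_def weight_order_def
    proof (intro ballI impI)
      fix x y :: monom
      have "x \<le> y \<or> y \<le> x" by (rule linear)
      moreover assume "x \<in> monoms n" "y \<in> monoms n"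
      ultimately show "(x, y) \<in> {(s, t). s \<in> monoms n \<and> t \<in> monoms n \<and>
       (mdeg s < mdeg t \<or> mdeg s = mdeg t \<and> (dotm \<eta> s < dotm \<eta> t \<or> dotm \<eta> s = dotm \<eta> t \<and>
       (dotm \<omega> s < dotm \<omega> t \<or> dotm \<omega> s = dotm \<omega> t \<and> s \<le> t)))} \<or>
        (y, x) \<in> {(s, t). s \<in> monoms n \<and> t \<in> monoms n \<and>
       (mdeg s < mdeg t \<or> mdeg s = mdeg t \<and> (dotm \<eta> s < dotm \<eta> t \<or> dotm \<eta> s = dotm \<eta> t \<and>
       (dotm \<omega> s < dotm \<omega> t \<or> dotm \<omega> s = dotm \<omega> t \<and> s \<le> t)))}"
        by (simp, linarith)
    qed
  qed
  show "(0, t) \<in> weight_order \<eta> \<omega>" if t: "t \<in> monoms n" for t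
  proof (cases "mdeg t = 0")
    case True
    then have "t = 0" using mdeg_0[OF t] by blast
    then show ?thesis using t by (simp add: weight_order_def)
  next
    case False
    moreover have "mdeg 0 = 0" by (simp add: mdeg_def)
    ultimately show ?thesis using t by (simp add: weight_order_def monoms_def)
  qed
  show "(s + u, t + u) \<in> weight_order \<eta> \<omega>"
    if "s \<in> monoms n" "t \<in> monoms n" "u \<in> monoms n" "(s, t) \<in> weight_order \<eta> \<omega>" for s t u
    using that by (simp add: weight_order_def monoms_add dotm_add mdeg_add)
qed

lemma parts_disjoint: "mono_dvd v (pos_part u) \<Longrightarrow> mono_dvd v (neg_part u) \<Longrightarrow> v = 0"
proof (rule monom_eqI)
  fix k
  assume "mono_dvd v (pos_part u)" "mono_dvd v (neg_part u)"
  then have "lk v k \<le> lk (pos_part u) k" "lk v k \<le> lk (neg_part u) k" unfolding mono_dvd_iff by blast+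
  then show "lk v k = lk 0 k" by (auto simp: lookup_pos_part lookup_neg_part split: if_splits)
qed

text \<open>After the total degree the order compares the degree \<open>\<eta>\<close> outside the
  support of \<open>u\<close>, then \<open>\<omega>\<close>, then exponent vectors in their linear
  order. Fiber points not supported in the support of \<open>u\<close> lie above
  \<open>pos_part u\<close> because of \<open>\<eta>\<close>, the remaining ones because of
  \<open>\<omega>\<close>; the tie between the two parts of \<open>u\<close> is broken by
  \<open>le\<close>.\<close>

lemma edge_in_ugb_aux:
  assumes u: "u \<in> ker" "u \<noteq> 0\<^sub>v n" and \<omega>: "(\<Sum>k<n. \<omega> k * u $ k) = 0"
    and pos: "\<And>w. w \<in> monoms n \<Longrightarrow> dg w = dg (neg_part u) \<Longrightarrow> (\<And>k. k < n \<Longrightarrow> u $ k = 0 \<Longrightarrow> lk w k = 0) \<Longrightarrow>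
      w \<noteq> pos_part u \<Longrightarrow> w \<noteq> neg_part u \<Longrightarrow> dotm \<omega> (neg_part u) < dotm \<omega> w"
    and le: "neg_part u \<le> pos_part u"
  shows "binom u \<in> (ugb A :: ('k::field) mpoly set)"
proof -
  define \<eta> where "\<eta> k = (if u $ k = 0 then 1 else 0 :: int)" for k
  define r where "r = weight_order \<eta> \<omega>"
  interpret toric_order A r by (rule toric_orderI) (simp add: r_def term_order_weight)
  have uc: "u \<in> carrier_vec n" using u by (simp add: ker_def)
  note pm = pos_part_monoms[OF uc] and nm = neg_part_monoms[OF uc]
  have dgp: "dg (pos_part u) = dg (neg_part u)" using u(1) by (rule dg_parts)
  have ne: "neg_part u \<noteq> pos_part u" using pos_neg_eq_iff[OF uc] u(2) by simp
  have \<omega>_eq: "dotm \<omega> (pos_part u) = dotm \<omega> (neg_part u)"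
  proof -
    have "dotm \<omega> (pos_part u) - dotm \<omega> (neg_part u) = (\<Sum>k<n. \<omega> k * u $ k)"
      unfolding dotm_def sum_subtractf[symmetric] using uc
      by (intro sum.cong) (auto simp: lookup_pos_part lookup_neg_part)
    then show ?thesis using \<omega> by simp
  qed
  have \<eta>0: "dotm \<eta> (pos_part u) = 0" "dotm \<eta> (neg_part u) = 0"
    using uc by (auto simp: dotm_def \<eta>_def lookup_pos_part lookup_neg_part intro!: sum.neutral)
  have \<eta>_ge: "0 \<le> dotm \<eta> w" for w by (auto simp: dotm_def \<eta>_def intro!: sum_nonneg)
  have outside: "lk w k = 0" if "dotm \<eta> w = 0" "k < n" "u $ k = 0" for w k
  proof -
    have "\<eta> k * int (lk w k) = 0"
      using that(1,2) unfolding dotm_def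
      by (subst (asm) sum_nonneg_eq_0_iff) (auto simp: \<eta>_def)
    then show ?thesis using that(3) by (simp add: \<eta>_def)
  qed
  have below: "w = neg_part u" if w: "w \<in> monoms n" "dg w = dg (neg_part u)" "(w, pos_part u) \<in> r" "w \<noteq> pos_part u" for w
  proof (rule ccontr)
    assume "w \<noteq> neg_part u"
    have "mdeg w = mdeg (pos_part u)" using dg_mdeg w(2) dgp by metis
    then have *: "dotm \<eta> w \<le> 0" "dotm \<eta> w = 0 \<longrightarrow> dotm \<omega> w \<le> dotm \<omega> (pos_part u)"
      using w(3) \<eta>0 by (auto simp: r_def weight_order_def)
    then have "dotm \<eta> w = 0" using \<eta>_ge[of w] by simp
    moreover from this have "dotm \<omega> (neg_part u) < dotm \<omega> w"
      using pos[OF w(1,2) outside w(4) \<open>w \<noteq> neg_part u\<close>] by blast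
    ultimately show False using * \<omega>_eq by simp
  qed
  have neg_pos: "(neg_part u, pos_part u) \<in> r"
    using le \<eta>0 \<omega>_eq dg_mdeg[OF dgp] pm nm by (simp add: r_def weight_order_def)
  have "red (pos_part u) (neg_part u)"
    unfolding red_def
  proof (intro conjI allI impI)
    show "std (neg_part u)"
      unfolding std_def
    proof (intro ballI impI)
      fix w assume w: "w \<in> monoms n" "dg w = dg (neg_part u)"
      show "(neg_part u, w) \<in> r"
      proof (rule ccontr)
        assume n: "(neg_part u, w) \<notin> r"
        then have "(w, neg_part u) \<in> r" using r_total w(1) nm by blast
        then have "(w, pos_part u) \<in> r" using neg_pos r_trans by blast
        moreover have "w \<noteq> pos_part u" using n neg_pos by blast
        ultimately have "w = neg_part u" using below w by blast
        then show False using n r_refl nm by blast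
      qed
    qed
    show "\<not> std (pos_part u)" using not_stdI[OF neg_pos ne] dgp by simp
    fix t assume t: "mono_dvd t (pos_part u)" "t \<noteq> pos_part u"
    show "std t"
    proof (rule ccontr)
      \<comment> \<open>A smaller \<open>x\<close> in the fiber of \<open>t\<close>, times the
        cofactor \<open>v\<close>, lies below \<open>pos_part u\<close> and is therefore
        \<open>neg_part u\<close>. Then \<open>v\<close> divides both parts of
        \<open>u\<close>.\<close>
      assume "\<not> std t"
      have tm: "t \<in> monoms n" using monoms_dvd[OF pm t(1)] .
      obtain x where x: "x \<in> monoms n" "dg x = dg t" "(x, t) \<in> r" "x \<noteq> t"
        using not_stdE[OF \<open>\<not> std t\<close> tm] .
      obtain v where v: "pos_part u = t + v" using t(1) unfolding mono_dvd_def by blast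
      have dv: "mono_dvd v (pos_part u)" unfolding v by (intro mono_dvd_add mono_dvd_refl)
      have vm: "v \<in> monoms n" using monoms_dvd[OF pm dv] .
      have "(x + v, pos_part u) \<in> r" unfolding v using x(3) vm by (rule r_add)
      moreover have "dg (x + v) = dg (neg_part u)" unfolding dgp[symmetric] v using x(2) by (simp add: dg_add)
      moreover have "x + v \<noteq> pos_part u" using x(4) by (simp add: v)
      ultimately have "x + v = neg_part u" using below monoms_add[OF x(1) vm] by blast
      then have "mono_dvd v (neg_part u)" using mono_dvd_add[OF mono_dvd_refl, of v x] by simp
      then have "v = 0" using dv parts_disjoint by blast
      then show False using t(2) v by simp
    qed
  qed (use pm nm dgp in simp_all)
  then show ?thesis
    unfolding ugb_iff binom_def using term_order_weight[of \<eta> \<omega>] r_def by blast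
qed

text \<open>If the final tie goes the other way, the same weights serve for \<open>- u\<close>,
  whose parts are exchanged.\<close>

theorem edge_in_ugb:
  assumes u: "u \<in> ker" "u \<noteq> 0\<^sub>v n" and \<omega>: "(\<Sum>k<n. \<omega> k * u $ k) = 0"
    and pos: "\<And>w. w \<in> monoms n \<Longrightarrow> dg w = dg (neg_part u) \<Longrightarrow> (\<And>k. k < n \<Longrightarrow> u $ k = 0 \<Longrightarrow> lk w k = 0) \<Longrightarrow>
      w \<noteq> pos_part u \<Longrightarrow> w \<noteq> neg_part u \<Longrightarrow> dotm \<omega> (neg_part u) < dotm \<omega> w"
  shows "binom u \<in> (ugb A :: ('k::field) mpoly set) \<or> binom (- u) \<in> (ugb A :: 'k mpoly set)"
proof (cases "neg_part u \<le> pos_part u")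
  case True
  then show ?thesis using edge_in_ugb_aux[OF u \<omega> pos] by blast
next
  case False
  have uc: "u \<in> carrier_vec n" using u by (simp add: ker_def)
  have dgp: "dg (pos_part u) = dg (neg_part u)" using u(1) by (rule dg_parts)
  have \<omega>_eq: "dotm \<omega> (pos_part u) = dotm \<omega> (neg_part u)"
  proof -
    have "dotm \<omega> (pos_part u) - dotm \<omega> (neg_part u) = (\<Sum>k<n. \<omega> k * u $ k)"
      unfolding dotm_def sum_subtractf[symmetric] using uc
      by (intro sum.cong) (auto simp: lookup_pos_part lookup_neg_part)
    then show ?thesis using \<omega> by simp
  qed
  have "binom (- u) \<in> (ugb A :: 'k mpoly set)"
  proof (rule edge_in_ugb_aux)
    show "- u \<in> ker"
    proof (rule kerI)
      fix i assume "i < dim_row A"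
      have "(\<Sum>k<n. A $$ (i, k) * (- u) $ k) = - (\<Sum>k<n. A $$ (i, k) * u $ k)"
        unfolding sum_negf[symmetric] using uc by (intro sum.cong) auto
      then show "(\<Sum>k<n. A $$ (i, k) * (- u) $ k) = 0" using kerD[OF u(1) \<open>i < dim_row A\<close>] by simp
    qed (use uc in simp)
    show "- u \<noteq> 0\<^sub>v n"
    proof
      assume "- u = 0\<^sub>v n"
      then have "pos_part (- u) = neg_part (- u)" using pos_neg_eq_iff[of "- u" n] uc by simp
      then show False using pos_neg_eq_iff[OF uc] u(2) by simp
    qed
    show "(\<Sum>k<n. \<omega> k * (- u) $ k) = 0"
    proof -
      have "(\<Sum>k<n. \<omega> k * (- u) $ k) = - (\<Sum>k<n. \<omega> k * u $ k)"
        unfolding sum_negf[symmetric] using uc by (intro sum.cong) auto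
      then show ?thesis using \<omega> by simp
    qed
    show "neg_part (- u) \<le> pos_part (- u)" using False by simp
    fix w assume w: "w \<in> monoms n" "dg w = dg (neg_part (- u))" "w \<noteq> pos_part (- u)" "w \<noteq> neg_part (- u)"
      and supp: "\<And>k. k < n \<Longrightarrow> (- u) $ k = 0 \<Longrightarrow> lk w k = 0"
    have "dotm \<omega> (neg_part u) < dotm \<omega> w"
      by (rule pos) (use w dgp supp uc in auto)
    then show "dotm \<omega> (neg_part (- u)) < dotm \<omega> w" using \<omega>_eq by simp
  qed
  then show ?thesis by blast
qed

text \<open>The binomial alone does not tell which of its monomials leads. The relation is
  symmetric: exchanging the two parts turns \<open>k\<close> into
  \<open>length ws - k\<close>.\<close>

theorem relation_not_in_ugb:
  assumes u: "u \<in> carrier_vec n" "u \<noteq> 0\<^sub>v n"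
    and ws: "\<And>w. w \<in> set ws \<Longrightarrow> w \<in> monoms n \<and> dg w = dg (pos_part u) \<and> w \<noteq> pos_part u \<and> w \<noteq> neg_part u"
    and ne: "ws \<noteq> []" and k: "k \<le> length ws"
    and rel: "sum_list ws = nsum k (pos_part u) + nsum (length ws - k) (neg_part u)"
  shows "binom u \<notin> (ugb A :: ('k::field) mpoly set)"
proof
  assume "binom u \<in> (ugb A :: 'k mpoly set)"
  then obtain r t s where r: "term_order n r" "toric_order.red A r t s"
     "binom u = (sg t 1 - sg s 1 :: 'k mpoly)"
    unfolding ugb_iff by blast
  interpret toric_order A r using r(1) by (rule toric_orderI)
  have "pos_part u \<noteq> neg_part u" using pos_neg_eq_iff[OF u(1)] u(2) by simp
  then consider "t = pos_part u" "s = neg_part u" | "t = neg_part u" "s = pos_part u"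
    using binomial_keys[OF r(3)[unfolded binom_def]] red_ne[OF r(2)] by blast
  then show False
  proof cases
    case 1
    show False by (rule red_no_relation[OF r(2) _ ne k]) (use 1 ws rel in auto)
  next
    case 2
    have d: "dg s = dg t" using r(2) unfolding red_def by blast
    show False
      by (rule red_no_relation[OF r(2) _ ne, of "length ws - k"]) (use 2 ws rel d k in \<open>auto simp: add.commute\<close>)
  qed
qed

end

section \<open>Enumeration of primitive vectors\<close>

type_synonym cols = "(int \<times> int) list"

text \<open>In the search below a column is a pair \<open>(g, h)\<close>: a block is balanced if the \<open>g\<close>-weighted sum of its entries
  is \<open>0\<close>, and the \<open>h\<close>-weighted sums of all blocks have to add up to \<open>0\<close>. A triple \<open>(s, d, t)\<close> in \<open>subs c x\<close>
  stands for a vector conformal to \<open>x\<close> with \<open>l\<^sub>1\<close>-norm \<open>s\<close>, \<open>g\<close>-weighted sum \<open>d\<close> and \<open>h\<close>-weighted sum \<open>t\<close>.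
  The functions are spelled out by primitive recursion so that \<open>code_simp\<close> can run them.\<close>

fun shift :: "int \<Rightarrow> int \<Rightarrow> int \<Rightarrow> (int \<times> int \<times> int) list \<Rightarrow> (int \<times> int \<times> int) list" where
  "shift a b c [] = []"
| "shift a b c ((s, d, t) # r) = (s + a, d + b, t + c) # shift a b c r"

function spread :: "int \<Rightarrow> int \<Rightarrow> int \<Rightarrow> (int \<times> int \<times> int) list \<Rightarrow> (int \<times> int \<times> int) list" where
  "spread k b c r = (if k \<le> 0 then r else r @ spread (k - 1) b c (shift 1 b c r))"
  by pat_completeness auto
termination by (relation "measure (\<lambda>(k, _). nat k)") auto
declare spread.simps [simp del]

fun subs :: "cols \<Rightarrow> int list \<Rightarrow> (int \<times> int \<times> int) list" where
  "subs ((g, h) # cs) (x # xs) =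
    (if x = 0 then subs cs xs else if 0 < x then spread x g h (subs cs xs)
     else spread (- x) (- g) (- h) (subs cs xs))"
| "subs _ _ = [(0, 0, 0)]"

fun bal0 :: "(int \<times> int \<times> int) list \<Rightarrow> (int \<times> int) list" where
  "bal0 [] = []" | "bal0 ((s, d, t) # r) = (if d = 0 then (s, t) # bal0 r else bal0 r)"

fun shift2 :: "int \<Rightarrow> int \<Rightarrow> (int \<times> int) list \<Rightarrow> (int \<times> int) list" where
  "shift2 a c [] = []"
| "shift2 a c ((s, t) # r) = (s + a, t + c) # shift2 a c r"

fun conv :: "(int \<times> int) list \<Rightarrow> (int \<times> int) list \<Rightarrow> (int \<times> int) list" where
  "conv [] r = []" | "conv ((s, t) # q) r = shift2 s t r @ conv q r"

fun vals :: "cols list \<Rightarrow> int list list \<Rightarrow> (int \<times> int) list" where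
  "vals (c # cs) (x # u) = conv (bal0 (subs c x)) (vals cs u)"
| "vals _ _ = [(0, 0)]"

fun sizes :: "int list \<Rightarrow> int" where "sizes [] = 0" | "sizes (x # xs) = \<bar>x\<bar> + sizes xs"
fun size2 :: "int list list \<Rightarrow> int" where "size2 [] = 0" | "size2 (x # xs) = sizes x + size2 xs"

text \<open>Only the norms of conformal subvectors are recorded, but a norm strictly between 0 and
  \<open>n\<close> already means a nonzero and proper subvector.\<close>

fun nonprim :: "int \<Rightarrow> (int \<times> int) list \<Rightarrow> bool" where
  "nonprim n [] = False"
| "nonprim n ((s, t) # r) = (if t = 0 then if 0 < s then if s < n then True else nonprim n r else nonprim n r else nonprim n r)"

fun tvals :: "(int \<times> int) list \<Rightarrow> int list" where
  "tvals [] = []"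
| "tvals ((s, t) # r) = (if s = 0 then tvals r else List.insert t (tvals r))"

fun compat1 :: "int list \<Rightarrow> int list \<Rightarrow> bool" where
  "compat1 (x # xs) (y # ys) = (if y = 0 then compat1 xs ys else if 0 < y then if x < 0 then False else compat1 xs ys else if 0 < x then False else compat1 xs ys)"
| "compat1 _ _ = True"
fun compat :: "int list list \<Rightarrow> int list list \<Rightarrow> bool" where
  "compat (x # xs) (y # ys) = (if compat1 x y then compat xs ys else False)"
| "compat _ _ = True"

section \<open>Fiber points of the blocks and candidates for a functional\<close>

fun add1 :: "int list \<Rightarrow> int list \<Rightarrow> int list" where
  "add1 (x # xs) (y # ys) = (x + y) # add1 xs ys" | "add1 _ _ = []"
fun add2 :: "int list list \<Rightarrow> int list list \<Rightarrow> int list list" where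
  "add2 (x # xs) (y # ys) = add1 x y # add2 xs ys" | "add2 _ _ = []"

fun scale :: "int \<Rightarrow> int list \<Rightarrow> int list" where
  "scale a [] = []" | "scale a (x # xs) = a * x # scale a xs"
fun dot :: "int list \<Rightarrow> int list \<Rightarrow> int" where
  "dot (x # xs) (y # ys) = x * y + dot xs ys" | "dot _ _ = 0"
fun negp :: "int list \<Rightarrow> int list" where
  "negp [] = []" | "negp (x # xs) = (if x < 0 then - x else 0) # negp xs"

text \<open>The prefix \<open>X\<close> is extended by every multiplicity \<open>k\<close> of one
  column for which the weight \<open>D\<close> still to be distributed stays nonnegative. The guard
  on \<open>g\<close> makes the recursion terminate.\<close>

function grow :: "int \<Rightarrow> int list \<Rightarrow> int \<Rightarrow> int \<Rightarrow> int \<Rightarrow> int \<Rightarrow> (int list \<times> int \<times> int) list" where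
  "grow k X D t g h = (if D < 0 then [] else if g \<le> 0 then [] else (k # X, D, t) # grow (k + 1) X (D - g) (t + h) g h)"
  by pat_completeness auto
termination by (relation "measure (\<lambda>(_, _, D, _). nat (D + 1))") auto
declare grow.simps [simp del]

fun grows :: "(int list \<times> int \<times> int) list \<Rightarrow> int \<Rightarrow> int \<Rightarrow> (int list \<times> int \<times> int) list" where
  "grows [] g h = []" | "grows ((X, D, t) # r) g h = grow 0 X D t g h @ grows r g h"
fun zeros :: "(int list \<times> int \<times> int) list \<Rightarrow> (int list \<times> int \<times> int) list" where
  "zeros [] = []" | "zeros ((X, D, t) # r) = (0 # X, D, t) # zeros r"

fun sols :: "cols \<Rightarrow> int list \<Rightarrow> (int list \<times> int \<times> int) list \<Rightarrow> (int list \<times> int \<times> int) list" where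
  "sols ((g, h) # cs) (x # xs) st = sols cs xs (if x = 0 then zeros st else grows st g h)"
| "sols _ _ st = st"

fun pick :: "(int list \<times> int \<times> int) list \<Rightarrow> (int list \<times> int) list" where
  "pick [] = []" | "pick ((X, D, t) # r) = (if D = 0 then (rev X, t) # pick r else pick r)"

fun dneg :: "cols \<Rightarrow> int list \<Rightarrow> int" where
  "dneg ((g, h) # cs) (x # xs) = (if x < 0 then dneg cs xs - g * x else dneg cs xs)" | "dneg _ _ = 0"
fun vneg :: "cols \<Rightarrow> int list \<Rightarrow> int" where
  "vneg ((g, h) # cs) (x # xs) = (if x < 0 then vneg cs xs - h * x else vneg cs xs)" | "vneg _ _ = 0"

text \<open>The nonnegative vectors with support in that of \<open>x\<close> and with the \<open>g\<close>-weighted sum of the negative part of \<open>x\<close>.\<close>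

definition opts :: "cols \<Rightarrow> int list \<Rightarrow> (int list \<times> int) list" where
  "opts c x = pick (sols c x [([], dneg c x, - vneg c x)])"

text \<open>\<open>X\<close> is a fiber point with its support in that of \<open>x\<close>; the
  comparison says that \<open>X\<close> minus the negative part of \<open>x\<close> is conformal to
  \<open>x\<close>.\<close>

fun small :: "int list \<Rightarrow> int list \<Rightarrow> bool" where
  "small (X # Xs) (x # xs) = (if X \<le> \<bar>x\<bar> then small Xs xs else False)" | "small _ _ = True"

text \<open>\<open>zt\<close> holds the values that the third block can contribute. Points that are
  conformal in both blocks are dropped, since no inequality is demanded of them.\<close>

fun ext1 :: "int list \<Rightarrow> int \<Rightarrow> bool \<Rightarrow> int list \<Rightarrow> int list \<Rightarrow> (int list \<times> int) list \<Rightarrow> int list list" where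
  "ext1 X t c x1 zt [] = []"
| "ext1 X t c x1 zt ((Y, s) # r) = (if List.member zt (- (t + s)) then 
     if c then if small Y x1 then ext1 X t c x1 zt r else (X @ Y) # ext1 X t c x1 zt r
     else (X @ Y) # ext1 X t c x1 zt r else ext1 X t c x1 zt r)"
fun ext2 :: "int list \<Rightarrow> int list \<Rightarrow> int list \<Rightarrow> (int list \<times> int) list \<Rightarrow> (int list \<times> int) list \<Rightarrow> int list list" where
  "ext2 x0 x1 zt [] O1 = []"
| "ext2 x0 x1 zt ((X, t) # r) O1 = ext1 X t (small X x0) x1 zt O1 @ ext2 x0 x1 zt r O1"

text \<open>The factor \<open>qq\<close>, the squared length of \<open>q\<close>, keeps the
  projections orthogonal to \<open>q\<close> integral.\<close>

fun projs :: "int list \<Rightarrow> int \<Rightarrow> int list \<Rightarrow> int list list \<Rightarrow> int list list" where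
  "projs q qq m [] = []"
| "projs q qq m (X # r) = (let y = add1 X (scale (- 1) m) in add1 (scale qq y) (scale (- dot y q) q) # projs q qq m r)"
fun sumv :: "int list \<Rightarrow> int list list \<Rightarrow> int list" where
  "sumv w [] = w" | "sumv w (v # r) = sumv (add1 w v) r"
fun corr :: "int list \<Rightarrow> int list list \<Rightarrow> int list list" where
  "corr w [] = []" | "corr w (v # r) = (if dot w v \<le> 0 then v # corr w r else corr w r)"
fun allpos :: "int list \<Rightarrow> int \<Rightarrow> int list list \<Rightarrow> bool" where
  "allpos w b [] = True" | "allpos w b (X # r) = (if dot w X > b then allpos w b r else False)"

text \<open>The candidate \<open>w\<close> adds up the projections of the points to \<open>q\<^sup>\<bottom>\<close>, counting twice those on the wrong side.
  Soundness does not depend on this choice.\<close>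

definition sep :: "int list \<Rightarrow> int list list \<Rightarrow> bool" where
  "sep q E = (case E of [] \<Rightarrow> True | _ \<Rightarrow> (let m = negp q; vs = projs q (dot q q) m E; w0 = sumv (scale 0 q) vs; w = sumv w0 (corr w0 vs) in
     if dot w q = 0 then allpos w (dot w m) E else False))"

fun nnz :: "int list \<Rightarrow> int" where "nnz [] = 0" | "nnz (x # xs) = (if x = 0 then nnz xs else 1 + nnz xs)"
definition good :: "int list \<Rightarrow> bool" where "good x = (nnz x \<le> 2)"

text \<open>At most one unit, and not of value 1 or -1: in the second family a unit of value 1 such
  as \<open>[1, 1, -1]\<close> has three nonzero entries, whereas units of value 2 or -2 in three
  columns have two.\<close>

fun lone :: "int list \<Rightarrow> bool" where
  "lone [] = True" | "lone (a # z) = (if a = 0 then sizes z \<le> 1 else False)"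

fun leaf1 :: "cols list \<Rightarrow> int list list \<Rightarrow> bool" where
  "leaf1 [c0, c1, cz] [x0, x1, z] = sep (x0 @ x1) (ext2 x0 x1 (0 # tvals (bal0 (subs cz z))) (opts c0 x0) (opts c1 x1))"
| "leaf1 _ _ = False"
text \<open>A functional is demanded as soon as one block has three nonzero entries. If both have,
  \<open>lone\<close> is demanded in addition; this is what later excludes a third large
  block.\<close>

fun leaf :: "cols list \<Rightarrow> int list list \<Rightarrow> bool" where
  "leaf cs [x0, x1, z] = (if good x0 then if good x1 then True else 
       if nonprim (size2 [x0, x1, z]) (vals cs [x0, x1, z]) then True else leaf1 cs [x0, x1, z]
     else if nonprim (size2 [x0, x1, z]) (vals cs [x0, x1, z]) then True else
      if good x1 then leaf1 cs [x0, x1, z] else if lone z then leaf1 cs [x0, x1, z] else False)"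
| "leaf cs _ = False"

type_synonym units = "(int list list \<times> int) list"

text \<open>Primitive vectors are enumerated as conformal sums of units, that is of minimal balanced vectors. The next unit
  has a value of the sign opposite to the value \<open>v\<close> of the partial sum \<open>p\<close>; \<open>Ps\<close> and \<open>Ns\<close> are the units that may
  still be used, and the last list those among them that may come next. \<open>T\<close> contains the values of the nonzero balanced
  vectors conformal to \<open>p\<close>, so the total is not primitive if a unit of a value in \<open>- T\<close> is added without ending the
  sum.\<close>

fun search :: "cols list \<Rightarrow> nat \<Rightarrow> int list list \<Rightarrow> int \<Rightarrow> int list \<Rightarrow> units \<Rightarrow> units \<Rightarrow> units \<Rightarrow> bool" where
  "search cs n p v T Ps Ns [] = True"
| "search cs 0 p v T Ps Ns (u # L) = False"
| "search cs (Suc n) p v T Ps Ns ((q, w) # L) = (if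
    (if compat p q then
      if v + w = 0 then leaf cs (add2 p q)
      else if List.member T (- w) then True
      else (let r = add2 p q; T' = tvals (vals cs r);
          Ps' = (if 0 < v then Ps else (q, w) # L); Ns' = (if 0 < v then (q, w) # L else Ns) in
        if List.member T' 0 then True
        else search cs n r (v + w) T' Ps' Ns' (if 0 < v + w then Ns' else Ps'))
    else True)
   then search cs (Suc n) p v T Ps Ns L else False)"

text \<open>A sum of nonzero values that add up to 0 contains a positive unit. The first of these in
  the list starts the sum, so positive units added later can be taken from this place of the list
  on. The ten successors bound the depth of the search; a sum exceeding the bound is answered by
  \<open>False\<close>.\<close>

fun search_all :: "cols list \<Rightarrow> units \<Rightarrow> units \<Rightarrow> bool" where
  "search_all cs Ns [] = True"
| "search_all cs Ns ((q, w) # L) =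
    (if search cs (Suc (Suc (Suc (Suc (Suc (Suc (Suc (Suc (Suc (Suc 0)))))))))) q w (tvals (vals cs q)) ((q, w) # L) Ns Ns
     then search_all cs Ns L else False)"

fun zero_leaves :: "cols list \<Rightarrow> units \<Rightarrow> bool" where
  "zero_leaves cs [] = True"
| "zero_leaves cs ((q, w) # L) = (if w = 0 then if leaf cs q then zero_leaves cs L else False else zero_leaves cs L)"

definition check :: "cols list \<Rightarrow> units \<Rightarrow> bool" where
  "check cs U = (if zero_leaves cs U then
     search_all cs (sort_key snd (filter (\<lambda>u. snd u < 0) U)) (rev (sort_key snd (filter (\<lambda>u. 0 < snd u) U))) else False)"

text \<open>The third block, with the columns \<open>zcols\<close>, stands for units of values \<open>1, \<dots>, m\<close> outside the first two blocks.\<close>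

definition units3 where
  "units3 n0 n1 nz U0 U1 Uz =
     map (\<lambda>(q, w). ([q, replicate n1 0, replicate nz 0], w)) U0 @
     map (\<lambda>(q, w). ([replicate n0 0, q, replicate nz 0], w)) U1 @
     map (\<lambda>(q, w). ([replicate n0 0, replicate n1 0, q], w)) Uz"

section \<open>Columns and units of the concrete problems\<close>

definition scols :: "nat \<Rightarrow> cols" where "scols n = map (\<lambda>i. (1, int i)) [1..<Suc n]"
definition hcols :: "nat \<Rightarrow> cols" where "hcols n = map (\<lambda>i. (int i, 1)) [1..<Suc n]"
definition zcols :: "nat \<Rightarrow> cols" where "zcols n = map (\<lambda>i. (0, int i)) [1..<Suc n]"

definition sunits :: "nat \<Rightarrow> (int list \<times> int) list" where
  "sunits n = [(map (\<lambda>k. if k = i then 1 else if k = j then - 1 else 0) [0..<n], int i - int j).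
     i \<leftarrow> [0..<n], j \<leftarrow> [0..<n], i \<noteq> j]"
definition zunits :: "nat \<Rightarrow> (int list \<times> int) list" where
  "zunits n = map (\<lambda>i. (map (\<lambda>k. if k = i then 1 else 0) [0..<n], int i + 1)) [0..<n] @
     map (\<lambda>i. (map (\<lambda>k. if k = i then - 1 else 0) [0..<n], - int i - 1)) [0..<n]"
text \<open>The Graver basis of the single row \<open>(1, 2, 3)\<close> with both signs, each vector
  paired with the sum of its entries.\<close>

definition hunits :: "(int list \<times> int) list" where
  "hunits = [([2, - 1, 0], 1), ([3, 0, - 1], 2), ([1, 1, - 1], 1), ([0, 3, - 2], 1), ([1, - 2, 1], 0),
    ([- 2, 1, 0], - 1), ([- 3, 0, 1], - 2), ([- 1, - 1, 1], - 1), ([0, - 3, 2], - 1), ([- 1, 2, - 1], 0)]"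

definition scheck where
  "scheck n0 n1 m = check [scols n0, scols n1, zcols m] (units3 n0 n1 m (sunits n0) (sunits n1) (zunits m))"
definition hcheck where
  "hcheck = check [hcols 3, hcols 3, zcols 2] (units3 3 3 2 hunits hunits (zunits 2))"

section \<open>Correctness of the enumeration\<close>

definition conf1 :: "int \<Rightarrow> int \<Rightarrow> bool" where
  "conf1 a b \<longleftrightarrow> 0 \<le> a \<and> a \<le> b \<or> b \<le> a \<and> a \<le> 0"

abbreviation lconf where "lconf \<equiv> list_all2 conf1"
abbreviation conf2 where "conf2 \<equiv> list_all2 lconf"

fun degL :: "cols \<Rightarrow> int list \<Rightarrow> int" where
  "degL ((g, h) # c) (x # xs) = g * x + degL c xs" | "degL _ _ = 0"
fun valL :: "cols \<Rightarrow> int list \<Rightarrow> int" where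
  "valL ((g, h) # c) (x # xs) = h * x + valL c xs" | "valL _ _ = 0"
fun val2 :: "cols list \<Rightarrow> int list list \<Rightarrow> int" where
  "val2 (c # cs) (x # xs) = valL c x + val2 cs xs" | "val2 _ _ = 0"

definition shaped :: "cols list \<Rightarrow> int list list \<Rightarrow> bool" where
  "shaped = list_all2 (\<lambda>c x. length x = length c)"
definition bal2 :: "cols list \<Rightarrow> int list list \<Rightarrow> bool" where
  "bal2 = list_all2 (\<lambda>c x. length x = length c \<and> degL c x = 0)"
definition null2 :: "int list list \<Rightarrow> bool" where
  "null2 u \<longleftrightarrow> (\<forall>x\<in>set u. \<forall>a\<in>set x. a = 0)"

definition prim2 :: "cols list \<Rightarrow> int list list \<Rightarrow> bool" where
  "prim2 cs u \<longleftrightarrow> bal2 cs u \<and> val2 cs u = 0 \<and> \<not> null2 u \<and>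
     (\<forall>v. bal2 cs v \<longrightarrow> val2 cs v = 0 \<longrightarrow> conf2 v u \<longrightarrow> null2 v \<or> v = u)"

lemma bal2_shaped: "bal2 cs u \<Longrightarrow> shaped cs u"
  unfolding bal2_def shaped_def by (erule list_all2_mono) simp

section \<open>Norms and values of the conformal balanced vectors\<close>

lemma shift_eq: "shift a b c r = map (\<lambda>(s, d, t). (s + a, d + b, t + c)) r"
  by (induction r) auto

lemma shift2_eq: "shift2 a c r = map (\<lambda>(s, t). (s + a, t + c)) r"
  by (induction r) auto

lemma set_spread:
  assumes "0 \<le> k"
  shows "set (spread k b c r) = {(s + i, d + i * b, t + i * c) | s d t i. (s, d, t) \<in> set r \<and> 0 \<le> i \<and> i \<le> k}"
  using assms
proof (induction "nat k" arbitrary: k r)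
  case 0
  then have k: "k = 0" by simp
  show ?case
  proof (intro equalityI subsetI)
    fix x assume "x \<in> set (spread k b c r)"
    then have "x \<in> set r" by (simp add: k spread.simps[of 0])
    then show "x \<in> {(s + i, d + i * b, t + i * c) | s d t i. (s, d, t) \<in> set r \<and> 0 \<le> i \<and> i \<le> k}"
      by (intro CollectI exI[of _ "fst x"] exI[of _ "fst (snd x)"]
          exI[of _ "snd (snd x)"] exI[of _ 0]) (simp add: k)
  qed (auto simp: k spread.simps[of 0] dest: order_antisym)
next
  case (Suc m)
  then have k: "0 < k" "nat (k - 1) = m" "0 \<le> k - 1" by simp_all
  have "set (spread k b c r) = set r \<union> set (spread (k - 1) b c (shift 1 b c r))"
    using k by (subst spread.simps) simp
  also have "\<dots> = set r \<union> {(s + i, d + i * b, t + i * c) | s d t i. (s, d, t) \<in> set (shift 1 b c r) \<and> 0 \<le> i \<and> i \<le> k - 1}"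
    using Suc.hyps(1)[of "k - 1"] k by simp
  also have "\<dots> = {(s + i, d + i * b, t + i * c) | s d t i. (s, d, t) \<in> set r \<and> 0 \<le> i \<and> i \<le> k}" (is "?A = ?B")
  proof (intro equalityI subsetI)
    fix x assume "x \<in> ?A"
    then show "x \<in> ?B"
    proof
      assume "x \<in> set r"
      then show "x \<in> ?B" using k by (intro CollectI exI[of _ "fst x"] exI[of _ "fst (snd x)"]
          exI[of _ "snd (snd x)"] exI[of _ 0]) simp
    next
      assume "x \<in> {(s + i, d + i * b, t + i * c) | s d t i. (s, d, t) \<in> set (shift 1 b c r) \<and> 0 \<le> i \<and> i \<le> k - 1}"
      then obtain s d t i where "(s, d, t) \<in> set r" "0 \<le> i" "i \<le> k - 1"
        "x = (s + 1 + i, d + b + i * b, t + c + i * c)" by (auto simp: shift_eq)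
      then show "x \<in> ?B" by (intro CollectI exI[of _ s] exI[of _ d] exI[of _ t] exI[of _ "i + 1"]) (simp add: algebra_simps)
    qed
  next
    fix x assume "x \<in> ?B"
    then obtain s d t i where x: "(s, d, t) \<in> set r" "0 \<le> i" "i \<le> k" "x = (s + i, d + i * b, t + i * c)" by auto
    show "x \<in> ?A"
    proof (cases "i = 0")
      case False
      have "(s + 1, d + b, t + c) \<in> set (shift 1 b c r)" using x(1) by (force simp: shift_eq)
      moreover have "x = (s + 1 + (i - 1), d + b + (i - 1) * b, t + c + (i - 1) * c)" using x(4) by (simp add: algebra_simps)
      ultimately show ?thesis using False x(2,3)
        by (intro UnI2 CollectI exI[of _ "s + 1"] exI[of _ "d + b"] exI[of _ "t + c"] exI[of _ "i - 1"]) simp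
    qed (use x in simp)
  qed
  finally show ?case .
qed

lemma set_subs:
  "length x = length c \<Longrightarrow> set (subs c x) = {(sizes v, degL c v, valL c v) | v. lconf v x}"
proof (induction x c rule: list_induct2)
  case (Cons a x p c)
  obtain g h where p: "p = (g, h)" by (cases p)
  have spl: "{(sizes v, degL (p # c) v, valL (p # c) v) | v. lconf v (a # x)} =
      {(\<bar>b\<bar> + s, g * b + d, h * b + t) | b s d t. conf1 b a \<and> (s, d, t) \<in> set (subs c x)}"
    unfolding Cons.IH p by (auto simp: list_all2_Cons2) (metis sizes.simps(2) degL.simps(1) valL.simps(1))+
  consider "a = 0" | "0 < a" | "a < 0" by linarith
  then show ?case
  proof cases
    case 1
    have "{(\<bar>b\<bar> + s, g * b + d, h * b + t) | b s d t. b = 0 \<and> (s, d, t) \<in> set (subs c x)} = set (subs c x)"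
      by auto
    moreover have "conf1 b 0 \<longleftrightarrow> b = 0" for b by (auto simp: conf1_def)
    ultimately show ?thesis unfolding spl by (simp add: p 1)
  next
    case 2
    have "set (subs (p # c) (a # x)) = {(s + i, d + i * g, t + i * h) | s d t i. (s, d, t) \<in> set (subs c x) \<and> 0 \<le> i \<and> i \<le> a}"
      using 2 by (simp add: p set_spread)
    also have "\<dots> = {(\<bar>b\<bar> + s, g * b + d, h * b + t) | b s d t. conf1 b a \<and> (s, d, t) \<in> set (subs c x)}"
    proof (intro equalityI subsetI)
      fix y assume "y \<in> {(s + i, d + i * g, t + i * h) | s d t i. (s, d, t) \<in> set (subs c x) \<and> 0 \<le> i \<and> i \<le> a}"
      then obtain s d t i where "y = (s + i, d + i * g, t + i * h)" "(s, d, t) \<in> set (subs c x)" "0 \<le> i" "i \<le> a" by auto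
      then show "y \<in> {(\<bar>b\<bar> + s, g * b + d, h * b + t) | b s d t. conf1 b a \<and> (s, d, t) \<in> set (subs c x)}"
        by (intro CollectI exI[of _ i] exI[of _ s] exI[of _ d] exI[of _ t]) (simp add: conf1_def algebra_simps)
    next
      fix y assume "y \<in> {(\<bar>b\<bar> + s, g * b + d, h * b + t) | b s d t. conf1 b a \<and> (s, d, t) \<in> set (subs c x)}"
      then obtain b s d t where "y = (\<bar>b\<bar> + s, g * b + d, h * b + t)" "conf1 b a" "(s, d, t) \<in> set (subs c x)" by auto
      then show "y \<in> {(s + i, d + i * g, t + i * h) | s d t i. (s, d, t) \<in> set (subs c x) \<and> 0 \<le> i \<and> i \<le> a}"
        using 2 by (intro CollectI exI[of _ s] exI[of _ d] exI[of _ t] exI[of _ b]) (auto simp: conf1_def algebra_simps)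
    qed
    finally show ?thesis unfolding spl .
  next
    case 3
    have "set (subs (p # c) (a # x)) = {(s + i, d + i * - g, t + i * - h) | s d t i. (s, d, t) \<in> set (subs c x) \<and> 0 \<le> i \<and> i \<le> - a}"
      using 3 by (simp add: p set_spread)
    also have "\<dots> = {(\<bar>b\<bar> + s, g * b + d, h * b + t) | b s d t. conf1 b a \<and> (s, d, t) \<in> set (subs c x)}"
    proof (intro equalityI subsetI)
      fix y assume "y \<in> {(s + i, d + i * - g, t + i * - h) | s d t i. (s, d, t) \<in> set (subs c x) \<and> 0 \<le> i \<and> i \<le> - a}"
      then obtain s d t i where "y = (s + i, d + i * - g, t + i * - h)" "(s, d, t) \<in> set (subs c x)" "0 \<le> i" "i \<le> - a" by auto
      then show "y \<in> {(\<bar>b\<bar> + s, g * b + d, h * b + t) | b s d t. conf1 b a \<and> (s, d, t) \<in> set (subs c x)}"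
        by (intro CollectI exI[of _ "- i"] exI[of _ s] exI[of _ d] exI[of _ t]) (simp add: conf1_def algebra_simps)
    next
      fix y assume "y \<in> {(\<bar>b\<bar> + s, g * b + d, h * b + t) | b s d t. conf1 b a \<and> (s, d, t) \<in> set (subs c x)}"
      then obtain b s d t where "y = (\<bar>b\<bar> + s, g * b + d, h * b + t)" "conf1 b a" "(s, d, t) \<in> set (subs c x)" by auto
      then show "y \<in> {(s + i, d + i * - g, t + i * - h) | s d t i. (s, d, t) \<in> set (subs c x) \<and> 0 \<le> i \<and> i \<le> - a}"
        using 3 by (intro CollectI exI[of _ s] exI[of _ d] exI[of _ t] exI[of _ "- b"]) (auto simp: conf1_def algebra_simps)
    qed
    finally show ?thesis unfolding spl .
  qed
qed simp

lemma set_bal0: "set (bal0 r) = {(s, t). (s, 0, t) \<in> set r}"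
  by (induction r rule: bal0.induct) auto

lemma set_conv: "set (conv q r) = {(s + s', t + t') | s t s' t'. (s, t) \<in> set q \<and> (s', t') \<in> set r}"
proof (induction q r rule: conv.induct)
  case (2 s t q r)
  have "set (shift2 s t r) = {(s + s', t + t') | s' t'. (s', t') \<in> set r}"
    by (force simp: shift2_eq add.commute)
  then show ?case using 2 by auto
qed simp

lemma set_vals: "shaped cs u \<Longrightarrow> set (vals cs u) = {(size2 v, val2 cs v) | v. conf2 v u \<and> bal2 cs v}"
  unfolding shaped_def
proof (induction rule: list_all2_induct)
  case (Cons c cs x u)
  have 1: "set (bal0 (subs c x)) = {(sizes v, valL c v) | v. lconf v x \<and> degL c v = 0}"
    using set_subs[OF Cons.hyps(1)] by (auto simp: set_bal0)
  show ?case
  proof (intro equalityI subsetI)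
    fix y assume "y \<in> set (vals (c # cs) (x # u))"
    then obtain v vs where "lconf v x" "degL c v = 0" "conf2 vs u" "bal2 cs vs"
      "y = (sizes v + size2 vs, valL c v + val2 cs vs)"
      by (auto simp: set_conv 1 Cons.IH)
    then show "y \<in> {(size2 v, val2 (c # cs) v) | v. conf2 v (x # u) \<and> bal2 (c # cs) v}"
      using Cons.hyps(1) by (intro CollectI exI[of _ "v # vs"]) (auto simp: bal2_def dest: list_all2_lengthD)
  next
    fix y assume "y \<in> {(size2 v, val2 (c # cs) v) | v. conf2 v (x # u) \<and> bal2 (c # cs) v}"
    then obtain v vs where "lconf v x" "conf2 vs u" "bal2 (c # cs) (v # vs)" "y = (size2 (v # vs), val2 (c # cs) (v # vs))"
      by (auto simp: list_all2_Cons2)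
    then show "y \<in> set (vals (c # cs) (x # u))"
      by (simp add: set_conv 1 Cons.IH bal2_def) blast
  qed
qed (simp add: bal2_def)

lemma nonprim_iff: "nonprim n r \<longleftrightarrow> (\<exists>s. (s, 0) \<in> set r \<and> 0 < s \<and> s < n)"
  by (induction n r rule: nonprim.induct) auto

lemma set_tvals: "set (tvals r) = {t. \<exists>s. (s, t) \<in> set r \<and> s \<noteq> 0}"
  by (induction r rule: tvals.induct) auto

lemma sizes_ge0: "0 \<le> sizes x" by (induction x) auto
lemma sizes_0: "sizes x = 0 \<longleftrightarrow> (\<forall>a\<in>set x. a = 0)"
  by (induction x) (use sizes_ge0 in \<open>auto simp: add_nonneg_eq_0_iff\<close>)
lemma size2_ge0: "0 \<le> size2 u" by (induction u) (auto simp: sizes_ge0)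
lemma size2_0: "size2 u = 0 \<longleftrightarrow> null2 u"
  by (induction u) (auto simp: null2_def add_nonneg_eq_0_iff sizes_ge0 size2_ge0 sizes_0)

lemma set_tvals_vals:
  "shaped cs u \<Longrightarrow> set (tvals (vals cs u)) = {val2 cs v | v. conf2 v u \<and> bal2 cs v \<and> \<not> null2 v}"
  by (auto simp: set_tvals set_vals size2_0[symmetric])

lemma add1_nth: "i < length x \<Longrightarrow> i < length y \<Longrightarrow> add1 x y ! i = x ! i + y ! i"
  by (induction x y arbitrary: i rule: add1.induct) (auto simp: nth_Cons')

lemma length_add1: "length (add1 x y) = min (length x) (length y)"
  by (induction x y rule: add1.induct) auto

lemma add2_nth: "i < length x \<Longrightarrow> i < length y \<Longrightarrow> add2 x y ! i = add1 (x ! i) (y ! i)"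
  by (induction x y arbitrary: i rule: add2.induct) (auto simp: nth_Cons')

lemma length_add2: "length (add2 x y) = min (length x) (length y)"
  by (induction x y rule: add2.induct) auto

definition same :: "int list list \<Rightarrow> int list list \<Rightarrow> bool" where
  "same v u \<longleftrightarrow> length v = length u \<and> (\<forall>k<length u. length (v ! k) = length (u ! k))"

lemma conf2_iff: "conf2 v u \<longleftrightarrow> same v u \<and> (\<forall>k<length u. \<forall>i<length (u ! k). conf1 (v ! k ! i) (u ! k ! i))"
  unfolding same_def by (auto simp: list_all2_conv_all_nth)

lemma same_eqI: "same v u \<Longrightarrow> (\<And>k i. k < length u \<Longrightarrow> i < length (u ! k) \<Longrightarrow> v ! k ! i = u ! k ! i) \<Longrightarrow> v = u"
  unfolding same_def by (metis nth_equalityI)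

lemma same_add2: "same p u \<Longrightarrow> same q u \<Longrightarrow> same (add2 p q) u"
  unfolding same_def by (simp add: length_add2 add2_nth length_add1)

lemma add2_at: "same p u \<Longrightarrow> same q u \<Longrightarrow> k < length u \<Longrightarrow> i < length (u ! k) \<Longrightarrow>
    add2 p q ! k ! i = p ! k ! i + q ! k ! i"
  unfolding same_def by (simp add: add2_nth add1_nth)

lemma null2_iff: "null2 u \<longleftrightarrow> (\<forall>k<length u. \<forall>i<length (u ! k). u ! k ! i = 0)"
proof
  assume u: "null2 u"
  show "\<forall>k<length u. \<forall>i<length (u ! k). u ! k ! i = 0"
  proof (intro allI impI)
    fix k i assume "k < length u" "i < length (u ! k)"
    from nth_mem[OF this(1)] nth_mem[OF this(2)] u show "u ! k ! i = 0" by (simp add: null2_def)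
  qed
next
  assume r: "\<forall>k<length u. \<forall>i<length (u ! k). u ! k ! i = 0"
  show "null2 u" unfolding null2_def
  proof (intro ballI)
    fix x a assume "x \<in> set u" "a \<in> set x"
    then obtain k i where "k < length u" "u ! k = x" "i < length x" "x ! i = a"
      unfolding in_set_conv_nth by blast
    then show "a = 0" using r by blast
  qed
qed

lemma valL_add1: "length x = length y \<Longrightarrow> valL c (add1 x y) = valL c x + valL c y"
proof (induction c x arbitrary: y rule: valL.induct)
  case (1 g h c x xs)
  then obtain b ys where "y = b # ys" by (cases y) auto
  with 1 show ?case by (simp add: distrib_left)
qed auto

lemma degL_add1: "length x = length y \<Longrightarrow> degL c (add1 x y) = degL c x + degL c y"
proof (induction c x arbitrary: y rule: degL.induct)
  case (1 g h c x xs)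
  then obtain b ys where "y = b # ys" by (cases y) auto
  with 1 show ?case by (simp add: distrib_left)
qed auto

lemma same_Cons: "same (x # xs) y \<longleftrightarrow> (\<exists>b ys. y = b # ys \<and> length x = length b \<and> same xs ys)"
proof -
  have "same v u \<longleftrightarrow> list_all2 (\<lambda>x y. length x = length y) v u" for v u
    unfolding same_def by (auto simp: list_all2_conv_all_nth)
  then show ?thesis by (simp add: list_all2_Cons1)
qed

lemma val2_add2: "same x y \<Longrightarrow> val2 cs (add2 x y) = val2 cs x + val2 cs y"
proof (induction cs x arbitrary: y rule: val2.induct)
  case (1 c cs x xs)
  then obtain b ys where y: "y = b # ys" "length x = length b" "same xs ys"
    by (auto simp: same_Cons)
  then show ?case using 1(1)[of ys] valL_add1[of x b c] by simp
qed (auto simp: same_def)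

lemma bal2_add2:
  assumes "bal2 cs x" "bal2 cs y" shows "bal2 cs (add2 x y)"
  using assms unfolding bal2_def
  by (auto simp: list_all2_conv_all_nth length_add2 add2_nth length_add1 degL_add1)

lemma val2_null: "null2 x \<Longrightarrow> val2 cs x = 0"
proof (induction cs x rule: val2.induct)
  case (1 c cs x xs)
  have "valL c x = 0" if "\<forall>a\<in>set x. a = 0" for x using that by (induction c x rule: valL.induct) auto
  then show ?case using 1 by (simp add: null2_def)
qed auto

lemma compat1_lconf: "lconf p u \<Longrightarrow> lconf q u \<Longrightarrow> compat1 p q"
proof (induction p q arbitrary: u rule: compat1.induct)
  case (1 x xs y ys)
  then obtain a us where "u = a # us" "conf1 x a" "conf1 y a" "lconf xs us" "lconf ys us" by (cases u) auto
  then have "\<not> (0 < y \<and> x < 0)" "\<not> (y < 0 \<and> 0 < x)" by (auto simp: conf1_def)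
  moreover have "lconf xs us" "lconf ys us" by fact+
  ultimately show ?case using 1(1-3)[of us] by (cases "y = 0"; cases "0 < y") auto
qed auto

lemma compat_conf2: "conf2 p u \<Longrightarrow> conf2 q u \<Longrightarrow> compat p q"
proof (induction p q arbitrary: u rule: compat.induct)
  case (1 x xs y ys)
  then obtain a us where "u = a # us" "lconf x a" "lconf y a" "conf2 xs us" "conf2 ys us" by (cases u) auto
  then show ?case using 1(1)[of us] compat1_lconf by auto
qed auto

section \<open>Conformal sums of units\<close>

inductive dec :: "units \<Rightarrow> units \<Rightarrow> int list list \<Rightarrow> bool" for U where
  nil: "null2 r \<Longrightarrow> dec U [] r"
| cons: "(q, w) \<in> set U \<Longrightarrow> dec U M r \<Longrightarrow> same q r \<Longrightarrow> conf2 q (add2 q r) \<Longrightarrow> dec U ((q, w) # M) (add2 q r)"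

text \<open>A conformal sum may be taken in any order, which lets the search prescribe the sign of
  the next unit.\<close>

lemma dec_pick:
  "dec U M r \<Longrightarrow> (q, w) \<in> set M \<Longrightarrow> \<exists>r'. r = add2 q r' \<and> same q r' \<and> conf2 q r \<and> dec U (remove1 (q, w) M) r'"
proof (induction rule: dec.induct)
  case (cons p v M r)
  show ?case
  proof (cases "(p, v) = (q, w)")
    case True
    then show ?thesis using cons by auto
  next
    case False
    then obtain r' where r': "r = add2 q r'" "same q r'" "conf2 q r" "dec U (remove1 (q, w) M) r'"
      using cons by auto
    have s: "same q r'" "same r' r'" "same p r'" "same r r'"
      using r' cons(3) by (auto simp: same_def length_add2 add2_nth length_add1)
    have s1: "same (add2 q r') r'" "same (add2 p r') r'" using s by (auto intro: same_add2)
    have s2: "same (add2 p (add2 q r')) r'" "same (add2 q (add2 p r')) r'" using s s1 by (auto intro: same_add2)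
    have pt: "conf1 (p ! k ! i) (add2 p r' ! k ! i) \<and> conf1 (q ! k ! i) (add2 q (add2 p r') ! k ! i) \<and>
        add2 p (add2 q r') ! k ! i = add2 q (add2 p r') ! k ! i"
      if ki: "k < length r'" "i < length (r' ! k)" for k i
    proof -
      have "conf1 (p ! k ! i) (add2 p (add2 q r') ! k ! i)"
        using cons(4) ki s2(1) unfolding r'(1) conf2_iff by (simp add: same_def)
      then have "conf1 (p ! k ! i) (p ! k ! i + (q ! k ! i + r' ! k ! i))"
        unfolding add2_at[OF s(3) s1(1) ki] add2_at[OF s(1,2) ki] .
      moreover have "conf1 (q ! k ! i) (add2 q r' ! k ! i)"
        using r'(3) ki s1(1) unfolding r'(1) conf2_iff by (simp add: same_def)
      then have "conf1 (q ! k ! i) (q ! k ! i + r' ! k ! i)"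
        unfolding add2_at[OF s(1,2) ki] .
      ultimately show ?thesis
        by (auto simp: conf1_def add2_at[OF s(3) s1(1) ki] add2_at[OF s(1,2) ki] add2_at[OF s(1) s1(2) ki] add2_at[OF s(3,2) ki])
    qed
    have e: "add2 p r = add2 q (add2 p r')" unfolding r'(1)
      by (rule same_eqI) (use pt s2 in \<open>auto simp: same_def\<close>)
    have "conf2 q (add2 q (add2 p r'))" "conf2 p (add2 p r')"
      unfolding conf2_iff using pt s s1 s2 by (auto simp: same_def)
    moreover have "dec U ((p, v) # remove1 (q, w) M) (add2 p r')"
      using cons(1) r'(4) s(3) \<open>conf2 p (add2 p r')\<close> by (rule dec.cons)
    moreover have "same q (add2 p r')" using s s1 by (auto simp: same_def)
    ultimately show ?thesis unfolding e using False by auto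
  qed
qed simp

lemma dec_units: "dec U M r \<Longrightarrow> set M \<subseteq> set U"
  by (induction rule: dec.induct) auto

definition units_ok :: "cols list \<Rightarrow> units \<Rightarrow> bool" where
  "units_ok cs U \<longleftrightarrow> (\<forall>u\<in>set U. bal2 cs (fst u) \<and> snd u = val2 cs (fst u) \<and> \<not> null2 (fst u)) \<and>
     (\<forall>r. bal2 cs r \<longrightarrow> \<not> null2 r \<longrightarrow> (\<exists>u\<in>set U. conf2 (fst u) r))"

lemma size2_add2: "same q r \<Longrightarrow> conf2 q (add2 q r) \<Longrightarrow> size2 (add2 q r) = size2 q + size2 r"
proof (induction q r rule: add2.induct)
  case (1 x xs y ys)
  have "sizes (add1 x y) = sizes x + sizes y" if "lconf x (add1 x y)" "length x = length y" for x y
    using that by (induction x y rule: add1.induct) (auto simp: conf1_def)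
  moreover have "length x = length y" "same xs ys" using 1(2) by (auto simp: same_Cons)
  ultimately show ?case using 1 by simp
qed (auto simp: same_def)

text \<open>Subtracting a conformal unit lowers the norm and leaves a balanced vector.\<close>

lemma ex_dec:
  assumes "units_ok cs U" "bal2 cs r"
  shows "\<exists>M. dec U M r"
  using assms(2)
proof (induction "nat (size2 r)" arbitrary: r rule: less_induct)
  case less
  show ?case
  proof (cases "null2 r")
    case True
    then show ?thesis by (blast intro: dec.nil)
  next
    case False
    have "\<exists>u\<in>set U. conf2 (fst u) r"
      using assms(1) less.prems False unfolding units_ok_def by blast
    then obtain qw where qw: "qw \<in> set U" "conf2 (fst qw) r" ..
    obtain q w where qw_eq: "qw = (q, w)" by (cases qw)
    have "bal2 cs (fst qw) \<and> \<not> null2 (fst qw)" using assms(1) qw(1) unfolding units_ok_def by blast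
    with qw have q: "(q, w) \<in> set U" "conf2 q r" "bal2 cs q" "\<not> null2 q" by (simp_all add: qw_eq)
    define r' where "r' = add2 r (map (map uminus) q)"
    have sq: "same q r" using q(2) by (simp add: conf2_iff)
    have su: "same (map (map uminus) q) r" using sq by (simp add: same_def)
    have sr: "same r r" "same r' r" unfolding r'_def using su same_add2[of r r "map (map uminus) q"] by (auto simp: same_def)
    have at: "r' ! k ! i = r ! k ! i - q ! k ! i" if "k < length r" "i < length (r ! k)" for k i
      unfolding r'_def using add2_at[OF sr(1) su that] sq that by (simp add: same_def)
    have e: "add2 q r' = r"
      by (rule same_eqI) (use at add2_at[OF sq sr(2)] same_add2[OF sq sr(2)] in auto)
    have "degL c (map uminus x) = - degL c x" for c x
      by (induction c x rule: degL.induct) auto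
    then have "bal2 cs (map (map uminus) q)" using q(3) unfolding bal2_def
      by (auto simp: list_all2_conv_all_nth)
    then have b: "bal2 cs r'" unfolding r'_def using less.prems by (intro bal2_add2)
    have s': "same q r'" using sq sr(2) by (auto simp: same_def)
    have "size2 r = size2 q + size2 r'" using size2_add2[OF s'] q(2) e by simp
    moreover have "0 < size2 q" using q(4) size2_0[of q] size2_ge0[of q] by linarith
    ultimately have "nat (size2 r') < nat (size2 r)" using size2_ge0[of r'] by linarith
    then obtain M where "dec U M r'" using less.hyps b by blast
    then have "dec U ((q, w) # M) (add2 q r')" by (rule dec.cons[OF q(1)]) (use s' q(2) e in simp_all)
    then show ?thesis using e by auto
  qed
qed

lemma dec_props:
  assumes "units_ok cs U" "dec U M r"
  shows "val2 cs r = (\<Sum>u\<leftarrow>M. snd u)" "M \<noteq> [] \<Longrightarrow> \<not> null2 r" "u \<in> set M \<Longrightarrow> conf2 (fst u) r"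
proof -
  show "val2 cs r = (\<Sum>u\<leftarrow>M. snd u)"
    using assms(2)
  proof (induction rule: dec.induct)
    case (cons q w M r)
    have "snd (q, w) = val2 cs (fst (q, w))" using assms(1) cons(1) unfolding units_ok_def by blast
    then show ?case using cons val2_add2[of q r cs] by simp
  qed (simp add: val2_null)
  show c: "conf2 (fst u) r" if "u \<in> set M" for u
    using dec_pick[OF assms(2), of "fst u" "snd u"] that by auto
  show "\<not> null2 r" if "M \<noteq> []"
  proof
    assume "null2 r"
    have "hd M \<in> set M" using that by simp
    then have h: "conf2 (fst (hd M)) r" "hd M \<in> set U" using c dec_units[OF assms(2)] by auto
    moreover have "conf1 a 0 \<longleftrightarrow> a = 0" for a by (auto simp: conf1_def)
    ultimately have "null2 (fst (hd M))" using \<open>null2 r\<close> unfolding null2_iff conf2_iff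
      by (auto simp: same_def)
    then show False using assms(1) h(2) unfolding units_ok_def by blast
  qed
qed

lemma conf2_trans: "conf2 a b \<Longrightarrow> conf2 b c \<Longrightarrow> conf2 a c"
  by (erule list_all2_trans[rotated], assumption) (erule list_all2_trans[rotated], assumption, auto simp: conf1_def)

lemma conf2_antisym: "conf2 a b \<Longrightarrow> conf2 b a \<Longrightarrow> a = b"
proof (rule same_eqI)
  assume ab: "conf2 a b" "conf2 b a"
  then show "same a b" by (simp add: conf2_iff)
  fix k i assume "k < length b" "i < length (b ! k)"
  then have "conf1 (a ! k ! i) (b ! k ! i)" "conf1 (b ! k ! i) (a ! k ! i)"
    using ab by (auto simp: conf2_iff same_def)
  then show "a ! k ! i = b ! k ! i" by (auto simp: conf1_def)
qed

lemma conf2_refl: "conf2 a a"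
  by (auto simp: conf2_iff same_def conf1_def)

lemma conf2_add_mono:
  assumes "conf2 v p" "same p q" "conf2 p (add2 p q)"
  shows "conf2 (add2 v q) (add2 p q)"
proof -
  have s: "same p q" "same q q" "same v q" using assms(1,2) by (auto simp: conf2_iff same_def)
  have s1: "same (add2 p q) q" "same (add2 v q) q" using s by (auto intro: same_add2)
  have "conf1 (add2 v q ! k ! i) (add2 p q ! k ! i)" if ki: "k < length q" "i < length (q ! k)" for k i
  proof -
    have "conf1 (v ! k ! i) (p ! k ! i)" using assms(1) ki s by (simp add: conf2_iff same_def)
    moreover have "conf1 (p ! k ! i) (add2 p q ! k ! i)" using assms(3) ki s1 by (simp add: conf2_iff same_def)
    ultimately show ?thesis
      unfolding add2_at[OF s(1,2) ki] add2_at[OF s(3,2) ki] by (auto simp: conf1_def)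
  qed
  then show ?thesis unfolding conf2_iff using s1 by (auto simp: same_def)
qed

text \<open>A step of the search: \<open>p\<close> is the part of \<open>u\<close> collected so far, \<open>r\<close> the rest.\<close>

lemma split_step:
  assumes "u = add2 p r" "same p r" "conf2 p u" "r = add2 q r'" "same q r'" "conf2 q r"
  shows "u = add2 (add2 p q) r'" "same (add2 p q) r'" "conf2 (add2 p q) u" "conf2 q u"
    "same p q" "conf2 p (add2 p q)"
proof -
  have s: "same q r'" "same r' r'" "same p r'" "same r r'"
    using assms by (auto simp: same_def length_add2 add2_nth length_add1)
  have s1: "same (add2 p q) r'" "same (add2 q r') r'" using s by (auto intro: same_add2)
  have s2: "same u r'" "same (add2 (add2 p q) r') r'" unfolding assms(1) using s s1 by (auto intro: same_add2)
  have pt: "u ! k ! i = p ! k ! i + q ! k ! i + r' ! k ! i" "add2 p q ! k ! i = p ! k ! i + q ! k ! i"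
    "conf1 (p ! k ! i) (p ! k ! i + q ! k ! i + r' ! k ! i)" "conf1 (q ! k ! i) (q ! k ! i + r' ! k ! i)"
    if ki: "k < length r'" "i < length (r' ! k)" for k i
  proof -
    show e: "u ! k ! i = p ! k ! i + q ! k ! i + r' ! k ! i"
      unfolding assms(1,4) using add2_at[OF s(3) s1(2) ki] add2_at[OF s(1,2) ki] by simp
    show "add2 p q ! k ! i = p ! k ! i + q ! k ! i" using add2_at[OF s(3,1) ki] .
    have "conf1 (p ! k ! i) (u ! k ! i)" using assms(3) ki s2 by (simp add: conf2_iff same_def)
    then show "conf1 (p ! k ! i) (p ! k ! i + q ! k ! i + r' ! k ! i)" unfolding e .
    have "conf1 (q ! k ! i) (r ! k ! i)" using assms(6) ki s by (simp add: conf2_iff same_def)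
    then show "conf1 (q ! k ! i) (q ! k ! i + r' ! k ! i)" unfolding assms(4) add2_at[OF s(1,2) ki] .
  qed
  show "u = add2 (add2 p q) r'"
    by (rule same_eqI) (use s1 s2 pt in \<open>auto simp: same_def add2_at[OF s1(1) s(2)]\<close>)
  show "same (add2 p q) r'" by fact
  have "conf1 (p ! k ! i + q ! k ! i) (p ! k ! i + q ! k ! i + r' ! k ! i) \<and>
      conf1 (q ! k ! i) (p ! k ! i + q ! k ! i + r' ! k ! i) \<and> conf1 (p ! k ! i) (p ! k ! i + q ! k ! i)"
    if "k < length r'" "i < length (r' ! k)" for k i
    using pt(3,4)[OF that] by (auto simp: conf1_def)
  then show "conf2 (add2 p q) u" "conf2 q u" "conf2 p (add2 p q)"
    unfolding conf2_iff using pt s s1 s2 by (auto simp: same_def)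
  show "same p q" using s by (auto simp: same_def)
qed

text \<open>\<open>M\<close> consists of the units of \<open>u\<close> still to be added, and
  \<open>r\<close> is their sum. \<open>Ps\<close> and \<open>Ns\<close> contain all of these of the
  respective sign, and \<open>L\<close> contains all of those whose sign is opposite to that of
  \<open>v\<close>.\<close>

definition search_inv ::
    "cols list \<Rightarrow> units \<Rightarrow> int list list \<Rightarrow> units \<Rightarrow> int list list \<Rightarrow> int list list \<Rightarrow> int \<Rightarrow> int list \<Rightarrow> units \<Rightarrow> units \<Rightarrow> units \<Rightarrow> bool" where
  "search_inv cs U u M r p v T Ps Ns L \<longleftrightarrow>
     dec U M r \<and> u = add2 p r \<and> same p r \<and> conf2 p u \<and> (\<forall>x\<in>set M. snd x \<noteq> 0) \<and>
     bal2 cs p \<and> v = val2 cs p \<and> v \<noteq> 0 \<and>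
     set T = {val2 cs x | x. conf2 x p \<and> bal2 cs x \<and> \<not> null2 x} \<and>
     {x \<in> set M. 0 < snd x} \<subseteq> set Ps \<and> {x \<in> set M. snd x < 0} \<subseteq> set Ns \<and>
     (if 0 < v then {x \<in> set M. snd x < 0} \<subseteq> set L else {x \<in> set M. 0 < snd x} \<subseteq> set L)"

text \<open>All remaining units have the sign of \<open>v\<close>, so the total value cannot be
  0.\<close>

lemma search_inv_Nil:
  assumes U: "units_ok cs U" and u: "prim2 cs u" and inv: "search_inv cs U u M r p v T Ps Ns []"
  shows False
proof -
  note inv = inv[unfolded search_inv_def]
  have d: "dec U M r" "u = add2 p r" "same p r" "v = val2 cs p" "v \<noteq> 0" "\<forall>x\<in>set M. snd x \<noteq> 0"
    using inv by blast+
  have "val2 cs u = 0" using u by (simp add: prim2_def)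
  then have s: "(\<Sum>u\<leftarrow>M. snd u) = - v"
    using val2_add2[OF d(3), of cs] dec_props(1)[OF U d(1)] d(2,4) by simp
  show False
  proof (cases "0 < v")
    case True
    then have "\<forall>x\<in>set M. \<not> snd x < 0" using inv by auto
    then have "0 \<le> (\<Sum>u\<leftarrow>M. snd u)" by (intro sum_list_nonneg) auto
    then show ?thesis using s True by simp
  next
    case False
    then have "\<forall>x\<in>set M. \<not> 0 < snd x" using inv by auto
    then have "(\<Sum>u\<leftarrow>M. snd u) \<le> 0" by (intro sum_list_nonpos) auto
    then show ?thesis using s False d(5) by simp
  qed
qed

text \<open>Every pruning test rests on \<open>full\<close>: a nonzero balanced vector of value 0
  conformal to \<open>add2 p q\<close> is \<open>u\<close> by primitivity, and then
  \<open>add2 p q\<close> is all of \<open>u\<close>.\<close>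

lemma search_inv_step:
  assumes U: "units_ok cs U" and u: "prim2 cs u"
    and inv: "search_inv cs U u M r p v T Ps Ns ((q, w) # L)" and M: "(q, w) \<in> set M"
  defines "Ps' \<equiv> if 0 < v then Ps else (q, w) # L" and "Ns' \<equiv> if 0 < v then (q, w) # L else Ns"
  shows "compat p q" "v + w = 0 \<Longrightarrow> add2 p q = u" "v + w \<noteq> 0 \<Longrightarrow> - w \<notin> set T"
    "v + w \<noteq> 0 \<Longrightarrow> 0 \<notin> set (tvals (vals cs (add2 p q)))"
    "v + w \<noteq> 0 \<Longrightarrow> \<exists>M' r'. search_inv cs U u M' r' (add2 p q) (v + w) (tvals (vals cs (add2 p q))) Ps' Ns'
       (if 0 < v + w then Ns' else Ps')"
proof -
  note inv = inv[unfolded search_inv_def]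
  have d: "dec U M r" "u = add2 p r" "same p r" "conf2 p u" "bal2 cs p" "v = val2 cs p" "v \<noteq> 0"
    and nz: "\<forall>x\<in>set M. snd x \<noteq> 0"
    and T: "set T = {val2 cs x | x. conf2 x p \<and> bal2 cs x \<and> \<not> null2 x}"
    and Ps: "{x \<in> set M. 0 < snd x} \<subseteq> set Ps" and Ns: "{x \<in> set M. snd x < 0} \<subseteq> set Ns"
    using inv by blast+
  have L: "0 < v \<Longrightarrow> {x \<in> set M. snd x < 0} \<subseteq> set ((q, w) # L)"
    "\<not> 0 < v \<Longrightarrow> {x \<in> set M. 0 < snd x} \<subseteq> set ((q, w) # L)"
    using inv by presburger+
  obtain r' where r': "r = add2 q r'" "same q r'" "conf2 q r" "dec U (remove1 (q, w) M) r'"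
    using dec_pick[OF d(1) M] by blast
  note st = split_step[OF d(2,3,4) r'(1-3)]
  have "(q, w) \<in> set U" using M dec_units[OF d(1)] by blast
  then have "bal2 cs (fst (q, w)) \<and> snd (q, w) = val2 cs (fst (q, w)) \<and> \<not> null2 (fst (q, w))"
    using U unfolding units_ok_def by blast
  then have qw: "bal2 cs q" "w = val2 cs q" "\<not> null2 q" by simp_all
  have bpq: "bal2 cs (add2 p q)" using d(5) qw(1) by (rule bal2_add2)
  have vpq: "val2 cs (add2 p q) = v + w" using val2_add2[OF st(5)] d(6) qw(2) by simp
  \<comment> \<open>\<open>v'\<close> has the signs of \<open>p\<close>, and adding \<open>q\<close>
    to \<open>p\<close> cancels nothing, so \<open>v'\<close> and \<open>q\<close> cannot cancel
    either.\<close>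
  have ne: "\<not> null2 (add2 v' q)" if v': "conf2 v' p" for v'
  proof
    assume n: "null2 (add2 v' q)"
    have sm: "same v' q" "same q q" using v' st(5) by (auto simp: conf2_iff same_def)
    have s': "same (add2 v' q) q" "same (add2 p q) q" using same_add2 sm st(5) by blast+
    have "q ! k ! i = 0" if ki: "k < length q" "i < length (q ! k)" for k i
    proof -
      have "add2 v' q ! k ! i = 0" using n ki s' unfolding null2_iff same_def by simp
      then have "v' ! k ! i + q ! k ! i = 0" unfolding add2_at[OF sm ki] .
      moreover have "conf1 (v' ! k ! i) (p ! k ! i)" using v' ki sm by (simp add: conf2_iff same_def)
      moreover have "conf1 (p ! k ! i) (add2 p q ! k ! i)"
        using st(6) ki s' unfolding conf2_iff by (simp add: same_def)
      ultimately show ?thesis unfolding add2_at[OF st(5) sm(2) ki] by (auto simp: conf1_def)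
    qed
    then show False using qw(3) unfolding null2_iff by blast
  qed
  have full: "add2 p q = u" if x: "conf2 x (add2 p q)" "bal2 cs x" "\<not> null2 x" "val2 cs x = 0" for x
  proof -
    have "conf2 x u" using x(1) st(3) by (rule conf2_trans)
    then have "x = u" using u x(2-4) unfolding prim2_def by blast
    then show ?thesis using x(1) st(3) conf2_antisym by blast
  qed
  have u0: "val2 cs u = 0" using u by (simp add: prim2_def)
  show "compat p q" using d(4) st(4) by (rule compat_conf2)
  show "add2 p q = u" if "v + w = 0"
    using full[OF conf2_refl bpq ne[OF conf2_refl]] vpq that by simp
  show "- w \<notin> set T" if vw: "v + w \<noteq> 0"
  proof
    assume "- w \<in> set T"
    then obtain x where x: "conf2 x p" "bal2 cs x" "val2 cs x = - w" unfolding T by auto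
    have sx: "same x q" using x(1) st(5) by (auto simp: conf2_iff same_def)
    have "val2 cs (add2 x q) = 0" using val2_add2[OF sx] x(3) qw(2) by simp
    then have "add2 p q = u"
      using full[OF conf2_add_mono[OF x(1) st(5,6)] bal2_add2[OF x(2) qw(1)] ne[OF x(1)]] by blast
    then show False using vpq vw u0 by simp
  qed
  define T' where "T' = tvals (vals cs (add2 p q))"
  have T': "set T' = {val2 cs x | x. conf2 x (add2 p q) \<and> bal2 cs x \<and> \<not> null2 x}"
    unfolding T'_def by (rule set_tvals_vals) (rule bal2_shaped[OF bpq])
  show "0 \<notin> set (tvals (vals cs (add2 p q)))" if vw: "v + w \<noteq> 0"
  proof
    assume "0 \<in> set (tvals (vals cs (add2 p q)))"
    then obtain x where "0 = val2 cs x" "conf2 x (add2 p q)" "bal2 cs x" "\<not> null2 x"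
      unfolding T'_def[symmetric] T' by blast
    then have "add2 p q = u" using full by simp
    then show False using vpq vw u0 by simp
  qed
  have rm: "set (remove1 (q, w) M) \<subseteq> set M" by (rule set_remove1_subset)
  show "\<exists>M' r'. search_inv cs U u M' r' (add2 p q) (v + w) (tvals (vals cs (add2 p q))) Ps' Ns'
     (if 0 < v + w then Ns' else Ps')" if vw: "v + w \<noteq> 0"
  proof (intro exI)
    have Ps': "{x \<in> set (remove1 (q, w) M). 0 < snd x} \<subseteq> set Ps'"
      using Ps L(2) rm unfolding Ps'_def by (cases "0 < v") auto
    have Ns': "{x \<in> set (remove1 (q, w) M). snd x < 0} \<subseteq> set Ns'"
      using Ns L(1) rm unfolding Ns'_def by (cases "0 < v") auto
    show "search_inv cs U u (remove1 (q, w) M) r' (add2 p q) (v + w) (tvals (vals cs (add2 p q))) Ps' Ns'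
     (if 0 < v + w then Ns' else Ps')"
      unfolding search_inv_def T'_def[symmetric]
      using r'(4) st(1,2,3) bpq vpq vw T' Ps' Ns' nz rm by auto
  qed
qed

lemma search_sound:
  assumes U: "units_ok cs U" and u: "prim2 cs u"
  shows "search cs N p v T Ps Ns L \<Longrightarrow> search_inv cs U u M r p v T Ps Ns L \<Longrightarrow> leaf cs u"
proof (induction N arbitrary: p v T Ps Ns L M r)
  case 0
  show ?case
  proof (cases L)
    case Nil
    then show ?thesis using search_inv_Nil[OF U u] 0 by blast
  qed (use 0 in simp)
next
  case (Suc N)
  from Suc.prems show ?case
  proof (induction L)
    case Nil
    then show ?case using search_inv_Nil[OF U u] by blast
  next
    case (Cons x L)
    obtain q w where x: "x = (q, w)" by (cases x)
    note search = Cons.prems(1)[unfolded x] and inv = Cons.prems(2)[unfolded x]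
    have goL: "search cs (Suc N) p v T Ps Ns L" using search by (simp split: if_splits)
    show ?case
    proof (cases "(q, w) \<in> set M")
      case False
      \<comment> \<open>A unit that does not occur in the rest of \<open>u\<close> can be removed
        from the scanned list without losing one that does.\<close>
      then have "search_inv cs U u M r p v T Ps Ns L"
        using inv unfolding search_inv_def by (auto split: if_splits)
      then show ?thesis using Cons.IH goL by blast
    next
      case True
      note step = search_inv_step[OF U u inv True]
      show ?thesis
      proof (cases "v + w = 0")
        case True
        then show ?thesis using search step(1,2) by (simp split: if_splits)
      next
        case False
        have "search cs N (add2 p q) (v + w) (tvals (vals cs (add2 p q))) (if 0 < v then Ps else (q, w) # L)
           (if 0 < v then (q, w) # L else Ns)
           (if 0 < v + w then (if 0 < v then (q, w) # L else Ns) else (if 0 < v then Ps else (q, w) # L))"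
          using search step(1) step(3,4)[OF False] False
          by (simp add: Let_def List.member_iff split: if_split_asm)
        then show ?thesis using step(5)[OF False] Suc.IH by blast
      qed
    qed
  qed
qed

lemma zero_leaves_iff: "zero_leaves cs L \<longleftrightarrow> (\<forall>u\<in>set L. snd u = 0 \<longrightarrow> leaf cs (fst u))"
  by (induction cs L rule: zero_leaves.induct) auto

lemma search_all_sound:
  assumes "search_all cs Ns L"
    and U: "units_ok cs U" and u: "prim2 cs u"
    and d: "dec U M u" and nz: "\<forall>x\<in>set M. snd x \<noteq> 0"
    and L: "{x \<in> set M. 0 < snd x} \<subseteq> set L" "\<exists>x\<in>set M. 0 < snd x"
    and Ns: "{x \<in> set M. snd x < 0} \<subseteq> set Ns"
    and pos: "\<forall>x\<in>set L. 0 < snd x"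
  shows "leaf cs u"
  using assms
proof (induction cs Ns L rule: search_all.induct)
  case (2 cs Ns q w L)
  show ?case
  proof (cases "(q, w) \<in> set M")
    case False
    then show ?thesis using 2 by (auto split: if_splits)
  next
    case True
    obtain r' where r': "u = add2 q r'" "same q r'" "conf2 q u" "dec U (remove1 (q, w) M) r'"
      using dec_pick[OF 2(5) True] by blast
    have "(q, w) \<in> set U" using True dec_units[OF 2(5)] by blast
    then have "bal2 cs (fst (q, w)) \<and> snd (q, w) = val2 cs (fst (q, w))"
      using 2(3) unfolding units_ok_def by blast
    then have qw: "bal2 cs q" "w = val2 cs q" by simp_all
    have rm: "set (remove1 (q, w) M) \<subseteq> set M" by (rule set_remove1_subset)
    have "0 < w" using 2(10) by simp
    show ?thesis
    proof (rule search_sound[OF 2(3,4)])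
      show "search cs (Suc (Suc (Suc (Suc (Suc (Suc (Suc (Suc (Suc (Suc 0)))))))))) q w (tvals (vals cs q)) ((q, w) # L) Ns Ns"
        using 2(2) by (simp del: search.simps split: if_splits)
      have "set (tvals (vals cs q)) = {val2 cs x | x. conf2 x q \<and> bal2 cs x \<and> \<not> null2 x}"
        by (rule set_tvals_vals) (rule bal2_shaped[OF qw(1)])
      then show "search_inv cs U u (remove1 (q, w) M) r' q w (tvals (vals cs q)) ((q, w) # L) Ns Ns"
        unfolding search_inv_def using r' qw \<open>0 < w\<close> 2(6,7,9) rm by auto
    qed
  qed
qed auto

text \<open>A unit of value 0 conformal to a primitive \<open>u\<close> is \<open>u\<close> itself,
  which is covered by \<open>zero_leaves\<close>. Otherwise the values of the units are nonzero with
  sum 0, so one of them is positive and \<open>search_all\<close> applies.\<close>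

theorem check_sound:
  assumes "check cs U" and U: "units_ok cs U" and u: "prim2 cs u"
  shows "leaf cs u"
proof -
  let ?N = "sort_key snd (filter (\<lambda>u. snd u < 0) U)" and ?P = "rev (sort_key snd (filter (\<lambda>u. 0 < snd u) U))"
  have c: "zero_leaves cs U" "search_all cs ?N ?P" using assms(1) unfolding check_def by (auto split: if_splits)
  have ub: "bal2 cs u" "val2 cs u = 0" "\<not> null2 u" using u by (simp_all add: prim2_def)
  obtain M where M: "dec U M u" using ex_dec[OF U ub(1)] by blast
  have MU: "set M \<subseteq> set U" using dec_units[OF M] .
  show ?thesis
  proof (cases "\<forall>x\<in>set M. snd x \<noteq> 0")
    case False
    then obtain x where x: "x \<in> set M" "snd x = 0" by blast
    then have "x \<in> set U" using MU by blast
    then have "bal2 cs (fst x)" "val2 cs (fst x) = 0" "\<not> null2 (fst x)"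
      using U x(2) unfolding units_ok_def by auto
    then have "fst x = u" using dec_props(3)[OF U M x(1)] u unfolding prim2_def by blast
    then show ?thesis using c(1) x(2) \<open>x \<in> set U\<close> unfolding zero_leaves_iff by blast
  next
    case True
    have sum0: "(\<Sum>x\<leftarrow>M. snd x) = 0" using dec_props(1)[OF U M] ub(2) by simp
    have "\<exists>x\<in>set M. 0 < snd x"
    proof (rule ccontr)
      assume "\<not> ?thesis"
      then have neg: "\<forall>x\<in>set M. snd x < 0" using True by (meson linorder_neqE)
      have "M \<noteq> []" using M ub(3) by (auto elim: dec.cases)
      then have "(\<Sum>x\<leftarrow>M. snd x) < 0" using neg
        by (induction M rule: list_nonempty_induct) auto
      then show False using sum0 by simp
    qed
    then show ?thesis
      by (intro search_all_sound[OF c(2) U u M True]) (use MU in auto)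
  qed
qed

section \<open>Correctness of the separating functionals\<close>

text \<open>The differences of nonnegative vectors supported in the second argument and the negative
  part of the latter.\<close>

definition ladm :: "int list \<Rightarrow> int list \<Rightarrow> bool" where
  "ladm = list_all2 (\<lambda>a b. (b = 0 \<longrightarrow> a = 0) \<and> (0 < b \<longrightarrow> 0 \<le> a) \<and> (b < 0 \<longrightarrow> b \<le> a))"

text \<open>The functional lives on the first two blocks only; the third block appears as a
  conformal vector \<open>z'\<close> that balances the value.\<close>

definition separable :: "cols \<Rightarrow> cols \<Rightarrow> cols \<Rightarrow> int list \<Rightarrow> int list \<Rightarrow> int list \<Rightarrow> bool" where
  "separable c0 c1 cz x0 x1 z \<longleftrightarrow> (\<exists>w. dot w (x0 @ x1) = 0 \<and>
     (\<forall>y0 y1 z'. ladm y0 x0 \<longrightarrow> ladm y1 x1 \<longrightarrow> lconf z' z \<longrightarrow> degL c0 y0 = 0 \<longrightarrow> degL c1 y1 = 0 \<longrightarrow>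
        valL c0 y0 + valL c1 y1 + valL cz z' = 0 \<longrightarrow> \<not> (lconf y0 x0 \<and> lconf y1 x1) \<longrightarrow> 0 < dot w (y0 @ y1)))"

lemma dot_add1: "length x = length y \<Longrightarrow> dot w (add1 x y) = dot w x + dot w y"
proof (induction w x arbitrary: y rule: dot.induct)
  case (1 a w x xs)
  then obtain b ys where "y = b # ys" by (cases y) auto
  with 1 show ?case by (simp add: distrib_left)
qed auto

lemma add1_append: "length x = length y \<Longrightarrow> add1 (x @ x') (y @ y') = add1 x y @ add1 x' y'"
  by (induction x y rule: list_induct2) auto

lemma length_negp: "length (negp x) = length x" by (induction x) auto
lemma negp_append: "negp (x @ y) = negp x @ negp y" by (induction x) auto

lemma allpos_iff: "allpos w b E \<longleftrightarrow> (\<forall>X\<in>set E. b < dot w X)"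
  by (induction E) auto

lemma sep_sound: "sep q E \<Longrightarrow> \<exists>w. dot w q = 0 \<and> (\<forall>X\<in>set E. dot w (negp q) < dot w X)"
proof (cases E)
  case Nil
  then show ?thesis by (intro exI[of _ "[]"]) simp
next
  case (Cons X E')
  assume "sep q E"
  then show ?thesis unfolding sep_def by (auto simp: Cons Let_def allpos_iff split: if_splits)
qed

lemma dneg_eq: "dneg c x = degL c (negp x)"
  by (induction c x rule: dneg.induct) auto
lemma vneg_eq: "vneg c x = valL c (negp x)"
  by (induction c x rule: vneg.induct) auto

lemma grow_mem:
  assumes "0 < g" "0 \<le> i" "g * i \<le> D"
  shows "((k + i) # X, D - g * i, t + h * i) \<in> set (grow k X D t g h)"
  using assms(2,3)
proof (induction "nat i" arbitrary: i k D t)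
  case 0
  then show ?case using assms(1) by (subst grow.simps) simp
next
  case (Suc m)
  then have i: "0 < i" "m = nat (i - 1)" by simp_all
  have "0 < g * i" using assms(1) i(1) by simp
  then have D: "0 \<le> D" using Suc.prems by simp
  have "((k + 1 + (i - 1)) # X, D - g - g * (i - 1), t + h + h * (i - 1)) \<in> set (grow (k + 1) X (D - g) (t + h) g h)"
    by (rule Suc.hyps(1)) (use i Suc.prems in \<open>auto simp: algebra_simps\<close>)
  then show ?case using D assms(1) by (subst grow.simps) (simp add: algebra_simps)
qed

lemma set_grows: "set (grows st g h) = (\<Union>(X, D, t)\<in>set st. set (grow 0 X D t g h))"
  by (induction st g h rule: grows.induct) auto

lemma set_zeros: "set (zeros st) = (\<lambda>(X, D, t). (0 # X, D, t)) ` set st"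
  by (induction st rule: zeros.induct) auto

lemma degL_nonneg: "\<forall>p\<in>set c. 0 < fst p \<Longrightarrow> \<forall>a\<in>set Y. 0 \<le> a \<Longrightarrow> 0 \<le> degL c Y"
  by (induction c Y rule: degL.induct) auto

lemma sols_mem:
  "\<forall>p\<in>set c. 0 < fst p \<Longrightarrow> list_all2 (\<lambda>a b. 0 \<le> a \<and> (b = 0 \<longrightarrow> a = 0)) Y x \<Longrightarrow> length x = length c \<Longrightarrow>
    (P, D, t) \<in> set st \<Longrightarrow> degL c Y \<le> D \<Longrightarrow> (rev Y @ P, D - degL c Y, t + valL c Y) \<in> set (sols c x st)"
proof (induction c x st arbitrary: Y P D t rule: sols.induct)
  case (1 g h cs x xs st)
  obtain k Y' where Y: "Y = k # Y'" "0 \<le> k" "x = 0 \<longrightarrow> k = 0"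
    and Y': "list_all2 (\<lambda>a b. 0 \<le> a \<and> (b = 0 \<longrightarrow> a = 0)) Y' xs"
    using 1(3) by (auto simp: list_all2_Cons2)
  have "\<forall>a\<in>set Y'. 0 \<le> a" using Y' by (auto simp: list_all2_conv_all_nth in_set_conv_nth)
  then have nn: "0 \<le> degL cs Y'" using 1(2) by (intro degL_nonneg) auto
  have D: "g * k + degL cs Y' \<le> D" using 1(6) by (simp add: Y)
  have "(k # P, D - g * k, t + h * k) \<in> set (if x = 0 then zeros st else grows st g h)"
  proof (cases "x = 0")
    case True
    then show ?thesis using 1(5) Y by (force simp: set_zeros)
  next
    case False
    have "((0 + k) # P, D - g * k, t + h * k) \<in> set (grow 0 P D t g h)"
      by (rule grow_mem) (use 1(2) Y D nn in auto)
    then show ?thesis using False 1(5) by (auto simp: set_grows)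
  qed
  then have "(rev Y' @ k # P, D - g * k - degL cs Y', t + h * k + valL cs Y') \<in> set (sols cs xs (if x = 0 then zeros st else grows st g h))"
    by (intro 1(1)) (use 1(2,4) Y' D in auto)
  then show ?case by (simp add: Y algebra_simps)
qed (auto simp: list_all2_Cons2)

lemma pick_mem: "(X, 0, t) \<in> set r \<Longrightarrow> (rev X, t) \<in> set (pick r)"
  by (induction r rule: pick.induct) auto

lemma opts_mem:
  assumes c: "\<forall>p\<in>set c. 0 < fst p" "length x = length c" and y: "ladm y x" "degL c y = 0"
  shows "(add1 y (negp x), valL c y) \<in> set (opts c x)"
proof -
  let ?Y = "add1 y (negp x)"
  have len: "length y = length x" using y(1) by (auto simp: ladm_def dest: list_all2_lengthD)
  have "list_all2 (\<lambda>a b. 0 \<le> a \<and> (b = 0 \<longrightarrow> a = 0)) ?Y x"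
    using y(1) unfolding ladm_def by (induction rule: list_all2_induct) auto
  moreover have "degL c ?Y = dneg c x"
    using degL_add1[of y "negp x" c] len y(2) by (simp add: length_negp dneg_eq)
  ultimately have "(rev ?Y @ [], dneg c x - degL c ?Y, - vneg c x + valL c ?Y) \<in> set (sols c x [([], dneg c x, - vneg c x)])"
    using c by (intro sols_mem) auto
  moreover have "- vneg c x + valL c ?Y = valL c y"
    using valL_add1[of y "negp x" c] len by (simp add: length_negp vneg_eq)
  ultimately have "(rev ?Y, 0, valL c y) \<in> set (sols c x [([], dneg c x, - vneg c x)])"
    using \<open>degL c ?Y = dneg c x\<close> by simp
  from pick_mem[OF this] show ?thesis by (simp add: opts_def)
qed

lemma small_lconf:
  assumes "ladm y x" shows "small (add1 y (negp x)) x \<longleftrightarrow> lconf y x"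
  using assms unfolding ladm_def by (induction rule: list_all2_induct) (auto simp: conf1_def)

lemma ext1_mem: "(Y, s) \<in> set r \<Longrightarrow> - (t + s) \<in> set zt \<Longrightarrow> \<not> (c \<and> small Y x1) \<Longrightarrow> X @ Y \<in> set (ext1 X t c x1 zt r)"
proof (induction r)
  case (Cons p r)
  obtain Y' s' where "p = (Y', s')" by (cases p)
  then show ?case using Cons by (cases "(Y, s) = p") auto
qed simp

lemma ext2_mem:
  "(X, t) \<in> set r \<Longrightarrow> (Y, s) \<in> set O1 \<Longrightarrow> - (t + s) \<in> set zt \<Longrightarrow> \<not> (small X x0 \<and> small Y x1) \<Longrightarrow>
    X @ Y \<in> set (ext2 x0 x1 zt r O1)"
  by (induction x0 x1 zt r O1 rule: ext2.induct) (auto intro: ext1_mem)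

lemma leaf1_sound:
  assumes leaf: "leaf1 [c0, c1, cz] [x0, x1, z]"
    and c: "\<forall>p\<in>set c0. 0 < fst p" "\<forall>p\<in>set c1. 0 < fst p" "\<forall>p\<in>set cz. fst p = 0"
    and len: "length x0 = length c0" "length x1 = length c1" "length z = length cz"
  shows "separable c0 c1 cz x0 x1 z"
proof -
  let ?zt = "0 # tvals (bal0 (subs cz z))"
  let ?E = "ext2 x0 x1 ?zt (opts c0 x0) (opts c1 x1)"
  obtain w where w: "dot w (x0 @ x1) = 0" "\<forall>X\<in>set ?E. dot w (negp (x0 @ x1)) < dot w X"
    using sep_sound leaf by fastforce
  show ?thesis unfolding separable_def
  proof (intro exI[of _ w] conjI allI impI)
    fix y0 y1 z'
    assume y: "ladm y0 x0" "ladm y1 x1" "lconf z' z" "degL c0 y0 = 0" "degL c1 y1 = 0"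
      "valL c0 y0 + valL c1 y1 + valL cz z' = 0" "\<not> (lconf y0 x0 \<and> lconf y1 x1)"
    have "degL cz z' = 0" using c(3) by (induction cz z' rule: degL.induct) auto
    then have "(sizes z', valL cz z') \<in> set (bal0 (subs cz z))"
      using set_subs[OF len(3)] y(3) by (auto simp: set_bal0)
    \<comment> \<open>\<open>tvals\<close> omits vectors of norm 0, which is why
      \<open>leaf1\<close> puts the value 0 in front.\<close>
    moreover have "valL cz z' = 0" if "sizes z' = 0"
    proof -
      have "\<forall>a\<in>set z'. a = 0" using that sizes_0 by blast
      then show ?thesis by (induction cz z' rule: valL.induct) auto
    qed
    ultimately have "valL cz z' \<in> set ?zt" by (auto simp: set_tvals)
    moreover have "- (valL c0 y0 + valL c1 y1) = valL cz z'" using y(6) by linarith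
    ultimately have zt: "- (valL c0 y0 + valL c1 y1) \<in> set ?zt" by simp
    have "add1 y0 (negp x0) @ add1 y1 (negp x1) \<in> set ?E"
      by (rule ext2_mem[OF opts_mem opts_mem zt]) (use c len y small_lconf[OF y(1)] small_lconf[OF y(2)] in auto)
    moreover have l: "length y0 = length x0" "length y1 = length x1"
      using y(1,2) by (auto simp: ladm_def dest: list_all2_lengthD)
    then have "add1 y0 (negp x0) @ add1 y1 (negp x1) = add1 (y0 @ y1) (negp (x0 @ x1))"
      by (simp add: negp_append add1_append length_negp)
    ultimately have "dot w (negp (x0 @ x1)) < dot w (add1 (y0 @ y1) (negp (x0 @ x1)))" using w(2) by metis
    then show "0 < dot w (y0 @ y1)" using l by (subst (asm) dot_add1) (auto simp: length_negp)
  qed (rule w)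
qed

theorem leaf_sound:
  assumes leaf: "leaf [c0, c1, cz] [x0, x1, z]" and prim: "prim2 [c0, c1, cz] [x0, x1, z]"
    and c: "\<forall>p\<in>set c0. 0 < fst p" "\<forall>p\<in>set c1. 0 < fst p" "\<forall>p\<in>set cz. fst p = 0"
  shows "good x0 \<and> good x1 \<or> (good x0 \<or> good x1 \<or> lone z) \<and> separable c0 c1 cz x0 x1 z"
proof -
  let ?cs = "[c0, c1, cz]" and ?u = "[x0, x1, z]"
  have sh: "shaped ?cs ?u" using prim by (auto simp: prim2_def intro: bal2_shaped)
  then have len: "length x0 = length c0" "length x1 = length c1" "length z = length cz"
    by (auto simp: shaped_def)
  have "\<not> nonprim (size2 ?u) (vals ?cs ?u)"
  proof
    assume "nonprim (size2 ?u) (vals ?cs ?u)"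
    then obtain s where "(s, 0) \<in> set (vals ?cs ?u)" "0 < s" "s < size2 ?u" unfolding nonprim_iff by blast
    then obtain v where v: "s = size2 v" "val2 ?cs v = 0" "conf2 v ?u" "bal2 ?cs v"
      unfolding set_vals[OF sh] by auto
    then have "null2 v \<or> v = ?u" using prim unfolding prim2_def by blast
    then show False using v(1) \<open>0 < s\<close> \<open>s < _\<close> size2_0[of v] by auto
  qed
  then show ?thesis using leaf leaf1_sound[OF _ c len] by (auto simp del: leaf1.simps split: if_splits)
qed

section \<open>Complete lists of units for single blocks\<close>

definition block_ok :: "cols \<Rightarrow> (int list \<times> int) list \<Rightarrow> bool" where
  "block_ok c Q \<longleftrightarrow> (\<forall>u\<in>set Q. length (fst u) = length c \<and> degL c (fst u) = 0 \<and> snd u = valL c (fst u) \<and>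
       (\<exists>a\<in>set (fst u). a \<noteq> 0)) \<and>
     (\<forall>r. length r = length c \<longrightarrow> degL c r = 0 \<longrightarrow> (\<exists>a\<in>set r. a \<noteq> 0) \<longrightarrow> (\<exists>u\<in>set Q. lconf (fst u) r))"

lemma lconf_zero: "n = length r \<Longrightarrow> lconf (replicate n 0) r"
  by (auto simp: list_all2_conv_all_nth conf1_def)

lemma degL_zero: "\<forall>a\<in>set x. a = 0 \<Longrightarrow> degL c x = 0"
  by (induction c x rule: degL.induct) auto

lemma valL_zero: "\<forall>a\<in>set x. a = 0 \<Longrightarrow> valL c x = 0"
  by (induction c x rule: valL.induct) auto

lemma set_units3: "set (units3 n0 n1 m U0 U1 Uz) =
   (\<lambda>u. ([fst u, replicate n1 0, replicate m 0], snd u)) ` set U0 \<union>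
   (\<lambda>u. ([replicate n0 0, fst u, replicate m 0], snd u)) ` set U1 \<union>
   (\<lambda>u. ([replicate n0 0, replicate n1 0, fst u], snd u)) ` set Uz"
  by (simp add: units3_def case_prod_beta Un_assoc)

lemma units3_ok:
  assumes "block_ok c0 U0" "block_ok c1 U1" "block_ok cz Uz"
    and n: "n0 = length c0" "n1 = length c1" "m = length cz"
  shows "units_ok [c0, c1, cz] (units3 n0 n1 m U0 U1 Uz)"
  unfolding units_ok_def
proof (intro conjI ballI allI impI)
  fix u assume "u \<in> set (units3 n0 n1 m U0 U1 Uz)"
  then consider w where "w \<in> set U0" "u = ([fst w, replicate n1 0, replicate m 0], snd w)"
    | w where "w \<in> set U1" "u = ([replicate n0 0, fst w, replicate m 0], snd w)"
    | w where "w \<in> set Uz" "u = ([replicate n0 0, replicate n1 0, fst w], snd w)"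
    unfolding set_units3 by blast
  then have "bal2 [c0, c1, cz] (fst u) \<and> snd u = val2 [c0, c1, cz] (fst u) \<and> \<not> null2 (fst u)"
  proof cases
    case 1
    then show ?thesis using assms(1) n by (simp add: block_ok_def bal2_def degL_zero valL_zero null2_def)
  next
    case 2
    then show ?thesis using assms(2) n by (simp add: block_ok_def bal2_def degL_zero valL_zero null2_def)
  next
    case 3
    then show ?thesis using assms(3) n by (simp add: block_ok_def bal2_def degL_zero valL_zero null2_def)
  qed
  then show "bal2 [c0, c1, cz] (fst u)" "snd u = val2 [c0, c1, cz] (fst u)" "\<not> null2 (fst u)" by blast+
next
  fix r assume r: "bal2 [c0, c1, cz] r" "\<not> null2 r"
  then obtain r0 r1 z where rr: "r = [r0, r1, z]" "length r0 = length c0" "length r1 = length c1" "length z = length cz"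
    "degL c0 r0 = 0" "degL c1 r1 = 0" "degL cz z = 0"
    by (auto simp: bal2_def list_all2_Cons1)
  consider "\<exists>a\<in>set r0. a \<noteq> 0" | "\<exists>a\<in>set r1. a \<noteq> 0" | "\<exists>a\<in>set z. a \<noteq> 0"
    using r(2) unfolding rr(1) null2_def by auto
  then show "\<exists>u\<in>set (units3 n0 n1 m U0 U1 Uz). conf2 (fst u) r"
  proof cases
    case 1
    then obtain u where "u \<in> set U0" "lconf (fst u) r0" using assms(1) rr unfolding block_ok_def by blast
    then show ?thesis using rr n unfolding set_units3
      by (intro bexI[of _ "([fst u, replicate n1 0, replicate m 0], snd u)"]) (auto simp: lconf_zero)
  next
    case 2
    then obtain u where "u \<in> set U1" "lconf (fst u) r1" using assms(2) rr unfolding block_ok_def by blast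
    then show ?thesis using rr n unfolding set_units3
      by (intro bexI[of _ "([replicate n0 0, fst u, replicate m 0], snd u)"]) (auto simp: lconf_zero)
  next
    case 3
    then obtain u where "u \<in> set Uz" "lconf (fst u) z" using assms(3) rr unfolding block_ok_def by blast
    then show ?thesis using rr n unfolding set_units3
      by (intro bexI[of _ "([replicate n0 0, replicate n1 0, fst u], snd u)"]) (auto simp: lconf_zero)
  qed
qed

lemma degL_sum: "length c = length x \<Longrightarrow> degL c x = (\<Sum>k<length x. fst (c ! k) * x ! k)"
proof (induction c x rule: list_induct2)
  case (Cons p c a x)
  obtain g h where "p = (g, h)" by (cases p)
  then show ?case using Cons by (simp add: sum.lessThan_Suc_shift del: sum.lessThan_Suc)
qed simp

lemma valL_sum: "length c = length x \<Longrightarrow> valL c x = (\<Sum>k<length x. snd (c ! k) * x ! k)"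
proof (induction c x rule: list_induct2)
  case (Cons p c a x)
  obtain g h where "p = (g, h)" by (cases p)
  then show ?case using Cons by (simp add: sum.lessThan_Suc_shift del: sum.lessThan_Suc)
qed simp

lemma set_sunits: "set (sunits n) = {(map (\<lambda>k. if k = i then 1 else if k = j then - 1 else 0) [0..<n], int i - int j) |
    i j. i < n \<and> j < n \<and> i \<noteq> j}"
  by (fastforce simp: sunits_def)

text \<open>A nonzero vector with sum 0 has a positive and a negative entry, and the corresponding
  difference of unit vectors is conformal to it.\<close>

lemma scols_block: "block_ok (scols n) (sunits n)"
  unfolding block_ok_def
proof (intro conjI ballI allI impI)
  fix u assume "u \<in> set (sunits n)"
  then obtain i j where ij: "i < n" "j < n" "i \<noteq> j" "snd u = int i - int j"
    "fst u = map (\<lambda>k. if k = i then 1 else if k = j then - 1 else 0) [0..<n]" (is "_ = map ?f _")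
    by (auto simp: sunits_def)
  have f: "?f k = (if k = i then 1 else 0) - (if k = j then 1 else 0)" for k using ij(3) by auto
  show "length (fst u) = length (scols n)" by (simp add: ij scols_def)
  have "degL (scols n) (fst u) = (\<Sum>k<n. ?f k)"
    by (subst degL_sum) (auto simp: ij(5) scols_def intro!: sum.cong simp del: upt_Suc)
  also have "\<dots> = 0" unfolding f using ij(1,2) by (simp add: sum_subtractf)
  finally show "degL (scols n) (fst u) = 0" .
  have "valL (scols n) (fst u) = (\<Sum>k<n. int (Suc k) * ?f k)"
    by (subst valL_sum) (auto simp: ij(5) scols_def intro!: sum.cong simp del: upt_Suc)
  also have "\<dots> = (\<Sum>k<n. (if k = i then int (Suc k) else 0) - (if k = j then int (Suc k) else 0))"
    unfolding f by (intro sum.cong) auto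
  also have "\<dots> = int i - int j" using ij(1,2) by (simp add: sum_subtractf)
  finally show "snd u = valL (scols n) (fst u)" using ij(4) by simp
  show "\<exists>a\<in>set (fst u). a \<noteq> 0" using ij(1) by (auto simp: ij(5) intro!: bexI[of _ i])
next
  fix r assume r: "length r = length (scols n)" "degL (scols n) r = 0" "\<exists>a\<in>set r. a \<noteq> 0"
  have len: "length r = n" using r(1) by (simp add: scols_def)
  have s: "(\<Sum>k<n. r ! k) = 0"
    using r(2) by (subst (asm) degL_sum) (auto simp: len scols_def simp del: upt_Suc)
  obtain k where k: "k < n" "r ! k \<noteq> 0" using r(3) len by (auto simp: in_set_conv_nth)
  have "\<exists>i<n. 0 < r ! i"
  proof (rule ccontr)
    assume "\<not> ?thesis"
    then have "\<forall>i\<in>{..<n}. 0 \<le> - (r ! i)" using not_less by force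
    moreover have "(\<Sum>k<n. - (r ! k)) = 0" using s by (simp add: sum_negf)
    ultimately have "- (r ! k) = 0" using k(1) sum_nonneg_eq_0_iff[of "{..<n}" "\<lambda>k. - (r ! k)"] by simp
    then show False using k(2) by simp
  qed
  moreover have "\<exists>i<n. r ! i < 0"
  proof (rule ccontr)
    assume "\<not> ?thesis"
    then have "\<forall>i\<in>{..<n}. 0 \<le> r ! i" using not_less by force
    then have "r ! k = 0" using s k(1) sum_nonneg_eq_0_iff[of "{..<n}" "\<lambda>k. r ! k"] by simp
    then show False using k(2) by simp
  qed
  ultimately obtain i j where ij: "i < n" "0 < r ! i" "j < n" "r ! j < 0" by blast
  let ?u = "(map (\<lambda>k. if k = i then 1 else if k = j then - 1 else 0) [0..<n], int i - int j)"
  have "i \<noteq> j" using ij by auto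
  then have "?u \<in> set (sunits n)" using ij unfolding set_sunits by blast
  moreover have "lconf (fst ?u) r" using ij len by (auto simp: list_all2_conv_all_nth conf1_def)
  ultimately show "\<exists>u\<in>set (sunits n). lconf (fst u) r" by blast
qed

lemma zcols_block: "block_ok (zcols n) (zunits n)"
  unfolding block_ok_def
proof (intro conjI ballI allI impI)
  fix u assume "u \<in> set (zunits n)"
  then have "\<exists>i e. i < n \<and> (e = 1 \<or> e = - 1) \<and> snd u = e * (int i + 1) \<and>
    fst u = map (\<lambda>k. if k = i then e else 0) [0..<n]"
  proof -
    assume "u \<in> set (zunits n)"
    then consider i where "i < n" "u = (map (\<lambda>k. if k = i then 1 else 0) [0..<n], int i + 1)"
      | i where "i < n" "u = (map (\<lambda>k. if k = i then - 1 else 0) [0..<n], - int i - 1)"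
      by (auto simp: zunits_def)
    then show ?thesis
    proof cases
      case (1 i)
      then show ?thesis by (intro exI[of _ i] exI[of _ 1]) simp
    next
      case (2 i)
      then show ?thesis by (intro exI[of _ i] exI[of _ "- 1"]) simp
    qed
  qed
  then obtain i e where ij: "i < n" "e = 1 \<or> e = -1" "snd u = e * (int i + 1)"
    "fst u = map (\<lambda>k. if k = i then e else 0) [0..<n]" (is "_ = map ?f _")
    by blast
  show "length (fst u) = length (zcols n)" by (simp add: ij zcols_def)
  show "degL (zcols n) (fst u) = 0"
    by (subst degL_sum) (auto simp: ij(4) zcols_def simp del: upt_Suc)
  have "valL (zcols n) (fst u) = (\<Sum>k<n. int (Suc k) * ?f k)"
    by (subst valL_sum) (auto simp: ij(4) zcols_def intro!: sum.cong simp del: upt_Suc)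
  also have "\<dots> = (\<Sum>k<n. (if k = i then int (Suc k) * e else 0))"
    by (intro sum.cong) auto
  finally show "snd u = valL (zcols n) (fst u)" using ij(1,3) by (simp add: mult.commute)
  show "\<exists>a\<in>set (fst u). a \<noteq> 0" using ij(1,2) by (auto simp: ij(4) intro!: bexI[of _ i])
next
  fix r :: "int list" assume r: "length r = length (zcols n)" "\<exists>a\<in>set r. a \<noteq> 0"
  have len: "length r = n" using r(1) by (simp add: zcols_def)
  obtain i where i: "i < n" "r ! i \<noteq> 0" using r(2) len by (auto simp: in_set_conv_nth)
  show "\<exists>u\<in>set (zunits n). lconf (fst u) r"
  proof (cases "0 < r ! i")
    case True
    have "(map (\<lambda>k. if k = i then 1 else 0) [0..<n], int i + 1) \<in> set (zunits n)" using i by (auto simp: zunits_def)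
    then show ?thesis by (rule bexI[rotated]) (use i len True in \<open>auto simp: list_all2_conv_all_nth conf1_def\<close>)
  next
    case False
    have "(map (\<lambda>k. if k = i then - 1 else 0) [0..<n], - int i - 1) \<in> set (zunits n)" using i by (auto simp: zunits_def)
    then show ?thesis by (rule bexI[rotated]) (use i len False in \<open>auto simp: list_all2_conv_all_nth conf1_def\<close>)
  qed
qed

lemma hcols_block: "block_ok (hcols 3) hunits"
  unfolding block_ok_def
proof (intro conjI allI impI)
  show "\<forall>u\<in>set hunits. length (fst u) = length (hcols 3) \<and> degL (hcols 3) (fst u) = 0 \<and>
      snd u = valL (hcols 3) (fst u) \<and> (\<exists>a\<in>set (fst u). a \<noteq> 0)"
    by (simp add: hunits_def hcols_def numeral_3_eq_3 upt_rec)
  fix r :: "int list"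
  assume r: "length r = length (hcols 3)" "degL (hcols 3) r = 0" "\<exists>a\<in>set r. a \<noteq> 0"
  then obtain a b c where abc: "r = [a, b, c]" by (auto simp: hcols_def numeral_3_eq_3 length_Suc_conv)
  have e: "a + 2 * b + 3 * c = 0" "a \<noteq> 0 \<or> b \<noteq> 0 \<or> c \<noteq> 0"
    using r by (auto simp: abc hcols_def numeral_3_eq_3 upt_rec)
  \<comment> \<open>That one of the ten listed vectors lies conformally below every nonzero solution
    is a statement of Presburger arithmetic in three variables.\<close>
  then show "\<exists>u\<in>set hunits. lconf (fst u) r"
    unfolding abc hunits_def conf1_def by simp presburger
qed

theorem scheck_sound:
  assumes "scheck n0 n1 m" "prim2 [scols n0, scols n1, zcols m] [x0, x1, z]"
  shows "good x0 \<and> good x1 \<or> (good x0 \<or> good x1 \<or> lone z) \<and> separable (scols n0) (scols n1) (zcols m) x0 x1 z"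
proof (rule leaf_sound[OF check_sound[OF _ units3_ok] assms(2)])
  show "check [scols n0, scols n1, zcols m] (units3 n0 n1 m (sunits n0) (sunits n1) (zunits m))"
    using assms(1) unfolding scheck_def .
qed (auto simp: scols_block zcols_block assms(2), auto simp: scols_def zcols_def)

theorem hcheck_sound:
  assumes "hcheck" "prim2 [hcols 3, hcols 3, zcols 2] [x0, x1, z]"
  shows "good x0 \<and> good x1 \<or> (good x0 \<or> good x1 \<or> lone z) \<and> separable (hcols 3) (hcols 3) (zcols 2) x0 x1 z"
proof (rule leaf_sound[OF check_sound[OF _ units3_ok] assms(2)])
  show "check [hcols 3, hcols 3, zcols 2] (units3 3 3 2 hunits hunits (zunits 2))"
    using assms(1) unfolding hcheck_def .
qed (auto simp: hcols_block zcols_block assms(2), auto simp: hcols_def zcols_def)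

section \<open>Reduction to two blocks\<close>

declare split_paired_All [simp del] split_paired_Ex [simp del]

definition conff :: "('a \<Rightarrow> int) \<Rightarrow> ('a \<Rightarrow> int) \<Rightarrow> bool" where
  "conff v u \<longleftrightarrow> (\<forall>p. conf1 (v p) (u p))"

definition admf :: "('a \<Rightarrow> int) \<Rightarrow> ('a \<Rightarrow> int) \<Rightarrow> bool" where
  "admf x u \<longleftrightarrow> (\<forall>p. (u p = 0 \<longrightarrow> x p = 0) \<and> (0 < u p \<longrightarrow> 0 \<le> x p) \<and> (u p < 0 \<longrightarrow> u p \<le> x p))"

abbreviation zerof :: "'a \<Rightarrow> int" where "zerof \<equiv> \<lambda>_. 0"

lemma conff_trans: "conff a b \<Longrightarrow> conff b c \<Longrightarrow> conff a c"
  unfolding conff_def conf1_def by (metis order_trans)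

lemma conff_refl: "conff a a"
  unfolding conff_def conf1_def by auto

definition sumf :: "('a \<Rightarrow> int) list \<Rightarrow> 'a \<Rightarrow> int" where
  "sumf Ys p = (\<Sum>y\<leftarrow>Ys. y p)"

lemma sumf_simps [simp]: "sumf [] p = 0" "sumf (y # Ys) p = y p + sumf Ys p" "sumf (Ys @ Zs) p = sumf Ys p + sumf Zs p"
  by (simp_all add: sumf_def)

lemma sumf_mset: "mset Ys = mset Zs \<Longrightarrow> sumf Ys = sumf Zs"
  unfolding sumf_def by (rule ext) (metis mset_map sum_mset_sum_list)

lemma sumf_sign: "(\<And>y. y \<in> set Ys \<Longrightarrow> conf1 (y p) c) \<Longrightarrow> (0 \<le> c \<longrightarrow> 0 \<le> sumf Ys p) \<and> (c \<le> 0 \<longrightarrow> sumf Ys p \<le> 0)"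
  by (induction Ys) (fastforce simp: conf1_def)+

text \<open>A cell \<open>(j, i)\<close> stands for the column at position \<open>i\<close> of block
  \<open>j\<close>. Its entry is \<open>g i\<close> in the row of its block and \<open>h i\<close>
  in the row common to all blocks.\<close>

locale blocks =
  fixes C :: "(nat \<times> nat) set" and g h :: "nat \<Rightarrow> int"
  assumes fin: "finite C" and gpos: "p \<in> C \<Longrightarrow> 0 < g (snd p)"
begin

definition blk where "blk j = {p \<in> C. fst p = j}"

definition bal where
  "bal u \<longleftrightarrow> (\<forall>p. p \<notin> C \<longrightarrow> u p = 0) \<and> (\<forall>j. (\<Sum>p\<in>blk j. g (snd p) * u p) = 0)"

definition val where "val u = (\<Sum>p\<in>C. h (snd p) * u p)"

definition primb where
  "primb u \<longleftrightarrow> bal u \<and> val u = 0 \<and> u \<noteq> zerof \<and> (\<forall>v. bal v \<longrightarrow> val v = 0 \<longrightarrow> conff v u \<longrightarrow> v = zerof \<or> v = u)"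

text \<open>For primitive \<open>u\<close> this is the hypothesis of \<open>edge_in_ugb\<close>:
  \<open>x\<close> is the difference of a fiber point and \<open>u^-\<close>, and a conformal
  \<open>x\<close> of value 0 can only be 0 or \<open>u\<close>.\<close>

definition edgeb where
  "edgeb u \<longleftrightarrow> (\<exists>\<omega>. (\<Sum>p\<in>C. \<omega> p * u p) = 0 \<and>
     (\<forall>x. bal x \<longrightarrow> val x = 0 \<longrightarrow> admf x u \<longrightarrow> \<not> conff x u \<longrightarrow> 0 < (\<Sum>p\<in>C. \<omega> p * x p)))"

definition supp where "supp u j = {p \<in> blk j. u p \<noteq> 0}"
definition goodf where "goodf u j \<longleftrightarrow> card (supp u j) \<le> 2"

text \<open>The Graver basis of the block rows alone, without the common row.\<close>

definition minb where
  "minb y \<longleftrightarrow> bal y \<and> y \<noteq> zerof \<and> (\<forall>y'. bal y' \<longrightarrow> conff y' y \<longrightarrow> y' = zerof \<or> y' = y)"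

definition res where "res J u = (\<lambda>p. if fst p \<in> J then u p else 0 :: int)"

lemma fin_blk: "finite (blk j)" using fin by (simp add: blk_def)

lemma bal_out: "bal u \<Longrightarrow> p \<notin> C \<Longrightarrow> u p = 0" by (simp add: bal_def)

lemma bal_res: "bal u \<Longrightarrow> bal (res J u)"
proof -
  assume u: "bal u"
  have "(\<Sum>p\<in>blk j. g (snd p) * res J u p) = (if j \<in> J then \<Sum>p\<in>blk j. g (snd p) * u p else 0)" for j
    by (auto simp: res_def blk_def intro!: sum.cong sum.neutral)
  then show ?thesis using u by (auto simp: bal_def res_def)
qed

lemma conff_res: "conff (res J u) u"
  by (auto simp: conff_def res_def conf1_def)

lemma val_add: "val (\<lambda>p. u p + v p) = val u + val v"
  by (simp add: val_def distrib_left sum.distrib)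

lemma bal_add: "bal u \<Longrightarrow> bal v \<Longrightarrow> bal (\<lambda>p. u p + v p)"
  by (simp add: bal_def distrib_left sum.distrib)

lemma bal_diff: "bal u \<Longrightarrow> bal v \<Longrightarrow> bal (\<lambda>p. u p - v p)"
  by (simp add: bal_def right_diff_distrib sum_subtractf)

lemma bal_zero: "bal zerof" by (simp add: bal_def)
lemma val_zero: "val zerof = 0" by (simp add: val_def)

lemma sumf_Cons: "sumf (y # Ys) = (\<lambda>p. y p + sumf Ys p)" by (rule ext) simp
lemma sumf_Nil: "sumf [] = zerof" by (rule ext) simp

lemma bal_sumf: "(\<And>y. y \<in> set Ys \<Longrightarrow> bal y) \<Longrightarrow> bal (sumf Ys)"
  by (induction Ys) (auto simp: sumf_Cons sumf_Nil bal_zero bal_add)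

lemma val_sumf: "val (sumf Ys) = (\<Sum>y\<leftarrow>Ys. val y)"
  by (induction Ys) (auto simp: sumf_Cons sumf_Nil val_zero val_add)

section \<open>Decomposition into minimal balanced vectors\<close>

definition norm1 where "norm1 u = (\<Sum>p\<in>C. \<bar>u p\<bar>)"

lemma norm1_pos: "bal u \<Longrightarrow> u \<noteq> zerof \<Longrightarrow> 0 < norm1 u"
proof -
  assume u: "bal u" "u \<noteq> zerof"
  then obtain p where "p \<in> C" "u p \<noteq> 0" using bal_out by fastforce
  then show ?thesis unfolding norm1_def using fin by (intro sum_pos2[of _ p]) auto
qed

lemma norm1_diff: "conff y x \<Longrightarrow> norm1 (\<lambda>p. x p - y p) = norm1 x - norm1 y"
  unfolding norm1_def sum_subtractf[symmetric] conff_def conf1_def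
  by (intro sum.cong refl) (smt (verit))

lemma conff_diff: "conff y x \<Longrightarrow> conff (\<lambda>p. x p - y p) x"
  unfolding conff_def conf1_def by (smt (verit))

lemma ex_min: "bal x \<Longrightarrow> x \<noteq> zerof \<Longrightarrow> \<exists>y. minb y \<and> conff y x"
proof (induction "nat (norm1 x)" arbitrary: x rule: less_induct)
  case less
  show ?case
  proof (cases "minb x")
    case True
    then show ?thesis using conff_refl by blast
  next
    case False
    then obtain y where y: "bal y" "conff y x" "y \<noteq> zerof" "y \<noteq> x" using less.prems unfolding minb_def by blast
    have "(\<lambda>p. x p - y p) \<noteq> zerof"
    proof
      assume "(\<lambda>p. x p - y p) = zerof"
      then have "x p - y p = 0" for p by (rule fun_cong)
      then show False using y(4) by auto
    qed
    then have "0 < norm1 (\<lambda>p. x p - y p)" using norm1_pos bal_diff less.prems(1) y(1) by blast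
    then have "nat (norm1 y) < nat (norm1 x)" using norm1_diff[OF y(2)] norm1_pos[OF y(1,3)] by linarith
    then obtain z where "minb z" "conff z y" using less.hyps y(1,3) by blast
    then show ?thesis using y(2) conff_trans by blast
  qed
qed

lemma ex_decomp: "bal x \<Longrightarrow> \<exists>Ys. (\<forall>y\<in>set Ys. minb y \<and> conff y x) \<and> sumf Ys = x"
proof (induction "nat (norm1 x)" arbitrary: x rule: less_induct)
  case less
  show ?case
  proof (cases "x = zerof")
    case True
    then show ?thesis by (intro exI[of _ "[]"]) (simp add: sumf_Nil)
  next
    case False
    then obtain y where y: "minb y" "conff y x" using ex_min less.prems by blast
    have yb: "bal y" "y \<noteq> zerof" using y(1) by (auto simp: minb_def)
    let ?d = "\<lambda>p. x p - y p"
    have "nat (norm1 ?d) < nat (norm1 x)"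
      using norm1_diff[OF y(2)] norm1_pos[OF yb] norm1_pos[OF less.prems False] by linarith
    then obtain Ys where Ys: "\<forall>y\<in>set Ys. minb y \<and> conff y ?d" "sumf Ys = ?d"
      using less.hyps bal_diff[OF less.prems yb(1)] by blast
    have "\<forall>z\<in>set (y # Ys). minb z \<and> conff z x"
      using Ys(1) y conff_diff[OF y(2)] conff_trans by auto
    moreover have "sumf (y # Ys) = x" unfolding sumf_Cons Ys(2) by auto
    ultimately show ?thesis by blast
  qed
qed

text \<open>The restriction of \<open>y\<close> to the block of \<open>p\<close> is balanced,
  conformal to \<open>y\<close> and nonzero, hence equal to \<open>y\<close>.\<close>

lemma minb_block:
  assumes "minb y" "y p \<noteq> 0"
  shows "y q \<noteq> 0 \<Longrightarrow> q \<in> blk (fst p)"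
proof -
  assume q: "y q \<noteq> 0"
  have yb: "bal y" using assms(1) by (simp add: minb_def)
  have "res {fst p} y p \<noteq> 0" using assms(2) by (simp add: res_def)
  then have "res {fst p} y \<noteq> zerof" by auto
  then have e: "res {fst p} y = y" using assms(1) bal_res[OF yb] conff_res unfolding minb_def by blast
  have "fst q = fst p"
  proof (rule ccontr)
    assume "fst q \<noteq> fst p"
    then have "res {fst p} y q = 0" by (simp add: res_def)
    then show False using q e by simp
  qed
  moreover have "q \<in> C" using q yb bal_out by blast
  ultimately show ?thesis by (simp add: blk_def)
qed

lemma bal_supp: "bal x \<Longrightarrow> (\<And>q. u q = 0 \<Longrightarrow> x q = 0) \<Longrightarrow> (\<Sum>q\<in>supp u j. g (snd q) * x q) = 0"
proof -
  assume x: "bal x" "\<And>q. u q = 0 \<Longrightarrow> x q = 0"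
  have "(\<Sum>q\<in>supp u j. g (snd q) * x q) = (\<Sum>q\<in>blk j. g (snd q) * x q)"
    by (rule sum.mono_neutral_left) (use x fin_blk in \<open>auto simp: supp_def\<close>)
  then show ?thesis using x(1) by (simp add: bal_def)
qed

text \<open>In a block where \<open>u\<close> has at most two nonzero entries the kernel is one-dimensional.\<close>

lemma good_pair:
  assumes u: "bal u" and good: "goodf u j" and p: "p \<in> supp u j"
  obtains q where "q \<in> supp u j" "q \<noteq> p" "supp u j = {p, q}"
    "\<And>x. bal x \<Longrightarrow> (\<And>q. u q = 0 \<Longrightarrow> x q = 0) \<Longrightarrow> g (snd p) * x p + g (snd q) * x q = 0"
proof -
  have fs: "finite (supp u j)" using fin_blk by (simp add: supp_def)
  have "0 < g (snd p)" "u p \<noteq> 0" using p gpos by (auto simp: supp_def blk_def)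
  have "supp u j \<noteq> {p}"
  proof
    assume "supp u j = {p}"
    then have "g (snd p) * u p = 0" using bal_supp[OF u, of u j] by simp
    then show False using \<open>0 < g (snd p)\<close> \<open>u p \<noteq> 0\<close> by simp
  qed
  then obtain q where q: "q \<in> supp u j" "q \<noteq> p" using p by blast
  have "{p, q} = supp u j"
    by (rule card_seteq[OF fs]) (use p q good in \<open>auto simp: goodf_def\<close>)
  then have S: "supp u j = {p, q}" by (rule sym)
  have "g (snd p) * x p + g (snd q) * x q = 0" if x: "bal x" "\<And>q. u q = 0 \<Longrightarrow> x q = 0" for x
    using bal_supp[of x u j, OF x] q(2) unfolding S by simp
  then show ?thesis using that[OF q S] by blast
qed

text \<open>In the two-element support \<open>x\<close> is proportional to \<open>u\<close>, so its
  lower bound at the negative entry of \<open>u\<close> becomes an upper bound at the positive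
  entry.\<close>

lemma good_conf:
  assumes u: "bal u" and x: "bal x" "admf x u" and good: "goodf u j" and p: "p \<in> blk j"
  shows "conf1 (x p) (u p)"
proof (cases "u p = 0")
  case True
  then show ?thesis using x(2) by (simp add: admf_def conf1_def)
next
  case False
  then have ps: "p \<in> supp u j" using p by (simp add: supp_def)
  obtain q where q: "q \<in> supp u j" "q \<noteq> p"
    "\<And>x. bal x \<Longrightarrow> (\<And>q. u q = 0 \<Longrightarrow> x q = 0) \<Longrightarrow> g (snd p) * x p + g (snd q) * x q = 0"
    using good_pair[OF u good ps] by metis
  have gp: "0 < g (snd p)" "0 < g (snd q)" using p q(1) gpos by (auto simp: supp_def blk_def)
  have eu: "g (snd p) * u p = - (g (snd q) * u q)" using q(3)[OF u] by simp
  have ex: "g (snd p) * x p = - (g (snd q) * x q)" using q(3)[OF x(1)] x(2) by (simp add: admf_def)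
  have a: "(0 < u p \<longrightarrow> 0 \<le> x p) \<and> (u p < 0 \<longrightarrow> u p \<le> x p)" "(0 < u q \<longrightarrow> 0 \<le> x q) \<and> (u q < 0 \<longrightarrow> u q \<le> x q)"
    using x(2) by (auto simp: admf_def)
  show ?thesis
  proof (cases "0 < u p")
    case True
    then have "0 < g (snd p) * u p" using gp by simp
    then have "g (snd q) * u q < 0" using eu by simp
    then have "u q < 0" using gp(2) by (simp add: mult_less_0_iff)
    then have "g (snd q) * u q \<le> g (snd q) * x q" using a(2) gp(2) by (intro mult_left_mono) auto
    then have "g (snd p) * x p \<le> g (snd p) * u p" using eu ex by simp
    then have "x p \<le> u p" using gp(1) by simp
    then show ?thesis using True a(1) by (simp add: conf1_def)
  next
    case False
    then have "u p < 0" using \<open>u p \<noteq> 0\<close> by simp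
    then have "g (snd p) * u p < 0" using gp by (simp add: mult_less_0_iff)
    then have "0 < g (snd q) * u q" using eu by simp
    then have "0 < u q" using gp(2) by (simp add: zero_less_mult_iff)
    then have "0 \<le> g (snd q) * x q" using a(2) gp(2) by simp
    then have "g (snd p) * x p \<le> 0" using ex by simp
    then have "x p \<le> 0" using gp(1) by (simp add: mult_le_0_iff)
    then show ?thesis using \<open>u p < 0\<close> a(1) by (simp add: conf1_def)
  qed
qed

lemma conff_zero: "conff y u \<Longrightarrow> u q = 0 \<Longrightarrow> y q = 0"
  by (metis conff_def conf1_def order_antisym)

text \<open>Both vectors are supported in the same two cells and proportional, so one of them is
  conformal to the other, and minimality makes them equal.\<close>

lemma minb_unique:
  assumes u: "bal u" and good: "goodf u (fst p)"
    and y: "minb y" "conff y u" "y p \<noteq> 0" and y': "minb y'" "conff y' u" "y' p \<noteq> 0"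
  shows "y = y'"
proof -
  have yb: "bal y" "bal y'" using y(1) y'(1) by (auto simp: minb_def)
  have ps: "p \<in> supp u (fst p)"
    using minb_block[OF y(1,3,3)] conff_zero[OF y(2), of p] y(3) by (auto simp: supp_def)
  obtain q where q: "q \<in> supp u (fst p)" "q \<noteq> p" "supp u (fst p) = {p, q}"
    "\<And>x. bal x \<Longrightarrow> (\<And>q. u q = 0 \<Longrightarrow> x q = 0) \<Longrightarrow> g (snd p) * x p + g (snd q) * x q = 0"
    using good_pair[OF u good ps] by metis
  have gp: "0 < g (snd p)" "0 < g (snd q)" using ps q(1) gpos by (auto simp: supp_def blk_def)
  have e: "g (snd p) * y p + g (snd q) * y q = 0" "g (snd p) * y' p + g (snd q) * y' q = 0"
    using q(4)[OF yb(1) conff_zero[OF y(2)]] q(4)[OF yb(2) conff_zero[OF y'(2)]] by blast+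
  have out: "a b = 0" if "minb a" "conff a u" "a p \<noteq> 0" "b \<noteq> p" "b \<noteq> q" for a b
  proof (rule ccontr)
    assume "a b \<noteq> 0"
    then have "b \<in> blk (fst p)" using minb_block[OF that(1,3)] by blast
    moreover have "u b \<noteq> 0" using conff_zero[OF that(2), of b] \<open>a b \<noteq> 0\<close> by blast
    ultimately have "b \<in> supp u (fst p)" by (simp add: supp_def)
    then show False using q(3) that by blast
  qed
  have key: "a = b" if a: "minb a" "conff a u" "a p \<noteq> 0" "g (snd p) * a p + g (snd q) * a q = 0"
    and b: "minb b" "conff b u" "b p \<noteq> 0" "g (snd p) * b p + g (snd q) * b q = 0" and le: "\<bar>a p\<bar> \<le> \<bar>b p\<bar>" for a b
  proof -
    have "g (snd q) * \<bar>a q\<bar> = g (snd p) * \<bar>a p\<bar>" "g (snd q) * \<bar>b q\<bar> = g (snd p) * \<bar>b p\<bar>"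
      using a(4) b(4) gp by (metis abs_minus_cancel abs_mult abs_of_pos add_eq_0_iff)+
    then have "g (snd q) * \<bar>a q\<bar> \<le> g (snd q) * \<bar>b q\<bar>" using le gp by simp
    then have leq: "\<bar>a q\<bar> \<le> \<bar>b q\<bar>" using gp by simp
    have "conf1 (a c) (b c)" for c
    proof -
      have "conf1 (a c) (u c)" "conf1 (b c) (u c)" using a(2) b(2) by (simp_all add: conff_def)
      moreover have "\<bar>a c\<bar> \<le> \<bar>b c\<bar>"
        using le leq out[OF a(1-3), of c] by (cases "c = p"; cases "c = q") auto
      ultimately show ?thesis by (auto simp: conf1_def)
    qed
    then have "conff a b" by (simp add: conff_def)
    then show ?thesis using a(1) b(1) unfolding minb_def by blast
  qed
  show ?thesis
  proof (cases "\<bar>y p\<bar> \<le> \<bar>y' p\<bar>")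
    case True
    show ?thesis by (rule key[OF y e(1) y' e(2) True])
  next
    case False
    then show ?thesis by (intro key[OF y' e(2) y e(1), symmetric]) simp
  qed
qed

lemma sumf_count: "(\<And>y'. y' \<in> set Ys \<Longrightarrow> y' p \<noteq> 0 \<Longrightarrow> y' = y) \<Longrightarrow> sumf Ys p = int (count (mset Ys) y) * y p"
proof (induction Ys)
  case (Cons a Ys)
  then have IH: "sumf Ys p = int (count (mset Ys) y) * y p" by simp
  have "a \<noteq> y \<Longrightarrow> a p = 0" using Cons.prems[of a] by auto
  then show ?case using IH by (cases "a = y") (simp_all add: algebra_simps)
qed simp

text \<open>By \<open>minb_unique\<close> the value of the sum at one cell of \<open>y\<close> tells
  how often \<open>y\<close> occurs.\<close>

lemma decomp_unique:
  assumes u: "bal u" and good: "\<And>j. goodf u j"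
    and Y: "\<And>y. y \<in> set Ys \<Longrightarrow> minb y \<and> conff y u" "sumf Ys = u"
    and Z: "\<And>y. y \<in> set Zs \<Longrightarrow> minb y \<and> conff y u" "sumf Zs = u"
  shows "mset Ys = mset Zs"
proof (rule multiset_eqI)
  fix y
  show "count (mset Ys) y = count (mset Zs) y"
  proof (cases "y \<in> set Ys \<union> set Zs")
    case True
    then have y: "minb y" "conff y u" using Y(1) Z(1) by blast+
    then obtain p where p: "y p \<noteq> 0" unfolding minb_def by fastforce
    have "sumf Ys p = int (count (mset Ys) y) * y p"
      by (rule sumf_count) (use minb_unique[OF u good _ _ _ y p] Y(1) in blast)
    moreover have "sumf Zs p = int (count (mset Zs) y) * y p"
      by (rule sumf_count) (use minb_unique[OF u good _ _ _ y p] Z(1) in blast)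
    ultimately show ?thesis using p Y(2) Z(2) by simp
  next
    case False
    then show ?thesis by (simp add: count_eq_zero_iff[THEN iffD2])
  qed
qed

end

text \<open>Values \<open>i\<close> and \<open>- i\<close> never occur together in an aligned list, so the signed count determines the list up to order.\<close>

definition zcount :: "int list \<Rightarrow> int \<Rightarrow> int" where
  "zcount vs i = (\<Sum>v\<leftarrow>vs. if v = i then 1 else if v = - i then - 1 else 0)"

definition aligned :: "int \<Rightarrow> int list \<Rightarrow> bool" where
  "aligned m vs \<longleftrightarrow> (\<forall>v\<in>set vs. v \<noteq> 0 \<and> \<bar>v\<bar> \<le> m) \<and> (\<forall>v\<in>set vs. \<forall>v'\<in>set vs. v' \<noteq> - v)"

lemma zcount_simps [simp]: "zcount [] i = 0"
  "zcount (v # vs) i = (if v = i then 1 else if v = - i then - 1 else 0) + zcount vs i"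
  by (simp_all add: zcount_def)

lemma zcount_sign: "(\<And>v. v \<in> set vs \<Longrightarrow> v \<noteq> - i) \<Longrightarrow> 0 \<le> zcount vs i"
  "(\<And>v. v \<in> set vs \<Longrightarrow> v \<noteq> i) \<Longrightarrow> zcount vs i \<le> 0"
  by (induction vs) auto

text \<open>Without opposite values nothing cancels, so the signed counts recover both the sum and
  the length of the list.\<close>

lemma zcount_sum:
  assumes "aligned (int m) vs"
  shows "(\<Sum>i\<in>{1..m}. int i * zcount vs (int i)) = sum_list vs"
    "(\<Sum>i\<in>{1..m}. \<bar>zcount vs (int i)\<bar>) = int (length vs)"
proof -
  have "(\<Sum>i\<in>{1..m}. int i * zcount vs (int i)) = sum_list vs \<and> (\<Sum>i\<in>{1..m}. \<bar>zcount vs (int i)\<bar>) = int (length vs)"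
    using assms
  proof (induction vs)
    case (Cons v vs)
    have al: "aligned (int m) vs" using Cons.prems by (auto simp: aligned_def)
    define k where "k = nat \<bar>v\<bar>"
    define s where "s = sgn v"
    have k: "k \<in> {1..m}" "v = s * int k" "s = 1 \<or> s = - 1"
      using Cons.prems by (auto simp: aligned_def k_def s_def sgn_if)
    have c: "zcount (v # vs) (int i) = zcount vs (int i) + (if i = k then s else 0)" if "i \<in> {1..m}" for i
      using k that by auto
    have sg: "\<bar>zcount vs (int k) + s\<bar> = \<bar>zcount vs (int k)\<bar> + 1"
    proof -
      have "u \<noteq> - v" if "u \<in> set vs" for u using Cons.prems that unfolding aligned_def by auto
      then show ?thesis using zcount_sign[of vs "int k"] k(2,3) by fastforce
    qed
    have "(\<Sum>i\<in>{1..m}. int i * zcount (v # vs) (int i)) = (\<Sum>i\<in>{1..m}. int i * zcount vs (int i) + (if i = k then int i * s else 0))"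
      by (rule sum.cong) (auto simp: c distrib_left simp del: zcount_simps)
    also have "\<dots> = sum_list vs + v" using Cons.IH[OF al] k by (simp add: sum.distrib mult.commute)
    finally have 1: "(\<Sum>i\<in>{1..m}. int i * zcount (v # vs) (int i)) = sum_list (v # vs)" by simp
    have "(\<Sum>i\<in>{1..m}. \<bar>zcount (v # vs) (int i)\<bar>) = (\<Sum>i\<in>{1..m}. \<bar>zcount vs (int i)\<bar> + (if i = k then 1 else 0))"
      by (rule sum.cong) (auto simp: c sg simp del: zcount_simps)
    also have "\<dots> = int (length vs) + 1" using Cons.IH[OF al] k by (simp add: sum.distrib)
    finally show ?case using 1 by simp
  qed simp
  then show "(\<Sum>i\<in>{1..m}. int i * zcount vs (int i)) = sum_list vs"
    "(\<Sum>i\<in>{1..m}. \<bar>zcount vs (int i)\<bar>) = int (length vs)" by blast+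
qed

text \<open>The head of the list is left out if \<open>w\<close> still fits the counts of the tail
  and is taken otherwise. So every vector conformal to the counts comes from a sublist.\<close>

lemma zcount_sub:
  assumes "aligned m (map f Ys)" "\<And>i. 1 \<le> i \<Longrightarrow> i \<le> m \<Longrightarrow> conf1 (w i) (zcount (map f Ys) i)"
  shows "\<exists>Ys'. mset Ys' \<subseteq># mset Ys \<and> (\<forall>i. 1 \<le> i \<longrightarrow> i \<le> m \<longrightarrow> zcount (map f Ys') i = w i)"
  using assms
proof (induction Ys arbitrary: w)
  case Nil
  then show ?case by (intro exI[of _ "[]"]) (auto simp: conf1_def dest: order_antisym)
next
  case (Cons y Ys)
  have al: "aligned m (map f Ys)" using Cons.prems by (auto simp: aligned_def)
  let ?v = "f y" and ?z = "zcount (map f Ys)"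
  define k where "k = \<bar>?v\<bar>"
  define s where "s = sgn ?v"
  have k: "1 \<le> k" "k \<le> m" "?v = s * k" "s = 1 \<or> s = - 1"
    using Cons.prems(1) by (auto simp: aligned_def k_def s_def sgn_if)
  have c: "zcount (map f (y # Ys)) i = ?z i + (if i = k then s else 0)" if "1 \<le> i" for i
    using k that by auto
  have sg: "s = 1 \<longrightarrow> 0 \<le> ?z k" "s = - 1 \<longrightarrow> ?z k \<le> 0"
  proof -
    have "u \<noteq> - ?v" if "u \<in> set (map f Ys)" for u using Cons.prems(1) that unfolding aligned_def by auto
    then show "s = 1 \<longrightarrow> 0 \<le> ?z k" "s = - 1 \<longrightarrow> ?z k \<le> 0" using zcount_sign[of "map f Ys" k] k(3) by fastforce+
  qed
  have w: "conf1 (w i) (?z i + (if i = k then s else 0))" if "1 \<le> i" "i \<le> m" for i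
    using Cons.prems(2)[OF that] unfolding c[OF that(1)] .
  show ?case
  proof (cases "conf1 (w k) (?z k)")
    case True
    have "conf1 (w i) (?z i)" if "1 \<le> i" "i \<le> m" for i using w[OF that] True by (cases "i = k") auto
    then obtain Ys' where "mset Ys' \<subseteq># mset Ys" "\<forall>i. 1 \<le> i \<longrightarrow> i \<le> m \<longrightarrow> zcount (map f Ys') i = w i"
      using Cons.IH[OF al] by blast
    moreover have "mset Ys \<subseteq># mset (y # Ys)" by simp
    ultimately show ?thesis using subset_mset.order_trans by blast
  next
    case False
    have "conf1 ((w(k := w k - s)) i) (?z i)" if "1 \<le> i" "i \<le> m" for i
    proof (cases "i = k")
      case True
      then show ?thesis using w[OF k(1,2)] False k(4) sg by (auto simp: conf1_def)
    qed (use w[OF that] in simp)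
    then obtain Ys' where Ys': "mset Ys' \<subseteq># mset Ys" "\<forall>i. 1 \<le> i \<longrightarrow> i \<le> m \<longrightarrow> zcount (map f Ys') i = (w(k := w k - s)) i"
      using Cons.IH[OF al] by blast
    have "zcount (map f (y # Ys')) i = w i" if "1 \<le> i" "i \<le> m" for i
      using Ys'(2) that k by (cases "i = k") auto
    moreover have "mset (y # Ys') \<subseteq># mset (y # Ys)" using Ys'(1) by simp
    ultimately show ?thesis by blast
  qed
qed

lemma aligned_sub: "aligned m vs \<Longrightarrow> set vs' \<subseteq> set vs \<Longrightarrow> aligned m vs'"
  unfolding aligned_def by blast

lemma zcount_mset_sum:
  "zcount vs i = sum_mset (image_mset (\<lambda>v. if v = i then 1 else if v = - i then - 1 else 0) (mset vs))"
  unfolding zcount_def by (simp flip: sum_mset_sum_list)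

lemma zcount_mset: "mset vs = mset vs' \<Longrightarrow> zcount vs i = zcount vs' i"
  unfolding zcount_mset_sum by simp

lemma zcount_append: "zcount (vs1 @ vs2) i = zcount vs1 i + zcount vs2 i"
  by (simp add: zcount_def)

lemma zcount_sub_conf: "aligned m vs \<Longrightarrow> mset vs = mset (vs1 @ vs2) \<Longrightarrow> 1 \<le> i \<Longrightarrow> conf1 (zcount vs1 i) (zcount vs i)"
proof -
  assume a: "aligned m vs" "mset vs = mset (vs1 @ vs2)" "1 \<le> i"
  have e: "zcount vs i = zcount vs1 i + zcount vs2 i"
    using zcount_mset[OF a(2)] zcount_append by simp
  have s: "set vs = set vs1 \<union> set vs2" using a(2) by (metis set_mset_mset set_append)
  have "i \<notin> set vs \<or> - i \<notin> set vs" using a(1) unfolding aligned_def by auto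
  then show ?thesis
  proof
    assume "i \<notin> set vs"
    then have "zcount vs1 i \<le> 0" "zcount vs2 i \<le> 0" using zcount_sign(2)[of _ i] s by blast+
    then show ?thesis unfolding e by (simp add: conf1_def)
  next
    assume "- i \<notin> set vs"
    then have "0 \<le> zcount vs1 i" "0 \<le> zcount vs2 i" using zcount_sign(1)[of _ i] s by blast+
    then show ?thesis unfolding e by (simp add: conf1_def)
  qed
qed

section \<open>Two blocks as lists and the counts of the other units\<close>

definition bcols :: "(nat \<Rightarrow> int) \<Rightarrow> (nat \<Rightarrow> int) \<Rightarrow> nat \<Rightarrow> cols" where
  "bcols g h n = map (\<lambda>i. (g i, h i)) [1..<Suc n]"

definition block_row :: "nat \<Rightarrow> nat \<Rightarrow> (nat \<times> nat \<Rightarrow> int) \<Rightarrow> int list" where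
  "block_row n j u = map (\<lambda>i. u (j, i)) [1..<Suc n]"

text \<open>The conclusion of \<open>leaf_sound\<close> for all primitive vectors of one finite
  problem, in which \<open>zcols m\<close> replaces the blocks that are not made explicit.\<close>

definition core :: "(nat \<Rightarrow> int) \<Rightarrow> (nat \<Rightarrow> int) \<Rightarrow> nat \<Rightarrow> nat \<Rightarrow> nat \<Rightarrow> bool" where
  "core g h n0 n1 m \<longleftrightarrow> (\<forall>x0 x1 z. prim2 [bcols g h n0, bcols g h n1, zcols m] [x0, x1, z] \<longrightarrow>
     good x0 \<and> good x1 \<or> (good x0 \<or> good x1 \<or> lone z) \<and> separable (bcols g h n0) (bcols g h n1) (zcols m) x0 x1 z)"

lemma length_row [simp]: "length (block_row n j u) = n" by (simp add: block_row_def)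
lemma length_bcols [simp]: "length (bcols g h n) = n" by (simp add: bcols_def)
lemma length_zcols [simp]: "length (zcols n) = n" by (simp add: zcols_def)

lemma block_row_nth: "k < n \<Longrightarrow> block_row n j u ! k = u (j, Suc k)"
  by (simp add: block_row_def del: upt_Suc)

lemma sum_shift: "(\<Sum>k<n. f (Suc k)) = (\<Sum>i\<in>{1..n}. f i)"
  by (rule sum.reindex_bij_witness[of _ "\<lambda>i. i - 1" Suc]) auto

lemma degL_bcols: "length x = n \<Longrightarrow> degL (bcols g h n) x = (\<Sum>k<n. g (Suc k) * x ! k)"
  by (subst degL_sum) (auto simp: bcols_def simp del: upt_Suc)
lemma valL_bcols: "length x = n \<Longrightarrow> valL (bcols g h n) x = (\<Sum>k<n. h (Suc k) * x ! k)"
  by (subst valL_sum) (auto simp: bcols_def simp del: upt_Suc)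
lemma degL_zcols: "degL (zcols n) x = 0"
proof -
  have "degL c x = 0" if "\<forall>p\<in>set c. fst p = 0" for c
    using that by (induction c x rule: degL.induct) auto
  then show ?thesis by (auto simp: zcols_def)
qed
lemma valL_zcols: "length x = n \<Longrightarrow> valL (zcols n) x = (\<Sum>k<n. int (Suc k) * x ! k)"
  by (subst valL_sum) (auto simp: zcols_def simp del: upt_Suc)

lemma dot_sum: "dot w x = (\<Sum>k<length x. (if k < length w then w ! k else 0) * x ! k)"
proof (induction w x rule: dot.induct)
  case (1 a w b x)
  then show ?case by (simp add: sum.lessThan_Suc_shift del: sum.lessThan_Suc cong: if_cong)
qed auto

lemma nnz_card: "nnz x = int (card {k. k < length x \<and> x ! k \<noteq> 0})"
proof (induction x)
  case (Cons a x)
  let ?S = "{k. k < length x \<and> x ! k \<noteq> 0}" and ?Z = "if a = 0 then {} else {0::nat}"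
  have "{k. k < length (a # x) \<and> (a # x) ! k \<noteq> 0} = ?Z \<union> Suc ` ?S"
  proof (intro equalityI subsetI)
    fix k assume "k \<in> {k. k < length (a # x) \<and> (a # x) ! k \<noteq> 0}"
    then show "k \<in> ?Z \<union> Suc ` ?S" by (cases k) auto
  next
    fix k assume "k \<in> ?Z \<union> Suc ` ?S"
    then show "k \<in> {k. k < length (a # x) \<and> (a # x) ! k \<noteq> 0}" by (auto split: if_splits)
  qed
  moreover have "card (?Z \<union> Suc ` ?S) = card ?Z + card (Suc ` ?S)"
    by (rule card_Un_disjoint) auto
  moreover have "card (Suc ` ?S) = card ?S" by (rule card_image) simp
  ultimately show ?case using Cons by simp
qed simp

lemma sizes_sum: "sizes x = (\<Sum>k<length x. \<bar>x ! k\<bar>)"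
proof (induction x)
  case (Cons a x)
  then show ?case by (simp add: sum.lessThan_Suc_shift del: sum.lessThan_Suc)
qed simp

lemma lone_sizes: "lone z \<Longrightarrow> sizes z \<le> 1 \<and> (z \<noteq> [] \<longrightarrow> z ! 0 = 0)"
  by (cases z) (auto split: if_splits)

lemma sumf_eq_zero:
  assumes "\<And>y. y \<in> set Ys \<Longrightarrow> conf1 (y p) c" "sumf Ys p = 0" "y \<in> set Ys"
  shows "y p = 0"
  using assms
proof (induction Ys)
  case (Cons a Ys)
  have s: "conf1 (a p) c" "(0 \<le> c \<longrightarrow> 0 \<le> sumf Ys p) \<and> (c \<le> 0 \<longrightarrow> sumf Ys p \<le> 0)"
    using Cons.prems(1) sumf_sign[of Ys p c] by auto
  then have "a p = 0" "sumf Ys p = 0" using Cons.prems(2) by (auto simp: conf1_def)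
  then show ?case using Cons by auto
qed simp

lemma sub_conff:
  assumes "mset Ys = mset (Ys1 @ Ys2)" "\<And>y. y \<in> set Ys \<Longrightarrow> conff y x" "sumf Ys = x"
  shows "conff (sumf Ys1) x"
  unfolding conff_def
proof
  fix p
  have s: "set Ys = set Ys1 \<union> set Ys2" using assms(1) by (metis set_mset_mset set_append)
  have "x p = sumf Ys1 p + sumf Ys2 p" using sumf_mset[OF assms(1)] assms(3) by (metis sumf_simps(3))
  moreover have "(0 \<le> x p \<longrightarrow> 0 \<le> sumf Ys1 p) \<and> (x p \<le> 0 \<longrightarrow> sumf Ys1 p \<le> 0)"
    by (rule sumf_sign) (use assms(2) s in \<open>auto simp: conff_def\<close>)
  moreover have "(0 \<le> x p \<longrightarrow> 0 \<le> sumf Ys2 p) \<and> (x p \<le> 0 \<longrightarrow> sumf Ys2 p \<le> 0)"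
    by (rule sumf_sign) (use assms(2) s in \<open>auto simp: conff_def\<close>)
  ultimately show "conf1 (sumf Ys1 p) (x p)" by (auto simp: conf1_def)
qed

lemma sub_complement: "mset Ys' \<subseteq># mset Ys \<Longrightarrow> \<exists>Ys''. mset Ys = mset (Ys' @ Ys'')"
proof -
  assume "mset Ys' \<subseteq># mset Ys"
  then obtain M where "mset Ys = mset Ys' + M" using subset_mset.le_iff_add by blast
  moreover obtain Zs where "mset Zs = M" using ex_mset by blast
  ultimately show ?thesis by auto
qed

context blocks
begin

lemma sum_blk_row:
  assumes B: "blk j \<subseteq> {j} \<times> {1..n}" and u: "\<And>p. p \<notin> C \<Longrightarrow> u p = 0"
  shows "(\<Sum>p\<in>blk j. F (snd p) * u p) = (\<Sum>k<n. F (Suc k) * block_row n j u ! k)"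
proof -
  have "(\<Sum>p\<in>blk j. F (snd p) * u p) = (\<Sum>p\<in>Pair j ` {1..n}. F (snd p) * u p)"
    by (rule sum.mono_neutral_left) (use B u in \<open>auto simp: blk_def\<close>)
  also have "\<dots> = (\<Sum>i\<in>{1..n}. F i * u (j, i))"
    by (subst sum.reindex) (auto simp: inj_on_def)
  also have "\<dots> = (\<Sum>k<n. F (Suc k) * u (j, Suc k))" by (rule sum_shift[symmetric])
  also have "\<dots> = (\<Sum>k<n. F (Suc k) * block_row n j u ! k)" by (rule sum.cong) (auto simp: block_row_nth)
  finally show ?thesis .
qed

lemma sum_C_split:
  assumes "j0 \<noteq> j1"
  shows "(\<Sum>p\<in>C. F p) = (\<Sum>p\<in>blk j0. F p) + (\<Sum>p\<in>blk j1. F p) + (\<Sum>p\<in>{p\<in>C. fst p \<noteq> j0 \<and> fst p \<noteq> j1}. F p)"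
proof -
  have "C = blk j0 \<union> blk j1 \<union> {p\<in>C. fst p \<noteq> j0 \<and> fst p \<noteq> j1}" by (auto simp: blk_def)
  then have "sum F C = sum F (blk j0 \<union> blk j1 \<union> {p\<in>C. fst p \<noteq> j0 \<and> fst p \<noteq> j1})" by (rule arg_cong)
  also have "\<dots> = sum F (blk j0 \<union> blk j1) + sum F {p\<in>C. fst p \<noteq> j0 \<and> fst p \<noteq> j1}"
    by (rule sum.union_disjoint) (use fin in \<open>auto simp: blk_def\<close>)
  also have "sum F (blk j0 \<union> blk j1) = sum F (blk j0) + sum F (blk j1)"
    by (rule sum.union_disjoint) (use fin assms in \<open>auto simp: blk_def\<close>)
  finally show ?thesis .
qed

lemma val_rest: "val (res (- {j0, j1}) u) = (\<Sum>p\<in>{p\<in>C. fst p \<noteq> j0 \<and> fst p \<noteq> j1}. h (snd p) * u p)"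
  unfolding val_def
  by (rule sum.mono_neutral_cong_right) (use fin in \<open>auto simp: res_def\<close>)

lemma val_rows:
  assumes "j0 \<noteq> j1" "blk j0 \<subseteq> {j0} \<times> {1..n0}" "blk j1 \<subseteq> {j1} \<times> {1..n1}" "\<And>p. p \<notin> C \<Longrightarrow> u p = 0"
  shows "val u = valL (bcols g h n0) (block_row n0 j0 u) + valL (bcols g h n1) (block_row n1 j1 u) + val (res (- {j0, j1}) u)"
  using sum_C_split[OF assms(1), of "\<lambda>p. h (snd p) * u p"]
    sum_blk_row[OF assms(2,4), where F = h] sum_blk_row[OF assms(3,4), where F = h]
  by (simp add: valL_bcols val_rest val_def[of u])

lemma good_row:
  assumes B: "blk j \<subseteq> {j} \<times> {1..n}" and u: "\<And>p. p \<notin> C \<Longrightarrow> u p = 0"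
  shows "good (block_row n j u) \<longleftrightarrow> goodf u j"
proof -
  have "supp u j = (\<lambda>k. (j, Suc k)) ` {k. k < n \<and> block_row n j u ! k \<noteq> 0}"
  proof (intro equalityI subsetI)
    fix p assume p: "p \<in> supp u j"
    then have "p \<in> {j} \<times> {1..n}" "u p \<noteq> 0" using B by (auto simp: supp_def)
    then show "p \<in> (\<lambda>k. (j, Suc k)) ` {k. k < n \<and> block_row n j u ! k \<noteq> 0}"
      by (cases p) (auto intro!: image_eqI[of _ _ "snd p - 1"] simp: block_row_nth)
  next
    fix p assume "p \<in> (\<lambda>k. (j, Suc k)) ` {k. k < n \<and> block_row n j u ! k \<noteq> 0}"
    then obtain k where k: "p = (j, Suc k)" "k < n" "u p \<noteq> 0" by (auto simp: block_row_nth)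
    then have "p \<in> C" using u[of p] by blast
    then show "p \<in> supp u j" using k by (simp add: supp_def blk_def)
  qed
  then have "card (supp u j) = card {k. k < n \<and> block_row n j u ! k \<noteq> 0}"
    by (simp add: card_image inj_on_def)
  then show ?thesis by (simp add: good_def goodf_def nnz_card)
qed

text \<open>By \<open>good_conf\<close> every admissible balanced vector is conformal, so the zero
  functional suffices.\<close>

lemma all_good_edge:
  assumes "bal u" "\<And>j. goodf u j"
  shows "edgeb u"
  unfolding edgeb_def
proof (intro exI[of _ "\<lambda>_. 0"] conjI allI impI)
  fix x assume x: "bal x" "admf x u" "\<not> conff x u"
  have "conf1 (x p) (u p)" for p
  proof (cases "p \<in> C")
    case True
    then show ?thesis using good_conf[OF assms(1) x(1,2) assms(2)] by (simp add: blk_def)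
  next
    case False
    then show ?thesis using bal_out[OF assms(1) False] bal_out[OF x(1) False] by (simp add: conf1_def)
  qed
  then show "0 < (\<Sum>p\<in>C. 0 * x p)" using x(3) by (simp add: conff_def)
qed simp

lemma degL_row_0:
  assumes B: "blk j \<subseteq> {j} \<times> {1..n}" and u: "bal u"
  shows "degL (bcols g h n) (block_row n j u) = 0"
  using sum_blk_row[OF B, of u g] bal_out[OF u] u by (simp add: degL_bcols bal_def)

lemma lconf_row:
  assumes B: "blk j \<subseteq> {j} \<times> {1..n}" and l: "lconf (block_row n j x) (block_row n j u)" and p: "p \<in> blk j"
  shows "conf1 (x p) (u p)"
proof -
  obtain i where i: "p = (j, i)" "1 \<le> i" "i \<le> n" using B p by auto
  have "conf1 (block_row n j x ! (i - 1)) (block_row n j u ! (i - 1))" using l i by (simp add: list_all2_conv_all_nth)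
  then show ?thesis using i by (simp add: block_row_nth)
qed

lemma ladm_row: "admf x u \<Longrightarrow> ladm (block_row n j x) (block_row n j u)"
  by (auto simp: ladm_def list_all2_conv_all_nth block_row_nth admf_def)

text \<open>The entries of the auxiliary block that replace the units \<open>Ys\<close>: a unit of
  value \<open>i\<close> adds 1 at the column \<open>(0, i)\<close>, one of value \<open>- i\<close>
  subtracts 1 there.\<close>

definition zvec where "zvec m Ys = map (\<lambda>i. zcount (map val Ys) (int i)) [1..<Suc m]"

lemma length_zvec [simp]: "length (zvec m Ys) = m" by (simp add: zvec_def)
lemma zvec_nth: "k < m \<Longrightarrow> zvec m Ys ! k = zcount (map val Ys) (int (Suc k))"
  by (simp add: zvec_def del: upt_Suc)

lemma valL_zvec: "aligned (int m) (map val Ys) \<Longrightarrow> valL (zcols m) (zvec m Ys) = val (sumf Ys)"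
proof -
  assume "aligned (int m) (map val Ys)"
  from zcount_sum(1)[OF this] have "(\<Sum>k<m. int (Suc k) * zcount (map val Ys) (int (Suc k))) = val (sumf Ys)"
    using sum_shift[of "\<lambda>i. int i * zcount (map val Ys) (int i)" m] by (simp add: val_sumf)
  then show ?thesis by (simp add: valL_zcols zvec_nth)
qed

text \<open>The blocks other than \<open>j0\<close> and \<open>j1\<close> enter only through the
  values of their units, so \<open>core\<close> applies to the two rows of \<open>u\<close> together
  with signed counts. The hypothesis \<open>good\<close> covers two situations: either the other
  blocks have at most two entries each, or both chosen blocks have more, and then
  \<open>core\<close> leaves at most a single unit outside them.\<close>

theorem merge_edge:
  assumes u: "primb u" and j: "j0 \<noteq> j1"
    and B0: "blk j0 \<subseteq> {j0} \<times> {1..n0}" and B1: "blk j1 \<subseteq> {j1} \<times> {1..n1}"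
    and unit: "\<And>y. minb y \<Longrightarrow> (\<And>p. y p \<noteq> 0 \<Longrightarrow> fst p \<noteq> j0 \<and> fst p \<noteq> j1) \<Longrightarrow> val y \<noteq> 0 \<Longrightarrow>
      \<bar>val y\<bar> \<le> int m \<and> (\<bar>val y\<bar> = 1 \<or> card {p \<in> C. y p \<noteq> 0} \<le> 2)"
    and core: "core g h n0 n1 m"
    and good: "(\<forall>j. j \<noteq> j0 \<longrightarrow> j \<noteq> j1 \<longrightarrow> goodf u j) \<or> \<not> goodf u j0 \<and> \<not> goodf u j1"
  shows "edgeb u"
proof (cases "\<forall>j. goodf u j")
  case True
  then show ?thesis using u all_good_edge by (simp add: primb_def)
next
  case False
  have ub: "bal u" "val u = 0" "\<And>v. bal v \<Longrightarrow> val v = 0 \<Longrightarrow> conff v u \<Longrightarrow> v = zerof \<or> v = u"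
    using u unfolding primb_def by blast+
  note uout = bal_out[OF ub(1)]
  let ?R = "- {j0, j1}"
  let ?r = "res ?R u"
  have rb: "bal ?r" using ub(1) by (rule bal_res)
  \<comment> \<open>\<open>u\<close> is nonzero somewhere on the chosen blocks, so a vector
    conformal to the rest is never \<open>u\<close>; primitivity then forces it to be 0 whenever it
    is balanced of value 0.\<close>
  obtain p0 where p0: "fst p0 = j0 \<or> fst p0 = j1" "u p0 \<noteq> 0"
  proof -
    have "\<not> goodf u j0 \<or> \<not> goodf u j1" using False good by metis
    then obtain j where jj: "j = j0 \<or> j = j1" "\<not> goodf u j" by blast
    then have "supp u j \<noteq> {}" by (auto simp: goodf_def)
    then show ?thesis using that jj by (auto simp: supp_def blk_def)
  qed
  obtain Ys where Ys: "\<And>y. y \<in> set Ys \<Longrightarrow> minb y \<and> conff y ?r" "sumf Ys = ?r"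
    using ex_decomp[OF rb] by blast
  have not_u: "v \<noteq> u" if "conff v ?r" for v
  proof
    assume "v = u"
    then have "conf1 (u p0) (?r p0)" using that by (simp add: conff_def)
    then show False using p0 by (auto simp: res_def conf1_def)
  qed
  have r_u: "conff v u" if "conff v ?r" for v using that conff_res conff_trans by blast
  have Ysb: "bal y" "y \<noteq> zerof" if "y \<in> set Ys" for y using Ys(1)[OF that] by (auto simp: minb_def)
  have val_nz: "val y \<noteq> 0" if y: "y \<in> set Ys" for y
  proof
    assume v0: "val y = 0"
    have c: "conff y ?r" using Ys(1)[OF y] by (rule conjunct2)
    have "y = zerof \<or> y = u" by (rule ub(3)[OF Ysb(1)[OF y] v0 r_u[OF c]])
    then show False using Ysb(2)[OF y] not_u[OF c] by simp
  qed
  \<comment> \<open>Two units of opposite values would add up to a nonzero conformal vector of value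
    0 outside the chosen blocks.\<close>
  have al: "aligned (int m) (map val Ys)"
    unfolding aligned_def
  proof (intro conjI ballI)
    fix v assume "v \<in> set (map val Ys)"
    then obtain y where y: "y \<in> set Ys" "v = val y" by auto
    show "v \<noteq> 0" using val_nz[OF y(1)] y(2) by simp
    have "fst p \<noteq> j0 \<and> fst p \<noteq> j1" if "y p \<noteq> 0" for p
    proof -
      have "?r p \<noteq> 0" using conff_zero[of y ?r p] Ys(1)[OF y(1)] that by blast
      then show ?thesis by (auto simp: res_def split: if_splits)
    qed
    note d = this
    have "minb y" using Ys(1)[OF y(1)] by (rule conjunct1)
    from unit[OF this d val_nz[OF y(1)]] show "\<bar>v\<bar> \<le> int m" unfolding y(2) by (rule conjunct1)
  next
    fix v v' assume "v \<in> set (map val Ys)" "v' \<in> set (map val Ys)"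
    then obtain y y' where y: "y \<in> set Ys" "v = val y" "y' \<in> set Ys" "v' = val y'" by auto
    show "v' \<noteq> - v"
    proof
      assume eq: "v' = - v"
      have "v \<noteq> 0" using val_nz[OF y(1)] y(2) by simp
      then have "y \<noteq> y'" using eq y by auto
      moreover have "y \<in># mset Ys" "y' \<in># mset Ys" using y by simp_all
      ultimately have "y' \<in># mset Ys - {#y#}"
        by (cases "y' = y") (simp_all add: in_diff_count)
      then have "mset [y, y'] \<subseteq># mset Ys" using \<open>y \<in># mset Ys\<close> by (simp add: insert_subset_eq_iff)
      then obtain Zs where "mset Ys = mset ([y, y'] @ Zs)" using sub_complement by blast
      from sub_conff[OF this _ Ys(2)] have c: "conff (sumf [y, y']) ?r" using Ys(1) by blast
      have v0: "val (sumf [y, y']) = 0" using eq y by (simp add: val_sumf)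
      have b: "bal (sumf [y, y'])" by (rule bal_sumf) (use Ysb(1) y in auto)
      have "sumf [y, y'] = zerof \<or> sumf [y, y'] = u" by (rule ub(3)[OF b v0 r_u[OF c]])
      then have z: "sumf [y, y'] = zerof" using not_u[OF c] by simp
      have "y p = 0" for p
        by (rule sumf_eq_zero[of "[y, y']" p "?r p"]) (use z Ys(1) y in \<open>auto simp: conff_def fun_eq_iff\<close>)
      then have "y = zerof" by (rule ext)
      then show False using Ysb(2)[OF y(1)] by simp
    qed
  qed
  have sum_zero_Nil: "Zs = []" if "set Zs \<subseteq> set Ys" "sumf Zs = zerof" for Zs
  proof (rule ccontr)
    assume "Zs \<noteq> []"
    then obtain y where y: "y \<in> set Zs" by (cases Zs) auto
    have "y p = 0" for p
      by (rule sumf_eq_zero[of Zs p "?r p"]) (use that Ys(1) y in \<open>auto simp: conff_def fun_eq_iff\<close>)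
    then have "y = zerof" by (rule ext)
    moreover have "y \<in> set Ys" using y that(1) by blast
    ultimately show False using Ysb(2) by blast
  qed
  let ?x0 = "block_row n0 j0 u" and ?x1 = "block_row n1 j1 u" and ?z = "zvec m Ys"
  let ?cs = "[bcols g h n0, bcols g h n1, zcols m]" and ?u = "[block_row n0 j0 u, block_row n1 j1 u, zvec m Ys]"
  \<comment> \<open>A vector conformal to the three rows lifts to one conformal to \<open>u\<close>:
    by \<open>zcount_sub\<close> its third row selects a sublist \<open>Ys'\<close> of the units. So
    primitivity carries over from \<open>u\<close>.\<close>
  have prim: "prim2 ?cs ?u"
    unfolding prim2_def
  proof (intro conjI allI impI)
    show "bal2 ?cs ?u"
      using degL_row_0[OF B0 ub(1)] degL_row_0[OF B1 ub(1)] by (simp add: bal2_def degL_zcols)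
    show "val2 ?cs ?u = 0"
      using val_rows[OF j B0 B1 uout] valL_zvec[OF al] Ys(2) ub(2) by simp
    show "\<not> null2 ?u"
    proof
      assume n: "null2 ?u"
      have "p0 \<in> C" using p0(2) uout by blast
      then obtain i where i: "p0 = (fst p0, Suc i)" "fst p0 = j0 \<and> i < n0 \<or> fst p0 = j1 \<and> i < n1"
        using p0(1) B0 B1 by (cases p0; cases "snd p0") (auto simp: blk_def)
      have "block_row n0 j0 u ! i = 0" if "i < n0" using n that by (auto simp: null2_def)
      moreover have "block_row n1 j1 u ! i = 0" if "i < n1" using n that by (auto simp: null2_def)
      ultimately show False using i p0(2) by (metis block_row_nth)
    qed
    fix v assume v: "bal2 ?cs v" "val2 ?cs v = 0" "conf2 v ?u"
    obtain v0 v1 z' where vv: "v = [v0, v1, z']" and len: "length v0 = n0" "length v1 = n1" "length z' = m"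
      and deg: "degL (bcols g h n0) v0 = 0" "degL (bcols g h n1) v1 = 0"
      using v(1) by (auto simp: bal2_def list_all2_Cons1)
    have cf: "lconf v0 ?x0" "lconf v1 ?x1" "lconf z' ?z" using v(3) by (simp_all add: vv)
    have "\<exists>Ys'. mset Ys' \<subseteq># mset Ys \<and> (\<forall>i. 1 \<le> i \<longrightarrow> i \<le> int m \<longrightarrow> zcount (map val Ys') i = z' ! (nat i - 1))"
    proof (rule zcount_sub[OF al])
      fix i :: int assume i: "1 \<le> i" "i \<le> int m"
      then have "nat i - 1 < m" "int (Suc (nat i - 1)) = i" by auto
      then show "conf1 (z' ! (nat i - 1)) (zcount (map val Ys) i)"
        using cf(3) by (auto simp: list_all2_conv_all_nth zvec_nth)
    qed
    then obtain Ys' where Ys': "mset Ys' \<subseteq># mset Ys" "\<And>i. 1 \<le> i \<Longrightarrow> i \<le> int m \<Longrightarrow> zcount (map val Ys') i = z' ! (nat i - 1)"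
      by blast
    obtain Ys'' where Ys'': "mset Ys = mset (Ys' @ Ys'')" using sub_complement[OF Ys'(1)] by blast
    have sets: "set Ys' \<subseteq> set Ys" "set Ys'' \<subseteq> set Ys" using Ys'' by (metis set_mset_mset set_append Un_upper1 Un_upper2)+
    have z'_eq: "z' = zvec m Ys'"
    proof (rule nth_equalityI)
      fix k assume "k < length z'"
      then have k: "k < m" using len by simp
      have "zcount (map val Ys') (int (Suc k)) = z' ! (nat (int (Suc k)) - 1)" by (rule Ys'(2)) (use k in auto)
      moreover have "nat (int (Suc k)) - 1 = k" by (simp only: nat_int diff_Suc_1)
      ultimately show "z' ! k = zvec m Ys' ! k" by (simp only: zvec_nth[OF k])
    qed (simp add: len)
    have al': "aligned (int m) (map val Ys')" by (rule aligned_sub[OF al]) (use sets in auto)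
    let ?s = "sumf Ys'"
    have sc: "conff ?s ?r" by (rule sub_conff[OF Ys'' _ Ys(2)]) (use Ys(1) in blast)
    have sb: "bal ?s" by (rule bal_sumf) (use Ysb sets in blast)
    have s0: "?s p = 0" if "fst p = j0 \<or> fst p = j1" for p
      using conff_zero[OF sc, of p] that by (auto simp: res_def)
    define x where "x p = (if fst p = j0 then if p \<in> C then v0 ! (snd p - 1) else 0
      else if fst p = j1 then if p \<in> C then v1 ! (snd p - 1) else 0 else ?s p)" for p
    have xout: "x p = 0" if "p \<notin> C" for p using that bal_out[OF sb] by (simp add: x_def)
    have row0: "block_row n0 j0 x = v0"
    proof (rule nth_equalityI)
      fix k assume k: "k < length (block_row n0 j0 x)"
      have "v0 ! k = 0" if "(j0, Suc k) \<notin> C"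
        using cf(1) uout[OF that] k len by (auto simp: list_all2_conv_all_nth block_row_nth conf1_def)
      then show "block_row n0 j0 x ! k = v0 ! k" using k by (simp add: block_row_nth x_def)
    qed (simp add: len)
    have row1: "block_row n1 j1 x = v1"
    proof (rule nth_equalityI)
      fix k assume k: "k < length (block_row n1 j1 x)"
      have "v1 ! k = 0" if "(j1, Suc k) \<notin> C"
        using cf(2) uout[OF that] k len by (auto simp: list_all2_conv_all_nth block_row_nth conf1_def)
      then show "block_row n1 j1 x ! k = v1 ! k" using k j by (simp add: block_row_nth x_def)
    qed (simp add: len)
    have resx: "res ?R x = ?s" using s0 by (auto simp: res_def x_def fun_eq_iff)
    have xb: "bal x"
      unfolding bal_def
    proof (intro conjI allI impI)
      fix i
      consider "i = j0" | "i = j1" | "i \<noteq> j0" "i \<noteq> j1" by blast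
      then show "(\<Sum>p\<in>blk i. g (snd p) * x p) = 0"
      proof cases
        case 1
        then show ?thesis using sum_blk_row[OF B0 xout, where F = g] row0 deg(1) len by (simp add: degL_bcols)
      next
        case 2
        then show ?thesis using sum_blk_row[OF B1 xout, where F = g] row1 deg(2) len by (simp add: degL_bcols)
      next
        case 3
        then have "(\<Sum>p\<in>blk i. g (snd p) * x p) = (\<Sum>p\<in>blk i. g (snd p) * ?s p)"
          by (intro sum.cong) (auto simp: x_def blk_def)
        then show ?thesis using sb by (simp add: bal_def)
      qed
    qed (rule xout)
    have "val x = 0"
      using val_rows[OF j B0 B1 xout] row0 row1 resx v(2) valL_zvec[OF al'] by (simp add: vv z'_eq)
    moreover have "conff x u"
      unfolding conff_def
    proof
      fix p
      show "conf1 (x p) (u p)"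
      proof (cases "p \<in> C")
        case False
        then show ?thesis using xout uout by (simp add: conf1_def)
      next
        case pC: True
        consider "p \<in> blk j0" | "p \<in> blk j1" | "fst p \<noteq> j0" "fst p \<noteq> j1" using pC by (auto simp: blk_def)
        then show ?thesis
        proof cases
          case 1
          then show ?thesis using lconf_row[OF B0, of x u] cf(1) row0 by simp
        next
          case 2
          then show ?thesis using lconf_row[OF B1, of x u] cf(2) row1 by simp
        next
          case 3
          then show ?thesis using sc by (auto simp: x_def conff_def res_def split: if_splits)
        qed
      qed
    qed
    ultimately have "x = zerof \<or> x = u" using ub(3) xb by blast
    then show "null2 v \<or> v = ?u"
    proof
      assume "x = zerof"
      then have "v0 = replicate n0 0" "v1 = replicate n1 0" "?s = zerof"
        using row0[symmetric] row1[symmetric] resx[symmetric] by (auto simp: block_row_def res_def map_replicate_const)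
      moreover from this have "Ys' = []" using sum_zero_Nil[OF sets(1)] by blast
      then have "z' = replicate m 0" unfolding z'_eq zvec_def by (simp add: map_replicate_const)
      ultimately show ?thesis by (simp add: vv null2_def)
    next
      assume xu: "x = u"
      then have "?s = ?r" using resx by simp
      have "sumf Ys'' = zerof"
      proof
        fix p
        have "sumf Ys p = ?s p + sumf Ys'' p" using sumf_mset[OF Ys''] by simp
        then show "sumf Ys'' p = 0" using \<open>?s = ?r\<close> Ys(2) by simp
      qed
      then have "Ys'' = []" using sum_zero_Nil[OF sets(2)] by blast
      then have "mset (map val Ys') = mset (map val Ys)" using Ys'' by simp
      then have "z' = ?z" unfolding z'_eq zvec_def using zcount_mset by simp
      then show ?thesis using row0 row1 xu by (simp add: vv)
    qed
  qed
  have disj: "good ?x0 \<and> good ?x1 \<or> (good ?x0 \<or> good ?x1 \<or> lone ?z) \<and>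
      separable (bcols g h n0) (bcols g h n1) (zcols m) ?x0 ?x1 ?z"
    using core prim unfolding core_def by blast
  have g01: "good ?x0 \<longleftrightarrow> goodf u j0" "good ?x1 \<longleftrightarrow> goodf u j1"
    using good_row[OF B0 uout] good_row[OF B1 uout] by simp_all
  \<comment> \<open>If both chosen blocks are large, \<open>lone\<close> leaves at most one unit,
    and not of absolute value 1; by \<open>unit\<close> it has at most two nonzero entries.\<close>
  have rest_good: "goodf u i" if i: "i \<noteq> j0" "i \<noteq> j1" for i
  proof (cases "goodf u j0 \<or> goodf u j1")
    case True
    then show ?thesis using good i by blast
  next
    case False
    then have "lone ?z" using disj g01 by blast
    then have lz: "sizes ?z \<le> 1" "?z \<noteq> [] \<longrightarrow> ?z ! 0 = 0" using lone_sizes by blast+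
    have "zcount (map val Ys) 1 = 0" if "0 < m"
    proof -
      have "length ?z \<noteq> 0" using that by simp
      then have "?z ! 0 = 0" using lz(2) by (metis list.size(3))
      then show ?thesis using zvec_nth[OF that] by simp
    qed
    note l = lz(1) this
    have "sizes ?z = (\<Sum>k<m. \<bar>zcount (map val Ys) (int (Suc k))\<bar>)"
      unfolding sizes_sum length_zvec by (rule sum.cong) (auto simp: zvec_nth)
    also have "\<dots> = int (length Ys)"
      using zcount_sum(2)[OF al] sum_shift[of "\<lambda>i. \<bar>zcount (map val Ys) (int i)\<bar>" m] by simp
    finally have "length Ys \<le> 1" using l(1) by simp
    have sup: "supp u i = {p \<in> blk i. ?r p \<noteq> 0}" using i by (auto simp: supp_def res_def blk_def)
    show ?thesis
    proof (cases Ys)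
      case Nil
      then have "?r = zerof" using Ys(2) by (simp add: sumf_Nil)
      then show ?thesis by (simp add: goodf_def sup)
    next
      case (Cons y Zs)
      then have y: "Ys = [y]" using \<open>length Ys \<le> 1\<close> by simp
      then have ry: "?r = y" using Ys(2) by (auto simp: sumf_def fun_eq_iff)
      have "val y \<noteq> 0" "\<bar>val y\<bar> \<le> int m" using al y by (auto simp: aligned_def)
      then have "0 < m" by linarith
      then have "\<bar>val y\<bar> \<noteq> 1" using l(2) y by (auto split: if_splits)
      have d: "fst p \<noteq> j0 \<and> fst p \<noteq> j1" if "y p \<noteq> 0" for p
        using that ry by (auto simp: res_def fun_eq_iff split: if_splits)
      have "y \<in> set Ys" by (simp add: y)
      then have "minb y" using Ys(1) by blast
      note u2 = unit[OF this d \<open>val y \<noteq> 0\<close>]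
      with \<open>\<bar>val y\<bar> \<noteq> 1\<close> have "card {p \<in> C. y p \<noteq> 0} \<le> 2"
        using u2 by blast
      moreover have "card (supp u i) \<le> card {p \<in> C. y p \<noteq> 0}"
        unfolding sup ry using fin by (intro card_mono) (auto simp: blk_def)
      ultimately show ?thesis by (simp add: goodf_def)
    qed
  qed
  have "\<not> (good ?x0 \<and> good ?x1)" using False rest_good g01 by metis
  then have "separable (bcols g h n0) (bcols g h n1) (zcols m) ?x0 ?x1 ?z" using disj by blast
  then obtain w where w: "dot w (?x0 @ ?x1) = 0"
    "\<And>y0 y1 z'. ladm y0 ?x0 \<Longrightarrow> ladm y1 ?x1 \<Longrightarrow> lconf z' ?z \<Longrightarrow> degL (bcols g h n0) y0 = 0 \<Longrightarrow>
       degL (bcols g h n1) y1 = 0 \<Longrightarrow> valL (bcols g h n0) y0 + valL (bcols g h n1) y1 + valL (zcols m) z' = 0 \<Longrightarrow>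
       \<not> (lconf y0 ?x0 \<and> lconf y1 ?x1) \<Longrightarrow> 0 < dot w (y0 @ y1)"
    unfolding separable_def by blast
  \<comment> \<open>\<open>dot\<close> stops at the end of the shorter list, so weights beyond the
    end of \<open>w\<close> count as 0. Positions start at 1, and the weights of the second block
    follow the \<open>n0\<close> weights of the first.\<close>
  define W where "W k = (if k < length w then w ! k else 0)" for k
  define \<omega> where "\<omega> p = (if fst p = j0 then W (snd p - 1) else if fst p = j1 then W (n0 + snd p - 1) else 0)" for p :: "nat \<times> nat"
  have \<omega>: "(\<Sum>p\<in>C. \<omega> p * x p) = dot w (block_row n0 j0 x @ block_row n1 j1 x)" if x: "\<And>p. p \<notin> C \<Longrightarrow> x p = 0" for x
  proof -
    have "(\<Sum>p\<in>blk j0. \<omega> p * x p) = (\<Sum>p\<in>blk j0. W (snd p - 1) * x p)"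
      by (rule sum.cong) (auto simp: \<omega>_def blk_def)
    also have "\<dots> = (\<Sum>k<n0. W k * block_row n0 j0 x ! k)"
      using sum_blk_row[OF B0 x, where F = "\<lambda>i. W (i - 1)"] by simp
    finally have 0: "(\<Sum>p\<in>blk j0. \<omega> p * x p) = (\<Sum>k<n0. W k * block_row n0 j0 x ! k)" .
    have "(\<Sum>p\<in>blk j1. \<omega> p * x p) = (\<Sum>p\<in>blk j1. W (n0 + snd p - 1) * x p)"
      by (rule sum.cong) (use j in \<open>auto simp: \<omega>_def blk_def\<close>)
    also have "\<dots> = (\<Sum>k<n1. W (n0 + k) * block_row n1 j1 x ! k)"
      using sum_blk_row[OF B1 x, where F = "\<lambda>i. W (n0 + i - 1)"] by simp
    finally have 1: "(\<Sum>p\<in>blk j1. \<omega> p * x p) = (\<Sum>k<n1. W (n0 + k) * block_row n1 j1 x ! k)" .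
    have 2: "(\<Sum>p\<in>{p\<in>C. fst p \<noteq> j0 \<and> fst p \<noteq> j1}. \<omega> p * x p) = 0"
      by (rule sum.neutral) (auto simp: \<omega>_def)
    have "dot w (block_row n0 j0 x @ block_row n1 j1 x) = (\<Sum>k<n0 + n1. W k * (block_row n0 j0 x @ block_row n1 j1 x) ! k)"
      unfolding dot_sum W_def by simp
    also have "\<dots> = (\<Sum>k<n0. W k * block_row n0 j0 x ! k) + (\<Sum>k<n1. W (n0 + k) * block_row n1 j1 x ! k)"
    proof -
      have "{..<n0 + n1} = {..<n0} \<union> (+) n0 ` {..<n1}"
      proof (intro equalityI subsetI)
        fix k assume "k \<in> {..<n0 + n1}"
        then show "k \<in> {..<n0} \<union> (+) n0 ` {..<n1}"
          by (cases "k < n0") (auto intro!: image_eqI[of _ _ "k - n0"])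
      qed auto
      then have "(\<Sum>k<n0 + n1. W k * (block_row n0 j0 x @ block_row n1 j1 x) ! k) =
        (\<Sum>k<n0. W k * (block_row n0 j0 x @ block_row n1 j1 x) ! k) + (\<Sum>k\<in>(+) n0 ` {..<n1}. W k * (block_row n0 j0 x @ block_row n1 j1 x) ! k)"
        by (simp only:) (rule sum.union_disjoint; auto)
      also have "(\<Sum>k\<in>(+) n0 ` {..<n1}. W k * (block_row n0 j0 x @ block_row n1 j1 x) ! k) = (\<Sum>k<n1. W (n0 + k) * block_row n1 j1 x ! k)"
        by (subst sum.reindex) (auto simp: nth_append)
      also have "(\<Sum>k<n0. W k * (block_row n0 j0 x @ block_row n1 j1 x) ! k) = (\<Sum>k<n0. W k * block_row n0 j0 x ! k)"
        by (rule sum.cong) (auto simp: nth_append)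
      finally show ?thesis .
    qed
    finally show ?thesis unfolding sum_C_split[OF j] 0 1 2 by simp
  qed
  show ?thesis
    unfolding edgeb_def
  proof (intro exI[of _ \<omega>] conjI allI impI)
    show "(\<Sum>p\<in>C. \<omega> p * u p) = 0" using \<omega>[OF uout] w(1) by simp
    fix x assume x: "bal x" "val x = 0" "admf x u" "\<not> conff x u"
    note xout = bal_out[OF x(1)]
    let ?q = "res ?R x"
    \<comment> \<open>Outside the chosen blocks \<open>x\<close> is conformal to \<open>u\<close>.
      Decomposing this part and its complement yields the units \<open>Ys\<close> again, by
      uniqueness, so the part itself uses a sublist of them and its counts are conformal to those of
      \<open>Ys\<close>.\<close>
    have rest_conf: "conf1 (x p) (u p)" if "p \<in> C" "fst p \<noteq> j0" "fst p \<noteq> j1" for p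
      by (rule good_conf[OF ub(1) x(1,3) rest_good[OF that(2,3)]]) (use that in \<open>simp add: blk_def\<close>)
    have qc: "conff ?q ?r"
      unfolding conff_def
    proof
      fix p show "conf1 (?q p) (?r p)"
        using rest_conf[of p] xout[of p] uout[of p] by (cases "p \<in> C") (auto simp: res_def conf1_def)
    qed
    have qb: "bal ?q" using x(1) by (rule bal_res)
    obtain Y1 where Y1: "\<And>y. y \<in> set Y1 \<Longrightarrow> minb y \<and> conff y ?q" "sumf Y1 = ?q"
      using ex_decomp[OF qb] by blast
    obtain Y2 where Y2: "\<And>y. y \<in> set Y2 \<Longrightarrow> minb y \<and> conff y (\<lambda>p. ?r p - ?q p)" "sumf Y2 = (\<lambda>p. ?r p - ?q p)"
      using ex_decomp[OF bal_diff[OF rb qb]] by blast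
    have "mset (Y1 @ Y2) = mset Ys"
    proof (rule decomp_unique[OF rb])
      fix i
      show "goodf ?r i"
      proof (cases "i = j0 \<or> i = j1")
        case True
        then have "supp ?r i = {}" by (auto simp: supp_def res_def blk_def)
        then show ?thesis by (simp add: goodf_def)
      next
        case False
        then have "supp ?r i = supp u i" by (auto simp: supp_def res_def blk_def)
        then show ?thesis using False rest_good[of i] by (simp add: goodf_def)
      qed
    next
      fix y assume "y \<in> set (Y1 @ Y2)"
      then show "minb y \<and> conff y ?r" using Y1(1) Y2(1) conff_trans[OF _ qc] conff_trans[OF _ conff_diff[OF qc]] by auto
    next
      show "sumf (Y1 @ Y2) = ?r" by (rule ext) (simp add: Y1(2) Y2(2))
    qed (use Ys in auto)
    then have mY: "mset (map val Ys) = mset (map val Y1 @ map val Y2)" by (metis map_append mset_map)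
    have al1: "aligned (int m) (map val Y1)"
    proof (rule aligned_sub[OF al])
      show "set (map val Y1) \<subseteq> set (map val Ys)" using mY by (metis set_append set_mset_mset Un_upper1)
    qed
    have "lconf (zvec m Y1) ?z"
      using zcount_sub_conf[OF al mY] by (auto simp: list_all2_conv_all_nth zvec_nth)
    moreover have "valL (bcols g h n0) (block_row n0 j0 x) + valL (bcols g h n1) (block_row n1 j1 x) + valL (zcols m) (zvec m Y1) = 0"
      using val_rows[OF j B0 B1 xout] valL_zvec[OF al1] Y1(2) x(2) by simp
    moreover have "\<not> (lconf (block_row n0 j0 x) ?x0 \<and> lconf (block_row n1 j1 x) ?x1)"
    proof
      assume l: "lconf (block_row n0 j0 x) ?x0 \<and> lconf (block_row n1 j1 x) ?x1"
      have "conf1 (x p) (u p)" for p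
      proof (cases "p \<in> C")
        case True
        then consider "p \<in> blk j0" | "p \<in> blk j1" | "fst p \<noteq> j0" "fst p \<noteq> j1" by (auto simp: blk_def)
        then show ?thesis
        proof cases
          case 1
          then show ?thesis using lconf_row[OF B0] l by blast
        next
          case 2
          then show ?thesis using lconf_row[OF B1] l by blast
        next
          case 3
          then show ?thesis using rest_conf True by blast
        qed
      next
        case False
        then show ?thesis using xout uout by (simp add: conf1_def)
      qed
      then show False using x(4) by (simp add: conff_def)
    qed
    ultimately have "0 < dot w (block_row n0 j0 x @ block_row n1 j1 x)"
      using w(2)[OF ladm_row[OF x(3)] ladm_row[OF x(3)]] degL_row_0[OF B0 x(1)] degL_row_0[OF B1 x(1)] by blast
    then show "0 < (\<Sum>p\<in>C. \<omega> p * x p)" using \<omega>[OF xout] by simp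
  qed
qed

end

section \<open>The two families\<close>

definition cells :: "nat list \<Rightarrow> (nat \<times> nat) set" where
  "cells ns = {(j, i). j < length ns \<and> 1 \<le> i \<and> i \<le> ns ! j}"

lemma finite_cells: "finite (cells ns)"
proof (rule finite_subset)
  show "cells ns \<subseteq> Sigma {..<length ns} (\<lambda>j. {..ns ! j})"
    unfolding cells_def by auto
qed simp

lemma mem_cells: "p \<in> cells ns \<longleftrightarrow> fst p < length ns \<and> 1 \<le> snd p \<and> snd p \<le> ns ! fst p"
  by (auto simp: cells_def)

text \<open>In the first family the block rows consist of ones and the common row of positions; in
  the second family these roles are exchanged.\<close>

interpretation S: blocks "cells ns" "\<lambda>_. 1" int for ns
  by unfold_locales (auto simp: finite_cells)

interpretation H: blocks "cells ns" int "\<lambda>_. 1" for ns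
  by unfold_locales (auto simp: finite_cells, auto simp: mem_cells)

lemma S_blk: "S.blk ns j \<subseteq> {j} \<times> {1..n}" if "j < length ns \<Longrightarrow> ns ! j \<le> n"
  using that by (auto simp: S.blk_def mem_cells)

lemma H_blk: "H.blk ns j \<subseteq> {j} \<times> {1..n}" if "j < length ns \<Longrightarrow> ns ! j \<le> n"
  using that by (auto simp: H.blk_def mem_cells)

section \<open>Minimal balanced vectors of the two families\<close>

lemma S_unit:
  assumes y: "S.minb ns y"
  obtains j a b where "(j, a) \<in> cells ns" "(j, b) \<in> cells ns" "a \<noteq> b"
    "y = (\<lambda>p. (if p = (j, a) then 1 else 0) - (if p = (j, b) then 1 else 0))"
proof -
  have yb: "S.bal ns y" "y \<noteq> zerof" using y by (auto simp: S.minb_def)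
  then obtain p where p: "y p \<noteq> 0" by fastforce
  then have pC: "p \<in> cells ns" using S.bal_out[OF yb(1)] by blast
  define B where "B = S.blk ns (fst p)"
  have fB: "finite B" unfolding B_def by (rule S.fin_blk)
  have pB: "p \<in> B" using pC by (simp add: B_def S.blk_def)
  have s: "(\<Sum>q\<in>B. y q) = 0" using yb(1) by (simp add: S.bal_def B_def)
  have "\<exists>q\<in>B. 0 < y q"
  proof (rule ccontr)
    assume "\<not> ?thesis"
    then have "\<And>q. q \<in> B \<Longrightarrow> 0 \<le> - y q" by (simp add: not_less)
    moreover have "(\<Sum>q\<in>B. - y q) = 0" using s by (simp add: sum_negf)
    ultimately have "- y p = 0" using sum_nonneg_eq_0_iff[OF fB, of "\<lambda>q. - y q"] pB by simp
    then show False using p by simp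
  qed
  then obtain q1 where q1: "q1 \<in> B" "0 < y q1" by blast
  have "\<exists>q\<in>B. y q < 0"
  proof (rule ccontr)
    assume "\<not> ?thesis"
    then have "\<And>q. q \<in> B \<Longrightarrow> 0 \<le> y q" by (simp add: not_less)
    then have "y p = 0" using sum_nonneg_eq_0_iff[OF fB, of y] pB s by simp
    then show False using p by simp
  qed
  then obtain q2 where q2: "q2 \<in> B" "y q2 < 0" by blast
  have "q1 \<noteq> q2" using q1(2) q2(2) by auto
  then have q: "q1 = (fst p, snd q1)" "q2 = (fst p, snd q2)" "q1 \<in> cells ns" "q2 \<in> cells ns" "q1 \<noteq> q2"
    using q1(1) q2(1) by (simp_all add: B_def S.blk_def prod_eq_iff)
  define e where "e p = (if p = q1 then 1 else 0) - (if p = q2 then 1 else 0 :: int)" for p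
  have "S.bal ns e"
    unfolding S.bal_def
  proof (intro conjI allI impI)
    fix j
    have "(\<Sum>q\<in>S.blk ns j. 1 * e q) = (\<Sum>q\<in>S.blk ns j. if q = q1 then 1 else 0) - (\<Sum>q\<in>S.blk ns j. if q = q2 then 1 else 0)"
      by (simp add: e_def sum_subtractf)
    also have "\<dots> = 0" using q q1(1) q2(1) S.fin_blk[of ns j] by (auto simp: S.blk_def B_def)
    finally show "(\<Sum>q\<in>S.blk ns j. 1 * e q) = 0" .
  qed (use q in \<open>auto simp: e_def\<close>)
  moreover have "conff e y" using q1(2) q2(2) by (auto simp: conff_def conf1_def e_def)
  moreover have "e \<noteq> zerof"
  proof
    assume "e = zerof"
    then have "e q1 = 0" by (rule fun_cong)
    then show False using q(5) by (simp add: e_def)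
  qed
  ultimately have "e = y" using y unfolding S.minb_def by blast
  then show ?thesis using that[of "fst p" "snd q1" "snd q2"] q by (metis e_def ext)
qed

text \<open>The value is a difference of two positions in a block of at most \<open>m + 1\<close>
  columns.\<close>

lemma S_unit_val:
  assumes y: "S.minb ns y" and m: "\<And>j a. y (j, a) \<noteq> 0 \<Longrightarrow> j < length ns \<Longrightarrow> ns ! j \<le> Suc m"
  shows "\<bar>S.val ns y\<bar> \<le> int m \<and> card {p \<in> cells ns. y p \<noteq> 0} \<le> 2"
proof -
  obtain j a b where e: "(j, a) \<in> cells ns" "(j, b) \<in> cells ns" "a \<noteq> b"
    "y = (\<lambda>p. (if p = (j, a) then 1 else 0) - (if p = (j, b) then 1 else 0))" using S_unit[OF y] .
  have "S.val ns y = (\<Sum>p\<in>cells ns. (if p = (j, a) then int (snd p) else 0)) - (\<Sum>p\<in>cells ns. (if p = (j, b) then int (snd p) else 0))"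
    unfolding S.val_def e(4) sum_subtractf[symmetric] by (rule sum.cong) auto
  also have "\<dots> = int a - int b" using e(1,2) finite_cells[of ns] by simp
  finally have v: "S.val ns y = int a - int b" .
  have "y (j, a) \<noteq> 0" using e(3) by (simp add: e(4))
  then have "ns ! j \<le> Suc m" using m e(1) by (auto simp: mem_cells)
  then have "\<bar>S.val ns y\<bar> \<le> int m" using e(1,2) v by (auto simp: mem_cells)
  moreover have "card {p \<in> cells ns. y p \<noteq> 0} \<le> card {(j, a), (j, b)}"
    by (rule card_mono) (auto simp: e(4) split: if_splits)
  moreover have "card {(j, a), (j, b)} \<le> 2" by (simp add: card_insert_if)
  ultimately show ?thesis by linarith
qed

text \<open>A block with fewer than three columns is padded by zeros to three, where
  \<open>hunits\<close> is complete.\<close>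

lemma H_unit:
  assumes y: "H.minb ns y" and p: "y p \<noteq> 0" and n: "ns ! fst p \<le> 3"
  obtains u where "u \<in> set hunits" "H.val ns y = snd u" "\<forall>i<3. y (fst p, Suc i) = fst u ! i"
    "{q \<in> cells ns. y q \<noteq> 0} \<subseteq> {(fst p, Suc i) | i. i < 3 \<and> fst u ! i \<noteq> 0}"
proof -
  let ?j = "fst p"
  have yb: "H.bal ns y" using y by (simp add: H.minb_def)
  have B: "H.blk ns ?j \<subseteq> {?j} \<times> {1..3}" by (rule H_blk) (rule n)
  have "p \<in> cells ns" using H.bal_out[OF yb] p by blast
  then obtain i where i: "p = (?j, Suc i)" "i < 3" using n by (cases p; cases "snd p") (auto simp: mem_cells)
  have hc: "bcols int (\<lambda>_. 1) 3 = hcols 3" by (simp add: bcols_def hcols_def)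
  have "block_row 3 ?j y ! i = y p" using block_row_nth[OF i(2)] i(1) by metis
  moreover have "block_row 3 ?j y ! i \<in> set (block_row 3 ?j y)" using i(2) by (intro nth_mem) simp
  ultimately have nz: "\<exists>a\<in>set (block_row 3 ?j y). a \<noteq> 0" using p by metis
  have "degL (hcols 3) (block_row 3 ?j y) = 0" using H.degL_row_0[OF B yb] unfolding hc .
  then obtain u where u: "u \<in> set hunits" "lconf (fst u) (block_row 3 ?j y)"
    using hcols_block nz unfolding block_ok_def by (metis hc length_bcols length_row)
  have ul: "length (fst u) = 3" "degL (hcols 3) (fst u) = 0" "snd u = valL (hcols 3) (fst u)" "\<exists>a\<in>set (fst u). a \<noteq> 0"
    using hcols_block u(1) unfolding block_ok_def by (auto simp: hc[symmetric])
  define e where "e q = (if q \<in> cells ns \<and> fst q = ?j then fst u ! (snd q - 1) else 0)" for q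
  have eo: "e q = 0" if "q \<notin> cells ns" for q using that by (simp add: e_def)
  have er: "block_row 3 ?j e = fst u"
  proof (rule nth_equalityI)
    fix k assume "k < length (block_row 3 ?j e)"
    then have k: "k < 3" by simp
    have "fst u ! k = 0" if "(?j, Suc k) \<notin> cells ns"
    proof -
      have "y (?j, Suc k) = 0" using H.bal_out[OF yb that] .
      moreover have "conf1 (fst u ! k) (block_row 3 ?j y ! k)" using u(2) k by (simp add: list_all2_conv_all_nth)
      ultimately show ?thesis using k by (auto simp: block_row_nth conf1_def)
    qed
    then show "block_row 3 ?j e ! k = fst u ! k" using k by (simp add: block_row_nth e_def)
  qed (simp add: ul)
  have eb: "H.bal ns e"
    unfolding H.bal_def
  proof (intro conjI allI impI)
    fix j
    show "(\<Sum>q\<in>H.blk ns j. int (snd q) * e q) = 0"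
    proof (cases "j = ?j")
      case True
      then show ?thesis using H.sum_blk_row[OF B eo, where F = int] er ul(1,2) degL_bcols[of "fst u" 3 int "\<lambda>_. 1"]
        unfolding hc by simp
    next
      case False
      then show ?thesis by (intro sum.neutral) (auto simp: e_def H.blk_def)
    qed
  qed (rule eo)
  have "conff e y"
    unfolding conff_def
  proof
    fix q
    show "conf1 (e q) (y q)"
    proof (cases "q \<in> H.blk ns ?j")
      case True
      then show ?thesis using H.lconf_row[OF B, of e y q] u(2) er by simp
    next
      case False
      then show ?thesis by (auto simp: e_def H.blk_def conf1_def)
    qed
  qed
  moreover have "e \<noteq> zerof"
  proof
    assume "e = zerof"
    then have "block_row 3 ?j e = replicate 3 0" by (simp add: block_row_def map_replicate_const)
    then show False using er ul(4) by auto
  qed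
  ultimately have ey: "e = y" using y eb unfolding H.minb_def by blast
  have "H.val ns e = (\<Sum>q\<in>H.blk ns ?j. 1 * e q)"
    unfolding H.val_def by (rule sum.mono_neutral_cong_right) (auto simp: finite_cells H.blk_def e_def)
  also have "\<dots> = snd u"
    using H.sum_blk_row[OF B eo, where F = "\<lambda>_. 1"] er ul(1,3) valL_bcols[of "fst u" 3 int "\<lambda>_. 1"] unfolding hc by simp
  finally have v: "H.val ns y = snd u" by (simp add: ey)
  have r: "y (?j, Suc k) = fst u ! k" if "k < 3" for k using er block_row_nth[OF that, of ?j e] ey by simp
  have "{q \<in> cells ns. y q \<noteq> 0} \<subseteq> {(?j, Suc i) | i. i < 3 \<and> fst u ! i \<noteq> 0}"
  proof
    fix q assume q: "q \<in> {q \<in> cells ns. y q \<noteq> 0}"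
    then have "q \<in> cells ns" "e q \<noteq> 0" using ey by simp_all
    then have "q \<in> H.blk ns ?j" by (auto simp: e_def H.blk_def split: if_splits)
    then obtain k where k: "q = (?j, k)" "1 \<le> k" "k \<le> 3" using B by auto
    then obtain k' where "k = Suc k'" by (cases k) auto
    then show "q \<in> {(?j, Suc i) | i. i < 3 \<and> fst u ! i \<noteq> 0}" using k q r[of k'] by auto
  qed
  with u(1) v r show ?thesis using that by blast
qed

lemma lt3: "i < (3::nat) \<longleftrightarrow> i = 0 \<or> i = 1 \<or> i = 2" by auto

text \<open>Among the units in three columns only \<open>[3, 0, -1]\<close> and its negative have a
  nonzero value other than 1 and -1.\<close>

lemma H_unit_val3:
  assumes y: "H.minb ns y" and n: "\<And>j a. y (j, a) \<noteq> 0 \<Longrightarrow> j < length ns \<Longrightarrow> ns ! j \<le> 3" and nz: "H.val ns y \<noteq> 0"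
  shows "\<bar>H.val ns y\<bar> \<le> int 2 \<and> (\<bar>H.val ns y\<bar> = 1 \<or> card {p \<in> cells ns. y p \<noteq> 0} \<le> 2)"
proof -
  have yb: "H.bal ns y" "y \<noteq> zerof" using y by (auto simp: H.minb_def)
  then obtain p where p: "y p \<noteq> 0" by fastforce
  then have "p \<in> cells ns" using H.bal_out[OF yb(1)] by blast
  then have "ns ! fst p \<le> 3" using n[of "fst p" "snd p"] p by (auto simp: mem_cells)
  then obtain u where u: "u \<in> set hunits" "H.val ns y = snd u"
    "{q \<in> cells ns. y q \<noteq> 0} \<subseteq> {(fst p, Suc i) | i. i < 3 \<and> fst u ! i \<noteq> 0}"
    by (rule H_unit[OF y p])
  show ?thesis
  proof (cases "\<bar>snd u\<bar> = 1")
    case True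
    then show ?thesis using u(2) by simp
  next
    case False
    then have "u = ([3, 0, - 1], 2) \<or> u = ([- 3, 0, 1], - 2)" using u(1,2) nz by (auto simp: hunits_def)
    then have "\<bar>H.val ns y\<bar> \<le> 2" "{q \<in> cells ns. y q \<noteq> 0} \<subseteq> {(fst p, 1), (fst p, 3)}"
      using u(2,3) by (auto simp: lt3 subset_iff)
    moreover from this have "card {q \<in> cells ns. y q \<noteq> 0} \<le> card {(fst p, 1), (fst p, 3::nat)}"
      by (intro card_mono) auto
    ultimately show ?thesis by simp
  qed
qed

text \<open>Two columns leave only \<open>[2, -1, 0]\<close> and its negative, and a single column
  has no nonzero balanced vector.\<close>

lemma H_unit_val2:
  assumes y: "H.minb ns y" and p: "y p \<noteq> 0" and n: "ns ! fst p \<le> 2"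
  shows "\<bar>H.val ns y\<bar> = 1" "1 < ns ! fst p"
proof -
  have n3: "ns ! fst p \<le> 3" using n by simp
  obtain u where u: "u \<in> set hunits" "H.val ns y = snd u" "\<forall>i<3. y (fst p, Suc i) = fst u ! i"
    "{q \<in> cells ns. y q \<noteq> 0} \<subseteq> {(fst p, Suc i) | i. i < 3 \<and> fst u ! i \<noteq> 0}"
    by (rule H_unit[OF y p n3])
  have yb: "H.bal ns y" using y by (simp add: H.minb_def)
  have "y (fst p, 3) = 0" by (rule H.bal_out[OF yb]) (use n in \<open>auto simp: mem_cells\<close>)
  then have "fst u ! 2 = 0" using u(3) by (simp add: numeral_3_eq_3 numeral_2_eq_2)
  then have uu: "u = ([2, - 1, 0], 1) \<or> u = ([- 2, 1, 0], - 1)" using u(1) by (auto simp: hunits_def)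
  then show "\<bar>H.val ns y\<bar> = 1" using u(2) by auto
  have "y (fst p, 2) \<noteq> 0" using u(3)[rule_format, of 1] uu by (auto simp: numeral_2_eq_2)
  then have "(fst p, 2) \<in> cells ns" using H.bal_out[OF yb] by blast
  then show "1 < ns ! fst p" by (simp add: mem_cells)
qed

lemma S_good_small: "ns ! j \<le> 2 \<or> length ns \<le> j \<Longrightarrow> S.goodf ns u j"
proof -
  assume "ns ! j \<le> 2 \<or> length ns \<le> j"
  then have "S.supp ns u j \<subseteq> {(j, 1), (j, 2)}" by (auto simp: S.supp_def S.blk_def mem_cells)
  then have "card (S.supp ns u j) \<le> card {(j, 1), (j, 2::nat)}" by (intro card_mono) auto
  then show ?thesis by (simp add: S.goodf_def)
qed

lemma H_good_small: "ns ! j \<le> 2 \<or> length ns \<le> j \<Longrightarrow> H.goodf ns u j"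
proof -
  assume "ns ! j \<le> 2 \<or> length ns \<le> j"
  then have "H.supp ns u j \<subseteq> {(j, 1), (j, 2)}" by (auto simp: H.supp_def H.blk_def mem_cells)
  then have "card (H.supp ns u j) \<le> card {(j, 1), (j, 2::nat)}" by (intro card_mono) auto
  then show ?thesis by (simp add: H.goodf_def)
qed

lemma bcols_S: "bcols (\<lambda>_. 1) int n = scols n" by (simp add: bcols_def scols_def)
lemma bcols_H: "bcols int (\<lambda>_. 1) n = hcols n" by (simp add: bcols_def hcols_def)

lemma core_S: "scheck n0 n1 m \<Longrightarrow> core (\<lambda>_. 1) int n0 n1 m"
  unfolding core_def bcols_S using scheck_sound by blast

lemma core_H: "hcheck \<Longrightarrow> core int (\<lambda>_. 1) 3 3 2"
  unfolding core_def bcols_H using hcheck_sound by blast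

lemma dot_length: "\<exists>w'. length w' = n \<and> (\<forall>x. length x = n \<longrightarrow> dot w x = dot w' x)"
  by (rule exI[of _ "map (\<lambda>k. if k < length w then w ! k else 0) [0..<n]"])
     (auto simp: dot_sum intro!: sum.cong)

lemma dot_append_zero: "\<forall>a\<in>set z. a = 0 \<Longrightarrow> dot w (y @ z) = dot w y"
proof (induction y arbitrary: w)
  case Nil
  then show ?case by (induction w z rule: dot.induct) auto
next
  case (Cons a y)
  then show ?case by (cases w) auto
qed

lemma length5: "length x = 5 \<longleftrightarrow> (\<exists>a b c d e. x = [a, b, c, d, e])"
  by (auto simp: numeral_eq_Suc length_Suc_conv)
lemma length6: "length x = 6 \<longleftrightarrow> (\<exists>a b c d e f. x = [a, b, c, d, e, f])"
  by (auto simp: numeral_eq_Suc length_Suc_conv)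
lemma length10: "length x = 10 \<longleftrightarrow> (\<exists>a b c d e f g h i j. x = [a, b, c, d, e, f, g, h, i, j])"
  by (auto simp: numeral_eq_Suc length_Suc_conv)

lemmas cols_eval = scols_def hcols_def zcols_def upt_rec numeral_eq_Suc

lemma scols_eval: "scols 6 = [(1, 1), (1, 2), (1, 3), (1, 4), (1, 5), (1, 6)]" "scols 4 = [(1, 1), (1, 2), (1, 3), (1, 4)]"
  "hcols 5 = [(1, 1), (2, 1), (3, 1), (4, 1), (5, 1)]" "hcols 6 = [(1, 1), (2, 1), (3, 1), (4, 1), (5, 1), (6, 1)]"
  "hcols 0 = []" "zcols 0 = []" "zcols 1 = [(0, 1)]" "zcols (Suc 0) = [(0, 1)]"
  by (simp_all add: cols_eval)

lemma conf1_0: "conf1 a 0 \<longleftrightarrow> a = 0" by (auto simp: conf1_def)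

text \<open>Blocks of two columns enter a primitive vector of the second family only through the sum \<open>t\<close> of their
  values, and \<open>t\<close> behaves like a further column at position \<open>0\<close> of the first block. So one block of five
  columns together with any number of blocks of two is governed by a block of six columns of the first family.\<close>

lemma core_H5:
  assumes "core (\<lambda>_. 1) int 6 4 1"
  shows "core int (\<lambda>_. 1) 5 0 1"
  unfolding core_def bcols_H
proof (intro allI impI)
  fix x0 x1 z
  assume prim: "prim2 [hcols 5, hcols 0, zcols 1] [x0, x1, z]"
  obtain a b c d e t where x: "x0 = [a, b, c, d, e]" "x1 = []" "z = [t]"
    and eq: "a + 2 * b + 3 * c + 4 * d + 5 * e = 0" "a + b + c + d + e + t = 0"
  proof -
    have "length x0 = 5" "length x1 = 0" "length z = 1" using prim by (simp_all add: prim2_def bal2_def scols_eval)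
    then obtain a b c d e t where x: "x0 = [a, b, c, d, e]" "x1 = []" "z = [t]"
      unfolding length5 by (auto simp: length_Suc_conv)
    have "degL (hcols 5) x0 = 0" "valL (hcols 5) x0 + (valL (hcols 0) x1 + valL (zcols 1) z) = 0"
      using prim by (simp_all add: prim2_def bal2_def)
    then have "a + 2 * b + 3 * c + 4 * d + 5 * e = 0" "a + b + c + d + e + t = 0"
      by (simp_all add: scols_eval x)
    then show ?thesis by (rule that[OF x])
  qed
  have "prim2 [scols 6, scols 4, zcols 1] [[t, a, b, c, d, e], [0, 0, 0, 0], [0]]"
    unfolding prim2_def
  proof (intro conjI allI impI)
    show "bal2 [scols 6, scols 4, zcols 1] [[t, a, b, c, d, e], [0, 0, 0, 0], [0]]"
      "val2 [scols 6, scols 4, zcols 1] [[t, a, b, c, d, e], [0, 0, 0, 0], [0]] = 0"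
      "\<not> null2 [[t, a, b, c, d, e], [0, 0, 0, 0], [0]]"
      using eq prim by (auto simp: prim2_def bal2_def scols_eval null2_def x)
    fix v assume v: "bal2 [scols 6, scols 4, zcols 1] v" "val2 [scols 6, scols 4, zcols 1] v = 0"
      "conf2 v [[t, a, b, c, d, e], [0, 0, 0, 0], [0]]"
    obtain t' a' b' c' d' e' where v': "v = [[t', a', b', c', d', e'], [0, 0, 0, 0], [0]]"
      "conf1 t' t" "conf1 a' a" "conf1 b' b" "conf1 c' c" "conf1 d' d" "conf1 e' e"
      using v(3) by (auto simp: list_all2_Cons2 conf1_0)
    have "t' + a' + b' + c' + d' + e' = 0" "t' + 2 * a' + 3 * b' + 4 * c' + 5 * d' + 6 * e' = 0"
      using v(1,2) by (auto simp: v'(1) bal2_def scols_eval)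
    then have "bal2 [hcols 5, hcols 0, zcols 1] [[a', b', c', d', e'], [], [t']]"
      "val2 [hcols 5, hcols 0, zcols 1] [[a', b', c', d', e'], [], [t']] = 0"
      by (auto simp: bal2_def scols_eval)
    moreover have "conf2 [[a', b', c', d', e'], [], [t']] [x0, x1, z]" using v'(2-) by (simp add: x)
    ultimately have "null2 [[a', b', c', d', e'], [], [t']] \<or> [[a', b', c', d', e'], [], [t']] = [x0, x1, z]"
      using prim unfolding prim2_def by blast
    then show "null2 v \<or> v = [[t, a, b, c, d, e], [0, 0, 0, 0], [0]]" by (auto simp: v'(1) x null2_def)
  qed
  then have disj: "good [t, a, b, c, d, e] \<or> separable (scols 6) (scols 4) (zcols 1) [t, a, b, c, d, e] [0, 0, 0, 0] [0]"
    using assms unfolding core_def bcols_S by blast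
  show "good x0 \<and> good x1 \<or> (good x0 \<or> good x1 \<or> lone z) \<and> separable (hcols 5) (hcols 0) (zcols 1) x0 x1 z"
  proof (cases "good [t, a, b, c, d, e]")
    case True
    then have "good x0" by (auto simp: good_def x split: if_splits)
    then show ?thesis by (simp add: x good_def)
  next
    case False
    then obtain w where w: "dot w [t, a, b, c, d, e, 0, 0, 0, 0] = 0"
      "\<And>y0 y1 z'. ladm y0 [t, a, b, c, d, e] \<Longrightarrow> ladm y1 [0, 0, 0, 0] \<Longrightarrow> lconf z' [0] \<Longrightarrow> degL (scols 6) y0 = 0 \<Longrightarrow>
        degL (scols 4) y1 = 0 \<Longrightarrow> valL (scols 6) y0 + valL (scols 4) y1 + valL (zcols 1) z' = 0 \<Longrightarrow>
        \<not> (lconf y0 [t, a, b, c, d, e] \<and> lconf y1 [0, 0, 0, 0]) \<Longrightarrow> 0 < dot w (y0 @ y1)"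
      using disj unfolding separable_def by auto
    obtain w' where w': "length w' = 10" "\<And>x. length x = 10 \<Longrightarrow> dot w x = dot w' x" using dot_length by blast
    obtain w0 w1 w2 w3 w4 w5 w6 w7 w8 w9 where ww: "w' = [w0, w1, w2, w3, w4, w5, w6, w7, w8, w9]"
      using w'(1) unfolding length10 by blast
    have "separable (hcols 5) (hcols 0) (zcols 1) x0 x1 z"
      unfolding separable_def
    \<comment> \<open>The entry \<open>t\<close> at position 0 is minus the sum of the other
      entries, so its weight \<open>w0\<close> is subtracted from their weights.\<close>
    proof (intro exI[of _ "[w1 - w0, w2 - w0, w3 - w0, w4 - w0, w5 - w0]"] conjI allI impI)
      have "w0 * t + w1 * a + w2 * b + w3 * c + w4 * d + w5 * e = 0"
        using w(1) w'(2)[of "[t, a, b, c, d, e, 0, 0, 0, 0]"] by (simp add: ww)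
      moreover have "t = - a - b - c - d - e" using eq(2) by simp
      ultimately show "dot [w1 - w0, w2 - w0, w3 - w0, w4 - w0, w5 - w0] (x0 @ x1) = 0"
        by (simp add: x algebra_simps)
      fix y0 y1 z'
      assume y: "ladm y0 x0" "ladm y1 x1" "lconf z' z" "degL (hcols 5) y0 = 0"
        "valL (hcols 5) y0 + valL (hcols 0) y1 + valL (zcols 1) z' = 0" "\<not> (lconf y0 x0 \<and> lconf y1 x1)"
      have "length y0 = 5" using list_all2_lengthD[OF y(1)[unfolded ladm_def]] by (simp add: x(1))
      then obtain a' b' c' d' e' where y0: "y0 = [a', b', c', d', e']" unfolding length5 by blast
      have y1: "y1 = []" using y(2) by (simp add: ladm_def x)
      obtain t' where z': "z' = [t']" "conf1 t' t" using y(3) by (auto simp: x list_all2_Cons2)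
      have e: "a' + 2 * b' + 3 * c' + 4 * d' + 5 * e' = 0" "a' + b' + c' + d' + e' + t' = 0"
        using y(4,5) by (auto simp: y0 y1 z' scols_eval)
      have "0 < dot w ([t', a', b', c', d', e'] @ [0, 0, 0, 0])"
      proof (rule w(2))
        show "ladm [t', a', b', c', d', e'] [t, a, b, c, d, e]"
        proof -
          have "(t = 0 \<longrightarrow> t' = 0) \<and> (0 < t \<longrightarrow> 0 \<le> t') \<and> (t < 0 \<longrightarrow> t \<le> t')"
            using z'(2) by (auto simp: conf1_def)
          moreover have "ladm [a', b', c', d', e'] [a, b, c, d, e]" using y(1) unfolding x(1) y0 .
          ultimately show ?thesis by (simp only: ladm_def list.rel_inject simp_thms)
        qed
        show "\<not> (lconf [t', a', b', c', d', e'] [t, a, b, c, d, e] \<and> lconf [0, 0, 0, 0] [0, 0, 0, 0])"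
          using y(6) by (auto simp: x y0 y1)
        show "ladm [0, 0, 0, 0] [0, 0, 0, 0]" by (simp add: ladm_def)
        show "lconf [0] [0]" by (simp add: conf1_def)
        show "degL (scols 6) [t', a', b', c', d', e'] = 0" "degL (scols 4) [0, 0, 0, 0] = 0"
          "valL (scols 6) [t', a', b', c', d', e'] + valL (scols 4) [0, 0, 0, 0] + valL (zcols 1) [0] = 0"
          using e by (simp_all add: scols_eval)
      qed
      then have "0 < w0 * t' + w1 * a' + w2 * b' + w3 * c' + w4 * d' + w5 * e'"
        using w'(2)[of "[t', a', b', c', d', e', 0, 0, 0, 0]"] by (simp add: ww)
      moreover have "t' = - a' - b' - c' - d' - e'" using e(2) by simp
      ultimately show "0 < dot [w1 - w0, w2 - w0, w3 - w0, w4 - w0, w5 - w0] (y0 @ y1)"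
        by (simp add: y0 y1 algebra_simps)
    qed
    then show ?thesis by (simp add: x good_def)
  qed
qed

text \<open>A single block of six columns has the same two rows in both families, with the roles of
  block row and common row exchanged. So it is the problem of the first family with zeros in the
  second and third blocks.\<close>

lemma core_H6:
  assumes "core (\<lambda>_. 1) int 6 4 1"
  shows "core int (\<lambda>_. 1) 6 0 0"
  unfolding core_def bcols_H
proof (intro allI impI)
  fix x0 x1 z
  assume prim: "prim2 [hcols 6, hcols 0, zcols 0] [x0, x1, z]"
  obtain t a b c d e where x: "x0 = [t, a, b, c, d, e]" "x1 = []" "z = []"
    and eq: "t + 2 * a + 3 * b + 4 * c + 5 * d + 6 * e = 0" "t + a + b + c + d + e = 0"
  proof -
    have "length x0 = 6" "length x1 = 0" "length z = 0" using prim by (simp_all add: prim2_def bal2_def scols_eval)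
    then obtain t a b c d e where "x0 = [t, a, b, c, d, e]" "x1 = []" "z = []"
      unfolding length6 by auto
    then show ?thesis using that prim by (simp add: prim2_def bal2_def scols_eval algebra_simps)
  qed
  have "prim2 [scols 6, scols 4, zcols 1] [x0, [0, 0, 0, 0], [0]]"
    unfolding prim2_def
  proof (intro conjI allI impI)
    show "bal2 [scols 6, scols 4, zcols 1] [x0, [0, 0, 0, 0], [0]]"
      "val2 [scols 6, scols 4, zcols 1] [x0, [0, 0, 0, 0], [0]] = 0"
      "\<not> null2 [x0, [0, 0, 0, 0], [0]]"
      using eq prim by (auto simp: prim2_def bal2_def scols_eval null2_def x)
    fix v assume v: "bal2 [scols 6, scols 4, zcols 1] v" "val2 [scols 6, scols 4, zcols 1] v = 0"
      "conf2 v [x0, [0, 0, 0, 0], [0]]"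
    obtain t' a' b' c' d' e' where v': "v = [[t', a', b', c', d', e'], [0, 0, 0, 0], [0]]"
      "lconf [t', a', b', c', d', e'] x0"
      using v(3) by (auto simp: list_all2_Cons2 conf1_0 x)
    have "t' + a' + b' + c' + d' + e' = 0" "t' + 2 * a' + 3 * b' + 4 * c' + 5 * d' + 6 * e' = 0"
      using v(1,2) by (auto simp: v'(1) bal2_def scols_eval)
    then have "bal2 [hcols 6, hcols 0, zcols 0] [[t', a', b', c', d', e'], [], []]"
      "val2 [hcols 6, hcols 0, zcols 0] [[t', a', b', c', d', e'], [], []] = 0"
      by (auto simp: bal2_def scols_eval)
    moreover have "conf2 [[t', a', b', c', d', e'], [], []] [x0, x1, z]" using v'(2) by (simp add: x)
    ultimately have "null2 [[t', a', b', c', d', e'], [], []] \<or> [[t', a', b', c', d', e'], [], []] = [x0, x1, z]"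
      using prim unfolding prim2_def by blast
    then show "null2 v \<or> v = [x0, [0, 0, 0, 0], [0]]" by (auto simp: v'(1) x null2_def)
  qed
  then have disj: "good x0 \<or> separable (scols 6) (scols 4) (zcols 1) x0 [0, 0, 0, 0] [0]"
    using assms unfolding core_def bcols_S by blast
  show "good x0 \<and> good x1 \<or> (good x0 \<or> good x1 \<or> lone z) \<and> separable (hcols 6) (hcols 0) (zcols 0) x0 x1 z"
  proof (cases "good x0")
    case True
    then show ?thesis by (simp add: x good_def)
  next
    case False
    then obtain w where w: "dot w (x0 @ [0, 0, 0, 0]) = 0"
      "\<And>y0 y1 z'. ladm y0 x0 \<Longrightarrow> ladm y1 [0, 0, 0, 0] \<Longrightarrow> lconf z' [0] \<Longrightarrow> degL (scols 6) y0 = 0 \<Longrightarrow>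
        degL (scols 4) y1 = 0 \<Longrightarrow> valL (scols 6) y0 + valL (scols 4) y1 + valL (zcols 1) z' = 0 \<Longrightarrow>
        \<not> (lconf y0 x0 \<and> lconf y1 [0, 0, 0, 0]) \<Longrightarrow> 0 < dot w (y0 @ y1)"
      using disj unfolding separable_def by auto
    have dz: "dot w (y @ [0, 0, 0, 0]) = dot w y" for y
      by (rule dot_append_zero) simp
    have "separable (hcols 6) (hcols 0) (zcols 0) x0 x1 z"
      unfolding separable_def
    proof (intro exI[of _ w] conjI allI impI)
      show "dot w (x0 @ x1) = 0" using w(1) dz by (simp add: x(2))
      fix y0 y1 z'
      assume y: "ladm y0 x0" "ladm y1 x1" "lconf z' z" "degL (hcols 6) y0 = 0"
        "valL (hcols 6) y0 + valL (hcols 0) y1 + valL (zcols 0) z' = 0" "\<not> (lconf y0 x0 \<and> lconf y1 x1)"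
      have "length y0 = 6" using list_all2_lengthD[OF y(1)[unfolded ladm_def]] by (simp add: x(1))
      then obtain t' a' b' c' d' e' where y0: "y0 = [t', a', b', c', d', e']" unfolding length6 by blast
      have y1: "y1 = []" using y(2) by (simp add: ladm_def x)
      have e: "t' + 2 * a' + 3 * b' + 4 * c' + 5 * d' + 6 * e' = 0" "t' + a' + b' + c' + d' + e' = 0"
        using y(4,5) by (auto simp: y0 y1 scols_eval)
      have "0 < dot w (y0 @ [0, 0, 0, 0])"
      proof (rule w(2))
        show "ladm y0 x0" by (rule y(1))
        show "ladm [0, 0, 0, 0] [0, 0, 0, 0]" by (simp add: ladm_def)
        show "lconf [0] [0]" by (simp add: conf1_def)
        show "degL (scols 6) y0 = 0" "degL (scols 4) [0, 0, 0, 0] = 0"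
          "valL (scols 6) y0 + valL (scols 4) [0, 0, 0, 0] + valL (zcols 1) [0] = 0"
          using e by (simp_all add: scols_eval y0)
        show "\<not> (lconf y0 x0 \<and> lconf [0, 0, 0, 0] [0, 0, 0, 0])"
          using y(6) by (simp add: x(2) y1)
      qed
      then show "0 < dot w (y0 @ y1)" using dz y1 by simp
    qed
    then show ?thesis by (simp add: x good_def)
  qed
qed

text \<open>Indices past the end count as empty blocks, so conditions on widths also express
  conditions on the number of blocks.\<close>

definition width :: "nat list \<Rightarrow> nat \<Rightarrow> nat" where
  "width ns j = (if j < length ns then ns ! j else 0)"

lemma width_mono: "sorted_wrt (\<ge>) ns \<Longrightarrow> i \<le> j \<Longrightarrow> width ns j \<le> width ns i"
  by (cases "i = j") (auto simp: width_def sorted_wrt_iff_nth_less)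

section \<open>From the block widths to the finite problems\<close>

lemma S_pair:
  assumes c: "core (\<lambda>_. 1) int n0 n1 m" and u: "S.primb ns u" and j: "j0 \<noteq> j1"
    and n: "width ns j0 \<le> n0" "width ns j1 \<le> n1" "\<And>j. j \<noteq> j0 \<Longrightarrow> j \<noteq> j1 \<Longrightarrow> width ns j \<le> Suc m"
    and good: "(\<forall>j. j \<noteq> j0 \<longrightarrow> j \<noteq> j1 \<longrightarrow> S.goodf ns u j) \<or> \<not> S.goodf ns u j0 \<and> \<not> S.goodf ns u j1"
  shows "S.edgeb ns u"
proof (rule S.merge_edge[OF u j S_blk S_blk _ c good])
  show "ns ! j0 \<le> n0" if "j0 < length ns" using n(1) that by (simp add: width_def)
  show "ns ! j1 \<le> n1" if "j1 < length ns" using n(2) that by (simp add: width_def)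
  fix y :: "nat \<times> nat \<Rightarrow> int" assume y: "S.minb ns y" "\<And>p. y p \<noteq> 0 \<Longrightarrow> fst p \<noteq> j0 \<and> fst p \<noteq> j1"
  have "ns ! j \<le> Suc m" if "y (j, a) \<noteq> 0" "j < length ns" for j a
    using n(3)[of j] y(2)[OF that(1)] that(2) by (simp add: width_def)
  then show "\<bar>S.val ns y\<bar> \<le> int m \<and> (\<bar>S.val ns y\<bar> = 1 \<or> card {p \<in> cells ns. y p \<noteq> 0} \<le> 2)"
    using S_unit_val[OF y(1)] by blast
qed

lemma S_small_block: "width ns j \<le> 2 \<Longrightarrow> S.goodf ns u j"
  by (rule S_good_small) (auto simp: width_def split: if_splits)

lemma H_small_block: "width ns j \<le> 2 \<Longrightarrow> H.goodf ns u j"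
  by (rule H_good_small) (auto simp: width_def split: if_splits)

text \<open>The assumptions exclude the widths (7), (6, 5) and (5, 4, 3), the block sizes of S(6),
  S(5,4) and S(4,3,2).\<close>

theorem S_edge:
  assumes c: "scheck 4 4 3" "scheck 3 3 5" "scheck 6 3 2" "scheck 6 4 1" "scheck 5 5 1"
    and ns: "sorted_wrt (\<ge>) ns" "width ns 0 \<le> 6" "width ns 0 \<le> 5 \<or> width ns 1 \<le> 4"
      "width ns 0 \<le> 4 \<or> width ns 1 \<le> 3 \<or> width ns 2 \<le> 2"
    and u: "S.primb ns u"
  shows "S.edgeb ns u"
proof -
  note mono = width_mono[OF ns(1)]
  consider "width ns 0 \<le> 4" | "\<not> width ns 0 \<le> 4" "width ns 1 \<le> 3"
    | "width ns 0 \<le> 6" "width ns 1 \<le> 4" "width ns 2 \<le> 2"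
    | "width ns 0 \<le> 5" "width ns 1 \<le> 5" "width ns 2 \<le> 2"
    using ns(2-4) mono[of 0 1] by linarith
  then show ?thesis
  proof cases
    case 1
    have w: "width ns j \<le> 4" for j using mono[of 0 j] 1 by simp
    \<comment> \<open>Two large blocks if there are two, otherwise the only large one, or any block,
      with an arbitrary partner.\<close>
    obtain j0 j1 where "j0 \<noteq> j1"
      "(\<forall>j. j \<noteq> j0 \<longrightarrow> j \<noteq> j1 \<longrightarrow> S.goodf ns u j) \<or> \<not> S.goodf ns u j0 \<and> \<not> S.goodf ns u j1"
      by (metis n_not_Suc_n)
    then show ?thesis using S_pair[OF core_S[OF c(1)] u] w by simp
  next
    case 2
    have w: "width ns j \<le> 3" if "j \<noteq> 0" for j using mono[of 1 j] 2(2) that by simp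
    have w6: "width ns j \<le> 6" for j using mono[of 0 j] ns(2) by simp
    show ?thesis
    proof (cases "\<exists>j0 j1. j0 \<noteq> j1 \<and> j0 \<noteq> 0 \<and> j1 \<noteq> 0 \<and> \<not> S.goodf ns u j0 \<and> \<not> S.goodf ns u j1")
      case True
      \<comment> \<open>With two large blocks besides block 0, these become the explicit ones, and
        block 0 with its up to six columns joins the rest; this accounts for the bound 5 on the
        values.\<close>
      then obtain j0 j1 where "j0 \<noteq> j1" "j0 \<noteq> 0" "j1 \<noteq> 0" "\<not> S.goodf ns u j0" "\<not> S.goodf ns u j1" by blast
      then show ?thesis using S_pair[OF core_S[OF c(2)] u, of j0 j1] w w6 by simp
    next
      case False
      then obtain j1 where "j1 \<noteq> 0" "\<forall>j. j \<noteq> 0 \<longrightarrow> j \<noteq> j1 \<longrightarrow> S.goodf ns u j" by (metis zero_neq_one)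
      then show ?thesis using S_pair[OF core_S[OF c(3)] u, of 0 j1] w ns(2) by simp
    qed
  next
    case 3
    have w: "width ns j \<le> 2" if "j \<noteq> 0" "j \<noteq> 1" for j using mono[of 2 j] 3(3) that by simp
    have "\<forall>j. j \<noteq> 0 \<longrightarrow> j \<noteq> 1 \<longrightarrow> S.goodf ns u j" using w S_small_block by blast
    then show ?thesis using S_pair[OF core_S[OF c(4)] u zero_neq_one] w 3 by (simp add: numeral_2_eq_2)
  next
    case 4
    have w: "width ns j \<le> 2" if "j \<noteq> 0" "j \<noteq> 1" for j using mono[of 2 j] 4(3) that by simp
    have "\<forall>j. j \<noteq> 0 \<longrightarrow> j \<noteq> 1 \<longrightarrow> S.goodf ns u j" using w S_small_block by blast
    then show ?thesis using S_pair[OF core_S[OF c(5)] u zero_neq_one] w 4 by (simp add: numeral_2_eq_2)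
  qed
qed

lemma H_pair:
  assumes c: "core int (\<lambda>_. 1) n0 n1 m" and u: "H.primb ns u" and j: "j0 \<noteq> j1"
    and n: "width ns j0 \<le> n0" "width ns j1 \<le> n1"
      "\<And>j. j \<noteq> j0 \<Longrightarrow> j \<noteq> j1 \<Longrightarrow> width ns j \<le> Suc m" "m \<le> 2"
    and good: "(\<forall>j. j \<noteq> j0 \<longrightarrow> j \<noteq> j1 \<longrightarrow> H.goodf ns u j) \<or> \<not> H.goodf ns u j0 \<and> \<not> H.goodf ns u j1"
  shows "H.edgeb ns u"
proof (rule H.merge_edge[OF u j H_blk H_blk _ c good])
  show "ns ! j0 \<le> n0" if "j0 < length ns" using n(1) that by (simp add: width_def)
  show "ns ! j1 \<le> n1" if "j1 < length ns" using n(2) that by (simp add: width_def)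
  fix y :: "nat \<times> nat \<Rightarrow> int"
  assume y: "H.minb ns y" "\<And>p. y p \<noteq> 0 \<Longrightarrow> fst p \<noteq> j0 \<and> fst p \<noteq> j1" "H.val ns y \<noteq> 0"
  have le: "ns ! j \<le> Suc m" if "y (j, a) \<noteq> 0" "j < length ns" for j a
    using n(3)[of j] y(2)[OF that(1)] that(2) by (simp add: width_def)
  have "ns ! j \<le> 3" if "y (j, a) \<noteq> 0" "j < length ns" for j a
    using le[OF that] n(4) by simp
  note v3 = H_unit_val3[OF y(1) this y(3)]
  show "\<bar>H.val ns y\<bar> \<le> int m \<and> (\<bar>H.val ns y\<bar> = 1 \<or> card {p \<in> cells ns. y p \<noteq> 0} \<le> 2)"
  \<comment> \<open>For smaller \<open>m\<close> the remaining blocks have at most two columns, so a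
    unit has value 1 or -1; it needs two columns, which gives \<open>1 \<le> m\<close>.\<close>
  proof (cases "m = 2")
    case True
    then show ?thesis using v3 by simp
  next
    case False
    have yb: "H.bal ns y" "y \<noteq> zerof" using y(1) by (auto simp: H.minb_def)
    then obtain p where p: "y p \<noteq> 0" by fastforce
    then have "p \<in> cells ns" using H.bal_out[OF yb(1)] by blast
    then have "ns ! fst p \<le> Suc m" using le[of "fst p" "snd p"] p by (simp add: mem_cells)
    moreover from this have "ns ! fst p \<le> 2" using False n(4) by linarith
    ultimately show ?thesis using H_unit_val2[OF y(1) p] by linarith
  qed
qed

text \<open>Unless all widths are at most 3, only block 0 can have more than two columns. It is then
  paired with the empty block at index \<open>length ns\<close>.\<close>

theorem H_edge:
  assumes c: "hcheck" "scheck 6 4 1"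
    and ns: "sorted_wrt (\<ge>) ns" "width ns 0 \<le> 6" "width ns 0 \<le> 5 \<or> width ns 1 \<le> 1"
      "width ns 0 \<le> 3 \<or> width ns 1 \<le> 2"
    and u: "H.primb ns u"
  shows "H.edgeb ns u"
proof -
  note mono = width_mono[OF ns(1)]
  consider "width ns 0 \<le> 3" | "0 < width ns 0" "width ns 0 \<le> 6" "width ns 1 \<le> 1"
    | "0 < width ns 0" "width ns 0 \<le> 5" "width ns 1 \<le> 2"
    using ns(2-4) by linarith
  then show ?thesis
  proof cases
    case 1
    have w: "width ns j \<le> 3" for j using mono[of 0 j] 1 by simp
    obtain j0 j1 where "j0 \<noteq> j1"
      "(\<forall>j. j \<noteq> j0 \<longrightarrow> j \<noteq> j1 \<longrightarrow> H.goodf ns u j) \<or> \<not> H.goodf ns u j0 \<and> \<not> H.goodf ns u j1"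
      by (metis n_not_Suc_n)
    then show ?thesis using H_pair[OF core_H[OF c(1)] u] w by simp
  next
    case 2
    have l: "0 \<noteq> length ns" "width ns (length ns) = 0" using 2(1) by (auto simp: width_def split: if_splits)
    have w: "width ns j \<le> 1" if "j \<noteq> 0" for j using mono[of 1 j] 2(3) that by simp
    have "H.goodf ns u j" if "j \<noteq> 0" for j by (rule H_small_block) (use w[OF that] in simp)
    then show ?thesis using H_pair[OF core_H6[OF core_S[OF c(2)]] u l(1)] l w 2 by simp
  next
    case 3
    have l: "0 \<noteq> length ns" "width ns (length ns) = 0" using 3(1) by (auto simp: width_def split: if_splits)
    have w: "width ns j \<le> 2" if "j \<noteq> 0" for j using mono[of 1 j] 3(3) that by simp
    have "H.goodf ns u j" if "j \<noteq> 0" for j by (rule H_small_block[OF w[OF that]])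
    then show ?thesis using H_pair[OF core_H5[OF core_S[OF c(2)]] u l(1)] l w 3 by (simp add: numeral_2_eq_2)
  qed
qed

section \<open>Matrices with block structure\<close>

text \<open>Extension of a list of entries by zero to all cells; this carries the minimal examples
  over to dominating matrices.\<close>

definition place :: "(nat \<times> nat) list \<Rightarrow> (nat \<Rightarrow> int) \<Rightarrow> nat \<times> nat \<Rightarrow> int" where
  "place D U p = (\<Sum>k<length D. if D ! k = p then U k else 0)"

lemma place_nth: "distinct D \<Longrightarrow> k < length D \<Longrightarrow> place D U (D ! k) = U k"
proof -
  assume D: "distinct D" "k < length D"
  have "place D U (D ! k) = (\<Sum>i<length D. if i = k then U i else 0)"
    unfolding place_def by (rule sum.cong) (use D in \<open>auto simp: nth_eq_iff_index_eq\<close>)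
  then show ?thesis using D(2) by simp
qed

lemma place_out: "p \<notin> set D \<Longrightarrow> place D U p = 0"
  unfolding place_def by (rule sum.neutral) auto

lemma place_eqI:
  assumes "distinct D" "\<And>k. k < length D \<Longrightarrow> U k = f (D ! k)" "\<And>p. p \<notin> set D \<Longrightarrow> f p = 0"
  shows "place D U = f"
proof
  fix p show "place D U p = f p"
  proof (cases "p \<in> set D")
    case True
    then obtain k where "k < length D" "p = D ! k" by (auto simp: in_set_conv_nth)
    then show ?thesis using assms(1,2) place_nth by simp
  next
    case False
    then show ?thesis using assms(3) place_out by simp
  qed
qed

lemma sum_place:
  assumes "finite C" "set D \<subseteq> C"
  shows "(\<Sum>p\<in>C. F p * place D U p) = (\<Sum>k<length D. F (D ! k) * U k)"
proof -
  have "(\<Sum>p\<in>C. F p * place D U p) = (\<Sum>p\<in>C. \<Sum>k<length D. if D ! k = p then F p * U k else 0)"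
    unfolding place_def sum_distrib_left by (intro sum.cong) auto
  also have "\<dots> = (\<Sum>k<length D. \<Sum>p\<in>C. if D ! k = p then F p * U k else 0)" by (rule sum.swap)
  also have "\<dots> = (\<Sum>k<length D. F (D ! k) * U k)"
  proof (rule sum.cong)
    fix k assume "k \<in> {..<length D}"
    then have "D ! k \<in> C" using assms(2) by auto
    then show "(\<Sum>p\<in>C. if D ! k = p then F p * U k else 0) = F (D ! k) * U k"
      using assms(1) by (simp add: sum.delta')
  qed simp
  finally show ?thesis .
qed

text \<open>An executable form of membership in the kernel. Only blocks occurring in
  \<open>D\<close> are tested, because the sums of the others are empty.\<close>

definition null_list :: "(nat \<Rightarrow> int) \<Rightarrow> (nat \<Rightarrow> int) \<Rightarrow> (nat \<times> nat) list \<Rightarrow> int list \<Rightarrow> bool" where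
  "null_list g h D U \<longleftrightarrow> (\<Sum>(p, a)\<leftarrow>zip D U. h (snd p) * a) = 0 \<and>
     (\<forall>j\<in>set (map fst D). (\<Sum>(p, a)\<leftarrow>zip D U. (if fst p = j then g (snd p) else 0) * a) = 0)"

lemma sum_list_zip:
  "length U = length D \<Longrightarrow> (\<Sum>(p, a)\<leftarrow>zip D U. F p * a) = (\<Sum>k<length D. F (D ! k) * U ! k)" for U :: "int list"
  by (simp add: sum_list_sum_nth atLeast0LessThan)

context blocks
begin

lemma sum_blk: "(\<Sum>p\<in>blk j. F p * f p) = (\<Sum>p\<in>C. (if fst p = j then F p else 0) * f p :: int)"
  by (rule sum.mono_neutral_cong_left) (use fin in \<open>auto simp: blk_def\<close>)

lemma null_list_iff:
  assumes D: "set D \<subseteq> C" and U: "length U = length D"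
  shows "null_list g h D U \<longleftrightarrow> bal (place D ((!) U)) \<and> val (place D ((!) U)) = 0"
proof -
  have "val (place D ((!) U)) = (\<Sum>(p, a)\<leftarrow>zip D U. h (snd p) * a)"
    unfolding val_def sum_place[OF fin D] sum_list_zip[OF U] ..
  moreover have row: "(\<Sum>p\<in>blk j. g (snd p) * place D ((!) U) p) =
      (\<Sum>(p, a)\<leftarrow>zip D U. (if fst p = j then g (snd p) else 0) * a)" for j
    unfolding sum_blk sum_place[OF fin D] sum_list_zip[OF U] ..
  moreover have "(\<Sum>(p, a)\<leftarrow>zip D U. (if fst p = j then g (snd p) else 0) * a) = 0" if "j \<notin> set (map fst D)" for j
    unfolding sum_list_zip[OF U] by (rule sum.neutral) (use that in auto)
  moreover have "place D ((!) U) p = 0" if "p \<notin> C" for p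
    by (rule place_out) (use D that in blast)
  ultimately show ?thesis unfolding null_list_def bal_def by metis
qed

end

section \<open>Certificates against membership in the universal Groebner basis\<close>

fun conf_lists :: "int list \<Rightarrow> int list list" where
  "conf_lists [] = [[]]"
| "conf_lists (a # as) = concat (map (\<lambda>b. map ((#) b) (conf_lists as)) (if 0 \<le> a then [0..a] else [a..0]))"

lemma conf_lists_complete: "lconf V U \<Longrightarrow> V \<in> set (conf_lists U)"
  by (induction rule: list_all2_induct) (auto simp: conf1_def)

text \<open>Primitivity of \<open>U\<close> is tested on the finitely many vectors conformal to it.
  Each \<open>W\<close> is the exponent vector of a fiber point, recognized by
  \<open>W - U^+\<close> lying in the kernel, and the last condition is the relation entry by
  entry.\<close>

definition relation_check ::
    "(nat \<Rightarrow> int) \<Rightarrow> (nat \<Rightarrow> int) \<Rightarrow> (nat \<times> nat) list \<Rightarrow> int list \<Rightarrow> int list list \<Rightarrow> nat \<Rightarrow> bool" where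
  "relation_check g h D U ws k \<longleftrightarrow> distinct D \<and> length U = length D \<and> list_ex (\<lambda>a. a \<noteq> 0) U \<and> null_list g h D U \<and>
     list_all (\<lambda>V. null_list g h D V \<longrightarrow> list_all (\<lambda>a. a = 0) V \<or> V = U) (conf_lists U) \<and>
     ws \<noteq> [] \<and> k \<le> length ws \<and>
     list_all (\<lambda>W. length W = length D \<and> list_all (\<lambda>a. 0 \<le> a) W \<and>
       null_list g h D (map2 (\<lambda>a b. a - max 0 b) W U) \<and> W \<noteq> map (max 0) U \<and> W \<noteq> map (\<lambda>a. max 0 (- a)) U) ws \<and>
     list_all (\<lambda>i. (\<Sum>W\<leftarrow>ws. W ! i) = int k * max 0 (U ! i) + int (length ws - k) * max 0 (- (U ! i))) [0..<length D]"

text \<open>\<open>P\<close> lists the cells in the order of the columns. The assumption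
  \<open>unit\<close> makes the matrix homogeneous: the entries of each column add up to 1 either in
  the common row alone or over the block rows.\<close>

locale block_mat = blocks C g h for C g h +
  fixes A :: "int mat" and P :: "(nat \<times> nat) list" and c :: nat
  assumes dist: "distinct P" and set_P: "set P = C" and dims: "dim_col A = length P" "dim_row A = Suc c"
    and C_sub: "p \<in> C \<Longrightarrow> fst p < c"
    and entry0: "k < length P \<Longrightarrow> A $$ (0, k) = h (snd (P ! k))"
    and entry: "k < length P \<Longrightarrow> r < c \<Longrightarrow> A $$ (Suc r, k) = (if fst (P ! k) = r then g (snd (P ! k)) else 0)"
    and unit: "(\<forall>i. h i = 1) \<or> (\<forall>i. g i = 1)"
begin

definition on_cells :: "int vec \<Rightarrow> nat \<times> nat \<Rightarrow> int" where "on_cells u = place P (\<lambda>k. u $ k)"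
definition to_vec :: "(nat \<times> nat \<Rightarrow> int) \<Rightarrow> int vec" where "to_vec f = vec (length P) (\<lambda>k. f (P ! k))"

lemma on_cells_nth: "k < length P \<Longrightarrow> on_cells u (P ! k) = u $ k"
  unfolding on_cells_def by (rule place_nth[OF dist])

lemma on_cells_out: "p \<notin> C \<Longrightarrow> on_cells u p = 0"
  unfolding on_cells_def by (rule place_out) (simp add: set_P)

lemma on_cells_to_vec: "(\<And>p. p \<notin> C \<Longrightarrow> f p = 0) \<Longrightarrow> on_cells (to_vec f) = f"
  unfolding on_cells_def by (rule place_eqI[OF dist]) (auto simp: to_vec_def set_P)

lemma to_vec_on_cells: "u \<in> carrier_vec (length P) \<Longrightarrow> to_vec (on_cells u) = u"
  by (rule eq_vecI) (auto simp: to_vec_def on_cells_nth)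

lemma to_vec_carrier: "to_vec f \<in> carrier_vec (dim_col A)" by (simp add: to_vec_def dims)

lemma sum_on_cells: "(\<Sum>p\<in>C. F p * on_cells u p) = (\<Sum>k<length P. F (P ! k) * u $ k)"
  unfolding on_cells_def by (rule sum_place[OF fin]) (simp add: set_P)

lemma row0: "(\<Sum>k<length P. A $$ (0, k) * u $ k) = val (on_cells u)"
  unfolding val_def sum_on_cells by (rule sum.cong) (auto simp: entry0)

lemma row_Suc: "r < c \<Longrightarrow> (\<Sum>k<length P. A $$ (Suc r, k) * u $ k) = (\<Sum>p\<in>blk r. g (snd p) * on_cells u p)"
  unfolding sum_blk sum_on_cells by (rule sum.cong) (auto simp: entry)

lemma mult_zero_iff:
  assumes u: "u \<in> carrier_vec (dim_col A)"
  shows "A *\<^sub>v u = 0\<^sub>v (dim_row A) \<longleftrightarrow> bal (on_cells u) \<and> val (on_cells u) = 0"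
proof -
  have "A *\<^sub>v u = 0\<^sub>v (dim_row A) \<longleftrightarrow> (\<forall>i<Suc c. (\<Sum>k<length P. A $$ (i, k) * u $ k) = 0)"
    unfolding vec_eq_iff using u dims
    by (auto simp: scalar_prod_def lessThan_atLeast0 intro!: sum.cong)
  also have "\<dots> \<longleftrightarrow> val (on_cells u) = 0 \<and> (\<forall>r<c. (\<Sum>p\<in>blk r. g (snd p) * on_cells u p) = 0)"
    unfolding All_less_Suc2 row0 using row_Suc by simp
  also have "(\<forall>r<c. (\<Sum>p\<in>blk r. g (snd p) * on_cells u p) = 0) \<longleftrightarrow> bal (on_cells u)"
  proof -
    have "(\<Sum>p\<in>blk r. g (snd p) * on_cells u p) = 0" if "\<not> r < c" for r
      by (rule sum.neutral) (use that C_sub in \<open>auto simp: blk_def\<close>)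
    then show ?thesis unfolding bal_def using on_cells_out by blast
  qed
  finally show ?thesis by blast
qed

sublocale toric A
proof
  fix u assume u: "u \<in> carrier_vec (dim_col A)" "A *\<^sub>v u = 0\<^sub>v (dim_row A)"
  then have b: "bal (on_cells u)" "val (on_cells u) = 0" using mult_zero_iff by blast+
  have tot: "(\<Sum>k<dim_col A. u $ k) = (\<Sum>p\<in>C. on_cells u p)" using sum_on_cells[of "\<lambda>_. 1"] by (simp add: dims)
  from unit show "(\<Sum>k<dim_col A. u $ k) = 0"
  proof
    assume "\<forall>i. h i = 1"
    then show ?thesis using b(2) tot by (simp add: val_def)
  next
    assume g: "\<forall>i. g i = 1"
    have "(\<Sum>p\<in>C. on_cells u p) = (\<Sum>r<c. \<Sum>p\<in>{p \<in> C. fst p = r}. on_cells u p)"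
      by (rule sum.group[symmetric]) (use fin C_sub in auto)
    also have "\<dots> = 0"
    proof (rule sum.neutral, rule ballI)
      fix r
      have "(\<Sum>p\<in>blk r. g (snd p) * on_cells u p) = 0" using b(1) by (simp add: bal_def)
      then show "(\<Sum>p\<in>{p \<in> C. fst p = r}. on_cells u p) = 0" using g by (simp add: blk_def)
    qed
    finally show ?thesis using tot by simp
  qed
qed

lemma ker_iff: "u \<in> ker \<longleftrightarrow> u \<in> carrier_vec (dim_col A) \<and> bal (on_cells u) \<and> val (on_cells u) = 0"
  unfolding ker_def using mult_zero_iff by blast

lemma to_vec_ker: "bal f \<Longrightarrow> val f = 0 \<Longrightarrow> to_vec f \<in> ker"
  unfolding ker_iff using on_cells_to_vec[of f] bal_out[of f] to_vec_carrier by simp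

lemma on_cells_zero: "on_cells (0\<^sub>v (dim_col A)) = zerof"
proof
  fix p show "on_cells (0\<^sub>v (dim_col A)) p = 0"
    unfolding on_cells_def place_def by (rule sum.neutral) (simp add: dims)
qed

lemma on_cells_inj: "u \<in> carrier_vec (dim_col A) \<Longrightarrow> v \<in> carrier_vec (dim_col A) \<Longrightarrow> on_cells u = on_cells v \<Longrightarrow> u = v"
  using to_vec_on_cells by (metis dims(1))

lemma conf_on_cells: "conf v u \<longleftrightarrow> conff (on_cells v) (on_cells u)"
proof
  assume c: "conf v u"
  show "conff (on_cells v) (on_cells u)"
    unfolding conff_def
  proof
    fix p show "conf1 (on_cells v p) (on_cells u p)"
    proof (cases "p \<in> C")
      case True
      then obtain k where "k < length P" "p = P ! k" using set_P by (metis in_set_conv_nth)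
      then show ?thesis using c on_cells_nth by (simp add: conf_def conf1_def dims)
    next
      case False
      then show ?thesis using on_cells_out by (simp add: conf1_def)
    qed
  qed
next
  assume c: "conff (on_cells v) (on_cells u)"
  have "conf1 (v $ k) (u $ k)" if "k < length P" for k
  proof -
    have "conf1 (on_cells v (P ! k)) (on_cells u (P ! k))" using c by (simp add: conff_def)
    then show ?thesis using that by (simp add: on_cells_nth)
  qed
  then show "conf v u" by (simp add: conf_def conf1_def dims)
qed

lemma prim_primb: "prim u \<Longrightarrow> primb (on_cells u)"
proof -
  assume u: "prim u"
  then have uk: "u \<in> carrier_vec (dim_col A)" "bal (on_cells u)" "val (on_cells u) = 0" "u \<noteq> 0\<^sub>v (dim_col A)"
    by (auto simp: prim_def ker_iff)
  have "on_cells u \<noteq> zerof" using on_cells_inj[OF uk(1) zero_carrier_vec] on_cells_zero uk(4) by metis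
  moreover have "v = zerof \<or> v = on_cells u" if v: "bal v" "val v = 0" "conff v (on_cells u)" for v
  proof -
    have fv: "on_cells (to_vec v) = v" by (rule on_cells_to_vec) (rule bal_out[OF v(1)])
    then have "conf (to_vec v) u" using conf_on_cells v(3) by simp
    then have "to_vec v = 0\<^sub>v (dim_col A) \<or> to_vec v = u" using u to_vec_ker[OF v(1,2)] unfolding prim_def by blast
    then show ?thesis using fv on_cells_zero by metis
  qed
  ultimately show ?thesis using uk by (auto simp: primb_def)
qed

lemma primb_prim: "primb f \<Longrightarrow> prim (to_vec f)"
proof -
  assume f: "primb f"
  then have fb: "bal f" "val f = 0" "f \<noteq> zerof" by (auto simp: primb_def)
  have ff: "on_cells (to_vec f) = f" by (rule on_cells_to_vec) (rule bal_out[OF fb(1)])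
  have "to_vec f \<noteq> 0\<^sub>v (dim_col A)" using ff fb(3) on_cells_zero by metis
  moreover have "v = 0\<^sub>v (dim_col A) \<or> v = to_vec f" if v: "v \<in> ker" "conf v (to_vec f)" for v
  proof -
    have vk: "v \<in> carrier_vec (dim_col A)" "bal (on_cells v)" "val (on_cells v) = 0" using v(1) ker_iff by auto
    have "conff (on_cells v) f" using v(2) conf_on_cells ff by simp
    then have "on_cells v = zerof \<or> on_cells v = f" using f vk unfolding primb_def by blast
    then show ?thesis using on_cells_inj[OF vk(1)] on_cells_zero ff to_vec_carrier zero_carrier_vec by metis
  qed
  ultimately show ?thesis using to_vec_ker[OF fb(1,2)] by (auto simp: prim_def)
qed

text \<open>The difference of a fiber point supported in \<open>u\<close> and \<open>u^-\<close> is
  admissible. If it were conformal to \<open>u\<close>, primitivity would make it 0 or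
  \<open>u\<close>, that is, the point would be \<open>u^-\<close> or \<open>u^+\<close>.\<close>

lemma prim_edge_in_ugb:
  assumes u: "prim u" and e: "edgeb (on_cells u)"
  shows "binom u \<in> (ugb A :: ('k::field) mpoly set) \<or> binom (- u) \<in> (ugb A :: 'k mpoly set)"
proof -
  have uk: "u \<in> ker" "u \<noteq> 0\<^sub>v n" using u by (auto simp: prim_def)
  then have uc: "u \<in> carrier_vec n" by (simp add: ker_def)
  obtain \<omega> where \<omega>: "(\<Sum>p\<in>C. \<omega> p * on_cells u p) = 0"
    "\<And>x. bal x \<Longrightarrow> val x = 0 \<Longrightarrow> admf x (on_cells u) \<Longrightarrow> \<not> conff x (on_cells u) \<Longrightarrow> 0 < (\<Sum>p\<in>C. \<omega> p * x p)"
    using e unfolding edgeb_def by blast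
  show ?thesis
  proof (rule edge_in_ugb[OF uk, of "\<lambda>k. \<omega> (P ! k)"])
    show "(\<Sum>k<n. \<omega> (P ! k) * u $ k) = 0" using \<omega>(1) by (simp add: sum_on_cells dims)
    fix w assume w: "w \<in> monoms n" "dg w = dg (neg_part u)" "\<And>k. k < n \<Longrightarrow> u $ k = 0 \<Longrightarrow> lk w k = 0"
      "w \<noteq> pos_part u" "w \<noteq> neg_part u"
    define x where "x = vec n (\<lambda>k. int (lk w k) - int (lk (neg_part u) k))"
    have xk: "x \<in> ker" using w(2) unfolding dg_eq_iff x_def .
    then have xb: "x \<in> carrier_vec n" "bal (on_cells x)" "val (on_cells x) = 0" by (auto simp: ker_iff)
    have xn: "x $ k = int (lk w k) - int (nat (- (u $ k)))" if "k < n" for k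
      using that uc by (simp add: x_def lookup_neg_part)
    have adm: "admf (on_cells x) (on_cells u)"
      unfolding admf_def
    proof
      fix p
      show "(on_cells u p = 0 \<longrightarrow> on_cells x p = 0) \<and> (0 < on_cells u p \<longrightarrow> 0 \<le> on_cells x p) \<and> (on_cells u p < 0 \<longrightarrow> on_cells u p \<le> on_cells x p)"
      proof (cases "p \<in> C")
        case True
        then obtain k where k: "k < length P" "p = P ! k" using set_P by (metis in_set_conv_nth)
        then have kn: "k < n" by (simp add: dims)
        have "(u $ k = 0 \<longrightarrow> x $ k = 0) \<and> (0 < u $ k \<longrightarrow> 0 \<le> x $ k) \<and> (u $ k < 0 \<longrightarrow> u $ k \<le> x $ k)"
          using w(3)[OF kn] by (auto simp: xn[OF kn])
        then show ?thesis using on_cells_nth k by simp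
      next
        case False
        then show ?thesis using on_cells_out by simp
      qed
    qed
    have "\<not> conff (on_cells x) (on_cells u)"
    proof
      assume "conff (on_cells x) (on_cells u)"
      then have "conf x u" by (simp add: conf_on_cells)
      then have "x = 0\<^sub>v n \<or> x = u" using u xk unfolding prim_def by blast
      then show False
      proof
        assume x0: "x = 0\<^sub>v n"
        have "w = neg_part u"
        proof (rule monom_eqI)
          fix k show "lk w k = lk (neg_part u) k"
          proof (cases "k < n")
            case True
            then have "int (lk w k) - int (nat (- (u $ k))) = 0" using x0 xn by simp
            then have "lk w k = nat (- (u $ k))" by linarith
            then show ?thesis using True uc by (simp add: lookup_neg_part)
          next
            case False
            then show ?thesis using w(1) neg_part_monoms[OF uc] by (simp add: monoms_iff)
          qed
        qed
        then show False using w(5) by simp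
      next
        assume xu: "x = u"
        have "w = pos_part u"
        proof (rule monom_eqI)
          fix k show "lk w k = lk (pos_part u) k"
          proof (cases "k < n")
            case True
            then have "u $ k = int (lk w k) - int (nat (- (u $ k)))" using xn xu by simp
            then have "lk w k = nat (u $ k)" by linarith
            then show ?thesis using True uc by (simp add: lookup_pos_part)
          next
            case False
            then show ?thesis using w(1) pos_part_monoms[OF uc] by (simp add: monoms_iff)
          qed
        qed
        then show False using w(4) by simp
      qed
    qed
    then have "0 < (\<Sum>p\<in>C. \<omega> p * on_cells x p)" by (rule \<omega>(2)[OF xb(2,3) adm])
    then have "0 < (\<Sum>k<n. \<omega> (P ! k) * x $ k)" by (simp add: sum_on_cells dims)
    also have "\<dots> = dotm (\<lambda>k. \<omega> (P ! k)) w - dotm (\<lambda>k. \<omega> (P ! k)) (neg_part u)"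
      unfolding dotm_def sum_subtractf[symmetric] by (rule sum.cong) (simp_all add: x_def right_diff_distrib)
    finally show "dotm (\<lambda>k. \<omega> (P ! k)) (neg_part u) < dotm (\<lambda>k. \<omega> (P ! k)) w" by simp
  qed
qed

theorem ugb_eq_graver:
  assumes "\<And>f. primb f \<Longrightarrow> edgeb f"
  shows "up_to_sign (ugb A :: ('k::field) mpoly set) = up_to_sign (graver A)"
  using ugb_neq_graver_iff prim_edge_in_ugb assms prim_primb by metis

text \<open>A vector conformal to the extension of \<open>U\<close> by zero vanishes outside
  \<open>D\<close>, so primitivity tested on \<open>D\<close> holds in the whole matrix. Fiber
  membership and the relation also survive the extension.\<close>

theorem ugb_neq_graver:
  assumes chk: "relation_check g h D U ws k" and D: "set D \<subseteq> C"
  shows "up_to_sign (ugb A :: ('k::field) mpoly set) \<noteq> up_to_sign (graver A)"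
proof -
  have dD: "distinct D" and len: "length U = length D" and nzU: "\<exists>a\<in>set U. a \<noteq> 0" and nullU: "null_list g h D U"
    and primU: "\<And>V. V \<in> set (conf_lists U) \<Longrightarrow> null_list g h D V \<Longrightarrow> (\<forall>a\<in>set V. a = 0) \<or> V = U"
    and ws: "ws \<noteq> []" "k \<le> length ws"
    and W: "\<And>W. W \<in> set ws \<Longrightarrow> length W = length D" "\<And>W a. W \<in> set ws \<Longrightarrow> a \<in> set W \<Longrightarrow> 0 \<le> a"
      "\<And>W. W \<in> set ws \<Longrightarrow> null_list g h D (map2 (\<lambda>a b. a - max 0 b) W U)"
      "\<And>W. W \<in> set ws \<Longrightarrow> W \<noteq> map (max 0) U" "\<And>W. W \<in> set ws \<Longrightarrow> W \<noteq> map (\<lambda>a. max 0 (- a)) U"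
    and rel: "\<And>i. i < length D \<Longrightarrow>
      (\<Sum>W\<leftarrow>ws. W ! i) = int k * max 0 (U ! i) + int (length ws - k) * max 0 (- (U ! i))"
    using chk unfolding relation_check_def list_all_iff list_ex_iff by auto
  let ?f = "\<lambda>V. place D ((!) V)"
  have fout: "?f V p = 0" if "p \<notin> C" for V p by (rule place_out) (use D that in blast)
  define u where "u = to_vec (?f U)"
  have fu: "on_cells u = ?f U" unfolding u_def by (rule on_cells_to_vec) (rule fout)
  have uc: "u \<in> carrier_vec n" unfolding u_def by (rule to_vec_carrier)
  have "primb (?f U)"
    unfolding primb_def
  proof (intro conjI allI impI)
    show "bal (?f U)" "val (?f U) = 0" using null_list_iff[OF D len] nullU by blast+
    obtain i where i: "i < length D" "U ! i \<noteq> 0" using nzU len by (metis in_set_conv_nth)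
    show "?f U \<noteq> zerof"
    proof
      assume "?f U = zerof"
      then have "?f U (D ! i) = 0" by (rule fun_cong)
      then show False using i place_nth[OF dD i(1)] by simp
    qed
    fix v assume v: "bal v" "val v = 0" "conff v (?f U)"
    define V where "V = map v D"
    have vV: "?f V = v"
    proof (rule place_eqI[OF dD])
      show "V ! i = v (D ! i)" if "i < length D" for i using that by (simp add: V_def)
      show "v p = 0" if "p \<notin> set D" for p using conff_zero[OF v(3)] place_out[OF that] by blast
    qed
    have lV: "length V = length D" by (simp add: V_def)
    have "lconf V U"
      unfolding list_all2_conv_all_nth
    proof (intro conjI allI impI)
      fix i assume "i < length V"
      then have i: "i < length D" by (simp add: V_def)
      have "conf1 (v (D ! i)) (?f U (D ! i))" using v(3) by (simp add: conff_def)
      then show "conf1 (V ! i) (U ! i)" using i place_nth[OF dD i] by (simp add: V_def)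
    qed (simp add: V_def len)
    then have "V \<in> set (conf_lists U)" by (rule conf_lists_complete)
    moreover have "null_list g h D V" using null_list_iff[OF D lV] v vV by simp
    ultimately have "(\<forall>a\<in>set V. a = 0) \<or> V = U" by (rule primU)
    then show "v = zerof \<or> v = ?f U"
    proof
      assume z: "\<forall>a\<in>set V. a = 0"
      have "?f V = zerof"
        by (rule place_eqI[OF dD]) (use z lV in auto)
      then show ?thesis using vV by simp
    next
      assume "V = U" then show ?thesis using vV by simp
    qed
  qed
  then have pu: "prim u" unfolding u_def by (rule primb_prim)
  have un: "u $ j = ?f U (P ! j)" if "j < n" for j using on_cells_nth[of j u] that by (simp add: fu dims)
  define pm where "pm V = pos_part (to_vec (?f V))" for V
  have pm: "lk (pm V) j = (if j < n then nat (?f V (P ! j)) else 0)" for V j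
    by (simp add: pm_def lookup_pos_part to_vec_def dims)
  have pm_at: "\<exists>j<n. \<forall>V. lk (pm V) j = nat (V ! i)" if i: "i < length D" for i
  proof -
    have "D ! i \<in> set P" using D i set_P by auto
    then obtain j where j: "j < length P" "P ! j = D ! i" by (metis in_set_conv_nth)
    then have "lk (pm V) j = nat (V ! i)" for V using place_nth[OF dD i] by (simp add: pm dims)
    then show ?thesis using j(1) dims(1) by metis
  qed
  let ?U = "map (max 0) U" and ?U' = "map (\<lambda>a. max 0 (- a)) U"
  have parts: "pos_part u = pm ?U" "neg_part u = pm ?U'"
  proof -
    have "nat (?f U p) = nat (?f ?U p) \<and> nat (- ?f U p) = nat (?f ?U' p)" for p
    proof (cases "p \<in> set D")
      case True
      then obtain i where i: "i < length D" "p = D ! i" by (auto simp: in_set_conv_nth)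
      then show ?thesis using place_nth[OF dD i(1)] len by (simp add: max_def)
    next
      case False
      then show ?thesis by (simp add: place_out)
    qed
    note e = this
    show "pos_part u = pm ?U"
      by (rule monom_eqI) (use uc un e in \<open>simp add: lookup_pos_part pm\<close>)
    show "neg_part u = pm ?U'"
      by (rule monom_eqI) (use uc un e in \<open>simp add: lookup_neg_part pm\<close>)
  qed
  have dg: "dg (pm W') = dg (pos_part u)" if w: "W' \<in> set ws" for W'
    unfolding dg_eq_iff
  proof -
    let ?V = "map2 (\<lambda>a b. a - max 0 b) W' U"
    have lV: "length ?V = length D" using W(1)[OF w] len by simp
    have "to_vec (?f ?V) \<in> ker" by (rule to_vec_ker) (use null_list_iff[OF D lV] W(3)[OF w] in blast)+
    also have "to_vec (?f ?V) = vec n (\<lambda>j. int (lk (pm W') j) - int (lk (pos_part u) j))"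
    proof (rule eq_vecI)
      fix j assume "j < dim_vec (vec n (\<lambda>j. int (lk (pm W') j) - int (lk (pos_part u) j)))"
      then have j: "j < n" by simp
      have "?f ?V p = int (nat (?f W' p)) - int (nat (?f ?U p))" for p
      proof (cases "p \<in> set D")
        case True
        then obtain i where i: "i < length D" "p = D ! i" by (auto simp: in_set_conv_nth)
        have "0 \<le> W' ! i" using W(1,2)[OF w] i(1) by simp
        then show ?thesis using place_nth[OF dD i(1)] len i W(1)[OF w] by simp
      next
        case False
        then show ?thesis by (simp add: place_out)
      qed
      then show "to_vec (?f ?V) $ j = vec n (\<lambda>j. int (lk (pm W') j) - int (lk (pos_part u) j)) $ j"
        using j by (simp add: parts(1) pm to_vec_def dims)
    qed (simp add: to_vec_def dims)
    finally show "vec n (\<lambda>j. int (lk (pm W') j) - int (lk (pos_part u) j)) \<in> ker" .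
  qed
  have pm_inj: "V = V'" if v: "pm V = pm V'" "length V = length D" "length V' = length D"
    "\<And>a. a \<in> set V \<Longrightarrow> 0 \<le> a" "\<And>a. a \<in> set V' \<Longrightarrow> 0 \<le> a" for V V'
  proof (rule nth_equalityI)
    fix i assume i: "i < length V"
    obtain j where j: "\<And>V. lk (pm V) j = nat (V ! i)" using pm_at[of i] i v(2) by auto
    have "nat (V ! i) = nat (V' ! i)" using v(1) by (simp flip: j)
    moreover have "0 \<le> V ! i" by (rule v(4)) (use i in simp)
    moreover have "0 \<le> V' ! i" by (rule v(5)) (use i v(2,3) in simp)
    ultimately show "V ! i = V' ! i" by simp
  qed (simp add: v)
  let ?ws = "map pm ws"
  have sm: "w \<in> monoms n \<and> dg w = dg (pos_part u) \<and> w \<noteq> pos_part u \<and> w \<noteq> neg_part u" if wm: "w \<in> set ?ws" for w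
  proof -
    obtain W' where w: "W' \<in> set ws" "w = pm W'" using wm by auto
    have "W' = ?U" if e: "pm W' = pm ?U"
      by (rule pm_inj[OF e]) (use W(1,2)[OF w(1)] len in auto)
    then have "pm W' \<noteq> pm ?U" using W(4)[OF w(1)] by blast
    moreover have "W' = ?U'" if e: "pm W' = pm ?U'"
      by (rule pm_inj[OF e]) (use W(1,2)[OF w(1)] len in auto)
    then have "pm W' \<noteq> pm ?U'" using W(5)[OF w(1)] by blast
    moreover have "pm W' \<in> monoms n" unfolding pm_def by (rule pos_part_monoms) (rule to_vec_carrier)
    ultimately show ?thesis using dg[OF w(1)] w(2) parts by simp
  qed
  have r: "sum_list ?ws = nsum k (pos_part u) + nsum (length ws - k) (neg_part u)"
  proof (rule monom_eqI)
    fix j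
    have eq: "lk (sum_list ?ws) j = (\<Sum>W\<leftarrow>ws. lk (pm W) j)"
      by (simp add: lookup_sum_list o_def)
    have "(\<Sum>W\<leftarrow>ws. lk (pm W) j) = k * lk (pm ?U) j + (length ws - k) * lk (pm ?U') j"
    proof (cases "j < n \<and> P ! j \<in> set D")
      case True
      then obtain i where i: "i < length D" "P ! j = D ! i" by (metis in_set_conv_nth)
      have l: "lk (pm V) j = nat (V ! i)" for V using True i place_nth[OF dD i(1)] by (simp add: pm)
      have "int (\<Sum>W\<leftarrow>vs. nat (W ! i)) = (\<Sum>W\<leftarrow>vs. W ! i)" if "set vs \<subseteq> set ws" for vs
        using that
      proof (induction vs)
        case (Cons v vs)
        then have "0 \<le> v ! i" using W(1,2)[of v] i(1) by simp
        then show ?case using Cons by simp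
      qed simp
      then have "int (\<Sum>W\<leftarrow>ws. nat (W ! i)) = int (k * nat (?U ! i) + (length ws - k) * nat (?U' ! i))"
        using rel[OF i(1)] i(1) len by simp
      then show ?thesis unfolding l by (rule int_int_eq[THEN iffD1])
    next
      case False
      then have "lk (pm V) j = 0" for V by (auto simp: pm place_out)
      then show ?thesis by simp
    qed
    then show "lk (sum_list ?ws) j = lk (nsum k (pos_part u) + nsum (length ws - k) (neg_part u)) j"
      unfolding eq by (simp add: parts lookup_add lookup_nsum)
  qed
  have u0: "u \<noteq> 0\<^sub>v n" "u \<in> ker" using pu by (auto simp: prim_def)
  have 1: "binom u \<notin> (ugb A :: 'k mpoly set)"
  proof (rule relation_not_in_ugb[where ws = ?ws and k = k])
    show "sum_list ?ws = nsum k (pos_part u) + nsum (length ?ws - k) (neg_part u)" using r by simp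
  qed (use uc u0(1) sm ws in simp_all)
  have "binom (- u) \<notin> (ugb A :: 'k mpoly set)"
  proof (rule relation_not_in_ugb[where ws = ?ws and k = "length ws - k"])
    show "- u \<in> carrier_vec n" using uc by simp
    show "- u \<noteq> 0\<^sub>v n" using u0(1) uc by (metis uminus_uminus_vec uminus_zero_vec)
    show "w \<in> monoms n \<and> dg w = dg (pos_part (- u)) \<and> w \<noteq> pos_part (- u) \<and> w \<noteq> neg_part (- u)" if "w \<in> set ?ws" for w
      using sm[OF that] dg_parts[OF u0(2)] by simp
    show "?ws \<noteq> []" using ws(1) by simp
    show "length ws - k \<le> length ?ws" by simp
    show "sum_list ?ws = nsum (length ws - k) (pos_part (- u)) + nsum (length ?ws - (length ws - k)) (neg_part (- u))"
      using r ws(2) by (simp add: add.commute)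
  qed
  then show ?thesis using ugb_neq_graver_iff pu 1 by blast
qed

end

section \<open>The matrices of the two families as block matrices\<close>

definition pairs :: "nat list \<Rightarrow> (nat \<times> nat) list" where
  "pairs ns = [(j, i). j \<leftarrow> [0..<length ns], i \<leftarrow> [1..<ns ! j + 1]]"

lemma set_pairs: "set (pairs ns) = cells ns"
  by (auto simp: pairs_def cells_def image_iff less_Suc_eq_le simp del: upt_Suc)

lemma distinct_prod_list: "(\<And>j. distinct (F j)) \<Longrightarrow> distinct [(j, i). j \<leftarrow> [0..<c], i \<leftarrow> F j]"
  by (induction c) (auto simp: distinct_map inj_on_def)

lemma distinct_pairs: "distinct (pairs ns)"
  unfolding pairs_def by (rule distinct_prod_list) simp

text \<open>The argument \<open>n_j - 1\<close> yields the half-open range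
  \<open>[1..<n_j + 1]\<close> of positions. Since subtraction on naturals is truncated, this relies
  on \<open>n_j \<ge> 1\<close>.\<close>

lemma S_mat_cols:
  assumes "\<forall>m\<in>set ns. m \<ge> 1"
  shows "S_mat (map (\<lambda>m. m - 1) ns) = mat_of_cols (length ns + 1)
    (map (\<lambda>(j, i). vCons (int i) (unit_vec (length ns) j)) (pairs ns))"
proof -
  have "(map (\<lambda>m. m - 1) ns) ! j + 2 = ns ! j + 1" if "j < length ns" for j
  proof -
    have "ns ! j \<ge> 1" using assms that by simp
    then show ?thesis using that by simp
  qed
  then have "[vCons (int i) (unit_vec (length ns) j). j \<leftarrow> [0..<length ns], i \<leftarrow> [1..<map (\<lambda>m. m - 1) ns ! j + 2]] =
      [vCons (int i) (unit_vec (length ns) j). j \<leftarrow> [0..<length ns], i \<leftarrow> [1..<ns ! j + 1]]"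
    by (intro arg_cong[where f = concat] map_cong refl) simp
  then show ?thesis by (simp add: S_mat_def pairs_def Let_def map_concat o_def del: upt_Suc)
qed

lemma H_mat_cols: "H_mat ns = mat_of_cols (length ns + 1)
    (map (\<lambda>(j, i). vCons 1 (int i \<cdot>\<^sub>v unit_vec (length ns) j)) (pairs ns))"
  by (simp add: H_mat_def pairs_def Let_def map_concat o_def del: upt_Suc)

lemma pairs_nth: "k < length (pairs ns) \<Longrightarrow> fst (pairs ns ! k) < length ns"
proof -
  assume "k < length (pairs ns)"
  then have "pairs ns ! k \<in> cells ns" using set_pairs nth_mem by metis
  then show ?thesis by (simp add: mem_cells)
qed

lemma S_block_mat:
  assumes "\<forall>m\<in>set ns. m \<ge> 1"
  shows "block_mat (cells ns) (\<lambda>_. 1) int (S_mat (map (\<lambda>m. m - 1) ns)) (pairs ns) (length ns)"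
proof unfold_locales
  let ?A = "S_mat (map (\<lambda>m. m - 1) ns)"
  show "distinct (pairs ns)" by (rule distinct_pairs)
  show "set (pairs ns) = cells ns" by (rule set_pairs)
  show "dim_col ?A = length (pairs ns)" "dim_row ?A = Suc (length ns)"
    unfolding S_mat_cols[OF assms] by simp_all
  show "fst p < length ns" if "p \<in> cells ns" for p using that by (simp add: mem_cells)
  fix k assume k: "k < length (pairs ns)"
  obtain j i where ji: "pairs ns ! k = (j, i)" by (cases "pairs ns ! k")
  then have j: "j < length ns" using pairs_nth[OF k] by simp
  have col: "?A $$ (r, k) = vCons (int i) (unit_vec (length ns) j) $ r" if "r < Suc (length ns)" for r
    unfolding S_mat_cols[OF assms] using that k ji by (simp add: mat_of_cols_index)
  show "?A $$ (0, k) = int (snd (pairs ns ! k))" using col[of 0] ji by simp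
  show "?A $$ (Suc r, k) = (if fst (pairs ns ! k) = r then 1 else 0)" if "r < length ns" for r
    using col[of "Suc r"] ji that j by simp
qed simp

lemma H_block_mat: "block_mat (cells ns) int (\<lambda>_. 1) (H_mat ns) (pairs ns) (length ns)"
proof unfold_locales
  let ?A = "H_mat ns"
  show "distinct (pairs ns)" by (rule distinct_pairs)
  show "set (pairs ns) = cells ns" by (rule set_pairs)
  show "dim_col ?A = length (pairs ns)" "dim_row ?A = Suc (length ns)"
    unfolding H_mat_cols by simp_all
  show "fst p < length ns" if "p \<in> cells ns" for p using that by (simp add: mem_cells)
  fix k assume k: "k < length (pairs ns)"
  obtain j i where ji: "pairs ns ! k = (j, i)" by (cases "pairs ns ! k")
  then have j: "j < length ns" using pairs_nth[OF k] by simp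
  have col: "?A $$ (r, k) = vCons 1 (int i \<cdot>\<^sub>v unit_vec (length ns) j) $ r" if "r < Suc (length ns)" for r
    unfolding H_mat_cols using that k ji by (simp add: mat_of_cols_index)
  show "?A $$ (0, k) = 1" using col[of 0] by simp
  show "?A $$ (Suc r, k) = (if fst (pairs ns ! k) = r then int (snd (pairs ns ! k)) else 0)" if "r < length ns" for r
    using col[of "Suc r"] ji that j by simp
qed simp

section \<open>Explicit relations for the six minimal matrices\<close>

definition block_cells :: "nat list \<Rightarrow> (nat \<times> nat) list" where
  "block_cells bs = concat (map (\<lambda>(j, b). map (Pair j) [1..<b + 1]) (enumerate 0 bs))"

lemma block_cells_sub: "(\<And>j. j < length bs \<Longrightarrow> bs ! j \<le> width ns j) \<Longrightarrow> set (block_cells bs) \<subseteq> cells ns"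
  by (fastforce simp: block_cells_def in_set_enumerate_eq mem_cells width_def split: if_splits simp del: upt_Suc)

text \<open>Here \<open>u\<close> is x3 x4 x6 - x1 x5 x7, and the product of the fiber elements x4^2
  x5, x3^2 x7 and x1 x6^2 is (x3 x4 x6)^2 x1 x5 x7.\<close>

lemma S6_relation: "relation_check (\<lambda>_. 1) int (block_cells [7]) [-1, 0, 1, 1, -1, 1, -1]
    [[0, 0, 0, 2, 1, 0, 0], [0, 0, 2, 0, 0, 0, 1], [1, 0, 0, 0, 0, 2, 0]] 2"
  by code_simp

text \<open>With \<open>k = 0\<close> the relation says that \<open>u^-\<close> = x1 x5 y1 y5 is the
  midpoint of x5^2 y1^2 and x1^2 y5^2, so it is not even a vertex of the hull of its fiber.\<close>

lemma S54_relation: "relation_check (\<lambda>_. 1) int (block_cells [6, 5]) [-1, 1, 0, 0, -1, 1, -1, 2, 0, 0, -1]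
    [[0, 0, 0, 0, 2, 0, 2, 0, 0, 0, 0], [2, 0, 0, 0, 0, 0, 0, 0, 0, 0, 2]] 0"
  by code_simp

text \<open>The midpoint of \<open>u^+\<close> = x5 y1 y3 z1 and \<open>u^-\<close> = x1 y2 y4 z3 is
  the average of four points, each of which squares one variable of the middle block.\<close>

lemma S432_relation: "relation_check (\<lambda>_. 1) int (block_cells [5, 4, 3]) [-1, 0, 0, 0, 1, 1, -1, 1, -1, 1, 0, -1]
    [[1, 0, 0, 0, 0, 0, 0, 0, 2, 1, 0, 0], [1, 0, 0, 0, 0, 0, 0, 2, 0, 0, 0, 1],
     [0, 0, 0, 0, 1, 0, 2, 0, 0, 1, 0, 0], [0, 0, 0, 0, 1, 2, 0, 0, 0, 0, 0, 1]] 2"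
  by code_simp

text \<open>A single block has the same two rows in both families, so the certificate of S(6) serves
  again.\<close>

lemma H7_relation: "relation_check int (\<lambda>_. 1) (block_cells [7]) [-1, 0, 1, 1, -1, 1, -1]
    [[0, 0, 0, 2, 1, 0, 0], [0, 0, 2, 0, 0, 0, 1], [1, 0, 0, 0, 0, 2, 0]] 2"
  by code_simp

text \<open>The product of x5^2 y1^2, x3^2 x4 y2 and x2^2 x6 y2 is the square of x2 x3 x5 y2 times
  x4 x6 y1^2.\<close>

lemma H62_relation: "relation_check int (\<lambda>_. 1) (block_cells [6, 2]) [0, 1, 1, -1, 1, -1, -2, 1]
    [[0, 0, 0, 0, 2, 0, 2, 0], [0, 0, 2, 1, 0, 0, 0, 1], [0, 2, 0, 0, 0, 1, 0, 1]] 2"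
  by code_simp

text \<open>Again \<open>u^-\<close> = x1 x2^2 x3 y3 is a midpoint, namely of x2^4 y3 and x1^2 x3^2
  y3.\<close>

lemma H43_relation: "relation_check int (\<lambda>_. 1) (block_cells [4, 3]) [-1, -2, -1, 2, 3, 0, -1]
    [[0, 4, 0, 0, 0, 0, 1], [2, 0, 2, 0, 0, 0, 1]] 0"
  by code_simp

section \<open>The classification in terms of block widths\<close>

lemma ugb_S_eq:
  assumes c: "scheck 4 4 3" "scheck 3 3 5" "scheck 6 3 2" "scheck 6 4 1" "scheck 5 5 1"
    and ns: "sorted_wrt (\<ge>) ns" "\<forall>m\<in>set ns. m \<ge> 1"
  shows "up_to_sign (ugb (S_mat (map (\<lambda>m. m - 1) ns)) :: ('k::field) mpoly set)
      = up_to_sign (graver (S_mat (map (\<lambda>m. m - 1) ns))) \<longleftrightarrow>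
    width ns 0 \<le> 6 \<and> (width ns 0 \<le> 5 \<or> width ns 1 \<le> 4) \<and> (width ns 0 \<le> 4 \<or> width ns 1 \<le> 3 \<or> width ns 2 \<le> 2)"
proof -
  interpret block_mat "cells ns" "\<lambda>_. 1" int "S_mat (map (\<lambda>m. m - 1) ns)" "pairs ns" "length ns"
    by (rule S_block_mat[OF ns(2)])
  note w = block_cells_sub
  show ?thesis
  proof (cases "width ns 0 \<le> 6 \<and> (width ns 0 \<le> 5 \<or> width ns 1 \<le> 4) \<and> (width ns 0 \<le> 4 \<or> width ns 1 \<le> 3 \<or> width ns 2 \<le> 2)")
    case True
    then show ?thesis using ugb_eq_graver S_edge[OF c ns(1)] by blast
  next
    case False
    then consider "7 \<le> width ns 0" | "6 \<le> width ns 0" "5 \<le> width ns 1"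
      | "5 \<le> width ns 0" "4 \<le> width ns 1" "3 \<le> width ns 2" by linarith
    then have "up_to_sign (ugb (S_mat (map (\<lambda>m. m - 1) ns)) :: 'k mpoly set) \<noteq>
        up_to_sign (graver (S_mat (map (\<lambda>m. m - 1) ns)))"
    proof cases
      case 1
      then show ?thesis by (intro ugb_neq_graver[OF S6_relation] block_cells_sub) (simp add: less_Suc_eq)
    next
      case 2
      then show ?thesis by (intro ugb_neq_graver[OF S54_relation] block_cells_sub) (auto simp: less_Suc_eq)
    next
      case 3
      then show ?thesis by (intro ugb_neq_graver[OF S432_relation] block_cells_sub) (auto simp: less_Suc_eq numeral_2_eq_2)
    qed
    then show ?thesis using False by blast
  qed
qed

lemma ugb_H_eq:
  assumes c: "hcheck" "scheck 6 4 1" and ns: "sorted_wrt (\<ge>) ns"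
  shows "up_to_sign (ugb (H_mat ns) :: ('k::field) mpoly set) = up_to_sign (graver (H_mat ns)) \<longleftrightarrow>
    width ns 0 \<le> 6 \<and> (width ns 0 \<le> 5 \<or> width ns 1 \<le> 1) \<and> (width ns 0 \<le> 3 \<or> width ns 1 \<le> 2)"
proof -
  interpret block_mat "cells ns" int "\<lambda>_. 1" "H_mat ns" "pairs ns" "length ns"
    by (rule H_block_mat)
  show ?thesis
  proof (cases "width ns 0 \<le> 6 \<and> (width ns 0 \<le> 5 \<or> width ns 1 \<le> 1) \<and> (width ns 0 \<le> 3 \<or> width ns 1 \<le> 2)")
    case True
    then show ?thesis using ugb_eq_graver H_edge[OF c ns] by blast
  next
    case False
    then consider "7 \<le> width ns 0" | "6 \<le> width ns 0" "2 \<le> width ns 1"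
      | "4 \<le> width ns 0" "3 \<le> width ns 1" by linarith
    then have "up_to_sign (ugb (H_mat ns) :: 'k mpoly set) \<noteq> up_to_sign (graver (H_mat ns))"
    proof cases
      case 1
      then show ?thesis by (intro ugb_neq_graver[OF H7_relation] block_cells_sub) (simp add: less_Suc_eq)
    next
      case 2
      then show ?thesis by (intro ugb_neq_graver[OF H62_relation] block_cells_sub) (auto simp: less_Suc_eq)
    next
      case 3
      then show ?thesis by (intro ugb_neq_graver[OF H43_relation] block_cells_sub) (auto simp: less_Suc_eq)
    qed
    then show ?thesis using False by blast
  qed
qed

text \<open>Since \<open>width\<close> is 0 past the end, a positive lower bound on it includes the
  condition on the length of the list.\<close>

lemma dominates_width:
  "0 < a \<Longrightarrow> dominates ns [a] \<longleftrightarrow> a \<le> width ns 0"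
  "0 < a \<Longrightarrow> 0 < b \<Longrightarrow> dominates ns [a, b] \<longleftrightarrow> a \<le> width ns 0 \<and> b \<le> width ns 1"
  "0 < a \<Longrightarrow> 0 < b \<Longrightarrow> 0 < d \<Longrightarrow> dominates ns [a, b, d] \<longleftrightarrow> a \<le> width ns 0 \<and> b \<le> width ns 1 \<and> d \<le> width ns 2"
  by (auto simp: dominates_def width_def All_less_Suc2 numeral_2_eq_2 Suc_le_eq split: if_splits)

lemma width_map: "width (map (\<lambda>m. m - Suc 0) ns) j = width ns j - Suc 0"
  by (simp add: width_def)

section \<open>The finite computations\<close>

lemma scheck_443: "scheck 4 4 3"
  by code_simp

lemma scheck_335: "scheck 3 3 5"
  by code_simp

lemma scheck_632: "scheck 6 3 2"
  by code_simp

lemma scheck_641: "scheck 6 4 1"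
  by code_simp

lemma scheck_551: "scheck 5 5 1"
  by code_simp

lemma hcheck_true: "hcheck"
  by code_simp

theorem theorem1:
  fixes ns :: "nat list"
  assumes "length ns \<ge> 1" and "sorted_wrt (\<ge>) ns" and "\<forall>m\<in>set ns. m \<ge> 1"
  shows "(let as = map (\<lambda>m. m - 1) ns in
      up_to_sign (ugb (S_mat as) :: ('k::field) mpoly set) \<noteq> up_to_sign (graver (S_mat as)) \<longleftrightarrow>
      dominates as [6] \<or> dominates as [5, 4] \<or> dominates as [4, 3, 2])
    \<and> (up_to_sign (ugb (H_mat ns) :: 'k mpoly set) \<noteq> up_to_sign (graver (H_mat ns)) \<longleftrightarrow>
      dominates ns [7] \<or> dominates ns [6, 2] \<or> dominates ns [4, 3])"
proof -
  note eqs = ugb_S_eq[OF scheck_443 scheck_335 scheck_632 scheck_641 scheck_551 assms(2,3)]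
    ugb_H_eq[OF hcheck_true scheck_641 assms(2)]
  show ?thesis
    \<comment> \<open>In the first family the arguments are the widths minus 1, so domination of
      S(6), S(5,4) or S(4,3,2) means widths of at least (7), (6, 5) or (5, 4, 3).\<close>
    unfolding Let_def eqs by (simp add: dominates_width width_map) linarith
qed

end
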